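(* Consider the mean field game described in the context. Suppose: (A) (1) For each measurable flow $\mu=(\mu_t)_{t\in[0,T]}$ of probability measures on $\mathcal B(\mathbb R)$ there exists a unique (up to indistinguishability) optimal pair $(X^\mu,\alpha^\mu)$; (2) there exist a continuous and strictly increasing function $\psi:[0,\infty)\to[0,\infty)$ with $\lim_{s\to\infty}\psi(s)=\infty$ and a constant $M>\psi(0)$ such that $\mathbb E[\psi(|X^\mu_t|)]\le M$ for all measurable flows $\mu$ of probability measures and all $t\in[0,T]$. (B) (Submodularity) For $\mathbb P\otimes dt$-a.a. $(\omega,t)\in\Omega\times[0,T]$, for $\phi\in\{f(t,\cdot,\cdot),g\}$, $$\phi(\bar x,\bar\mu)-\phi(x,\bar\mu)\le\phi(\bar x,\mu)-\phi(x,\mu)$$ for all $\bar x,x\in\mathbb R$ and $\bar\mu,\mu\in\mathcal P(\mathbb R)$ with $\bar x\ge x$ and $\bar\mu\ge^{\rm st}\mu$. (C) (1) The control set $U\subset\mathbb R$ is compact and there exists some $p>1$ such that $\mathbb E[|\xi|^p]<\infty$; (2) $b(t,x,a)=c_t+p_tx+q_ta$, where $c,p,q$ are deterministic and continuous in $t$, and the volatility $\sigma$ is constant; (3) the cost functions $f,g$ are continuous, and the cost function $l$ is convex and lower semicontinuous; (4) there exists a constant $C>0$ such that, with $p$ the exponent in (1), $|f(t,x,\mu)|+|l(t,x,a)|+|g(x,\mu)|\le C(1+|x|^p)$ for all $(t,x,a,\mu)\in[0,T]\times\mathbb R\times U\times[\mu^{\rm Min},\mu^{\rm Max}]$. Define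 sequences in $L$ by $\underline\mu^0:=\inf L$, $\overline\mu^0:=\sup L$, and $\underline\mu^{n+1}:=R(\underline\mu^n)$, $\overline\mu^{n+1}:=R(\overline\mu^n)$ for $n\ge0$. Then: (i) The sequence $(\underline\mu^n)_{n}$ is increasing in $(L,\le^{L})$ and it converges weakly to the minimal MFG solution, $\pi$-a.e. (that is, for $\pi$-a.e. $t\in[0,T]$, $\underline\mu^n_t$ converges weakly to the value at $t$ of the minimal MFG solution). (ii) The sequence $(\overline\mu^n)_{n}$ is decreasing in $(L,\le^{L})$ and it converges weakly to the maximal MFG solution, $\pi$-a.e.
   Context: Control problem. Fix $T>0$ and a Brownian motion $W=(W_t)_{t\in[0,T]}$ on a complete filtered probability space $(\Omega,\mathcal F,(\mathcal F_t)_{t\in[0,T]},\mathbb P)$. Let $\xi\in L^2(\Omega,\mathcal F_0,\mathbb P)$ and let $\sigma\ge0$ be the volatility. Let $U\subset\mathbb R$ be the control set and $\mathcal A$ the set of all square integrable progressively measurable processes $\alpha:\Omega\times[0,T]\to U$. For $\alpha\in\mathcal A$, $X^\alpha$ denotes the unique strong solution of $dX_t=b(t,X_t,\alpha_t)dt+\sigma dW_t$, $X_0=\xi$. $\mathcal P(\mathbb R)$ is the set of Borel probability measures on $\mathbb R$ with the topology of weak convergence. Costs are measurable functions $f:\Omega\times[0,T]\times\mathbb R\times\mathcal P(\mathbb R)\to\mathbb R$, $l:\Omega\times[0,T]\times\mathbb R\times U\to\mathbb R$, $g:\Omega\times\mathbb R\times\mathcal P(\mathbb R)\to\mathbb R$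 such that, for each $(x,\mu,a)$, the processes $f(\cdot,\cdot,x,\mu)$ and $l(\cdot,\cdot,x,a)$ are progressively measurable and $g(\cdot,x,\mu)$ is $\mathcal F_T$-measurable; the dependence on $\omega$ is suppressed in the notation. For a measurable flow $\mu=(\mu_t)_{t\in[0,T]}$ of probability measures on $\mathcal B(\mathbb R)$, $$J(\alpha,\mu)=\mathbb E\Big[\int_0^T[f(t,X^\alpha_t,\mu_t)+l(t,X^\alpha_t,\alpha_t)]dt+g(X^\alpha_T,\mu_T)\Big],\quad\alpha\in\mathcal A.$$ A pair $(X^\mu,\alpha^\mu)$ with $\alpha^\mu\in\mathcal A$ is an optimal pair for $\mu$ if $-\infty<J(\alpha^\mu,\mu)\le J(\alpha,\mu)$ for all $\alpha\in\mathcal A$ and $X^\mu=X^{\alpha^\mu}$. Order. Write $\mu(s):=\mu(-\infty,s]$. First order stochastic dominance: $\mu\le^{\rm st}\nu$ iff $\mu(s)\ge\nu(s)$ for all $s\in\mathbb R$. Lattice $L$. Under (A)(2), extend $\psi$ by $\psi(s)=\psi(0)$ for $s<0$ and let $\mu^{\rm Min},\mu^{\rm Max}\in\mathcal P(\mathbb R)$ have distribution functions: $\mu^{\rm Min}(s)=1$ if $\psi(-s)\le M$ and $\mu^{\rm Min}(s)=M/\psi(-s)$ otherwise; $\mu^{\rm Max}(s)=0$ if $\psi(s)\le M$ and $\mu^{\rm Max}(s)=1-M/\psi(s)$ otherwise. Then $\mu^{\rm Min}\le^{\rm st}\mathbb P\circ X^\mu_t\le^{\rm st}\mu^{\rm Max}$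 for all measurable flows $\mu$ and $t\in[0,T]$, where $\mathbb P\circ Z$ denotes the law of $Z$. Let $[\mu^{\rm Min},\mu^{\rm Max}]=\{\mu\in\mathcal P(\mathbb R):\mu^{\rm Min}\le^{\rm st}\mu\le^{\rm st}\mu^{\rm Max}\}$ and $\pi:=\delta_0+dt+\delta_T$ on $\mathcal B([0,T])$. $L$ is the set of $\pi$-equivalence classes of measurable flows $(\mu_t)_{t\in[0,T]}$ with $\mu_t\in[\mu^{\rm Min},\mu^{\rm Max}]$ for $\pi$-a.a. $t\in(0,T]$ and $\mu_0=\mathbb P\circ\xi$. Order on $L$: $\mu\le^{L}\nu$ iff $\mu_t\le^{\rm st}\nu_t$ for $\pi$-a.a. $t\in[0,T]$. $(L,\le^L)$ is a complete lattice. Best-response-map $R:L\to L$: $R(\mu):=(\mathbb P\circ X^\mu_t)_{t\in[0,T]}$. An MFG solution is a fixed point of $R$. The minimal (maximal) MFG solution is the least (greatest) element, with respect to $\le^L$, of the set of MFG solutions. *)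

theory Defs
  imports "HOL-Probability.Probability" "HOL-Algebra.Lattice"
begin

section \<open>Probability measures on the real line\<close>

text \<open>
  The set of Borel probability measures on the reals is \<open>space (prob_algebra borel)\<close>.  As a
  measurable space it carries the \<open>\<sigma>\<close>-algebra of \<^const>\<open>prob_algebra\<close>, which is generated by the
  evaluations at Borel sets and coincides with the Borel \<open>\<sigma>\<close>-algebra of the topology of weak
  convergence.
\<close>

abbreviation prob_measures :: "real measure set" where
  "prob_measures \<equiv> space (prob_algebra borel)"

text \<open>The coarsest topology making \<open>\<mu> \<mapsto> \<integral> \<phi> d\<mu>\<close> continuous for all bounded continuous \<open>\<phi>\<close>.\<close>

definition weak_topology :: "real measure topology" where
  "weak_topology = topology_generated_by
     {{\<mu> \<in> prob_measures. (\<integral>x. \<phi> x \<partial>\<mu>) \<in> V} | \<phi> V.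
        continuous_on UNIV \<phi> \<and> bounded (range \<phi>) \<and> open (V :: real set)}"

lemma real_distribution_iff_prob_measures: "real_distribution \<mu> \<longleftrightarrow> \<mu> \<in> prob_measures"
  by (auto simp: space_prob_algebra real_distribution_def real_distribution_axioms_def dest: sets_eq_imp_space_eq)

lemma limitin_weak_topology_iff:
  assumes "\<And>n. \<mu> n \<in> prob_measures" and "\<nu> \<in> prob_measures"
  shows "limitin weak_topology \<mu> \<nu> sequentially \<longleftrightarrow> weak_conv_m \<mu> \<nu>"
proof
  assume lim: "limitin weak_topology \<mu> \<nu> sequentially"
  show "weak_conv_m \<mu> \<nu>"
  proof (rule integral_bdd_continuous_conv_imp_weak_conv)
    fix \<phi> :: "real \<Rightarrow> real"
    assume \<phi>: "\<And>x. isCont \<phi> x" "\<And>x. \<bar>\<phi> x\<bar> \<le> 1"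
    show "(\<lambda>n. \<integral>x. \<phi> x \<partial>\<mu> n) \<longlonglongrightarrow> (\<integral>x. \<phi> x \<partial>\<nu>)"
    proof (rule topological_tendstoI)
      fix V :: "real set"
      assume V: "open V" "(\<integral>x. \<phi> x \<partial>\<nu>) \<in> V"
      have "bounded (range \<phi>)" using \<phi>(2) by (auto simp: bounded_iff)
      moreover have "continuous_on UNIV \<phi>"
        using \<phi>(1) by (simp add: continuous_on_eq_continuous_at)
      ultimately have "openin weak_topology {\<mu> \<in> prob_measures. (\<integral>x. \<phi> x \<partial>\<mu>) \<in> V}"
        unfolding weak_topology_def using V by (intro topology_generated_by_Basis) blast
      moreover have "\<nu> \<in> {\<mu> \<in> prob_measures. (\<integral>x. \<phi> x \<partial>\<mu>) \<in> V}"
        using V assms(2) by simp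
      ultimately have "\<forall>\<^sub>F n in sequentially. \<mu> n \<in> {\<mu> \<in> prob_measures. (\<integral>x. \<phi> x \<partial>\<mu>) \<in> V}"
        using lim unfolding limitin_def by blast
      then show "\<forall>\<^sub>F n in sequentially. (\<integral>x. \<phi> x \<partial>\<mu> n) \<in> V"
        by (rule eventually_mono) simp
    qed
  qed (use assms in \<open>auto simp: real_distribution_iff_prob_measures\<close>)
next
  assume conv: "weak_conv_m \<mu> \<nu>"
  have *: "\<forall>\<^sub>F n in sequentially. \<mu> n \<in> U"
    if "generate_topology_on {{\<mu> \<in> prob_measures. (\<integral>x. \<phi> x \<partial>\<mu>) \<in> V} | \<phi> V.
        continuous_on UNIV \<phi> \<and> bounded (range \<phi>) \<and> open (V :: real set)} U" "\<nu> \<in> U" for U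
    using that
  proof (induction rule: generate_topology_on.induct)
    case (Int a b)
    then show ?case by (auto intro: eventually_conj)
  next
    case (UN K)
    then obtain k where k: "k \<in> K" "\<nu> \<in> k" by auto
    show ?case by (rule eventually_mono[OF UN.IH[OF k]]) (use k(1) in auto)
  next
    case (Basis s)
    then obtain \<phi> :: "real \<Rightarrow> real" and V where s: "s = {\<mu> \<in> prob_measures. (\<integral>x. \<phi> x \<partial>\<mu>) \<in> V}"
      and \<phi>: "continuous_on UNIV \<phi>" "bounded (range \<phi>)" and V: "open V" by blast
    obtain B where B: "\<And>x. norm (\<phi> x) \<le> B" using \<phi>(2) by (auto simp: bounded_iff)
    have "(\<lambda>n. \<integral>x. \<phi> x \<partial>\<mu> n) \<longlonglongrightarrow> (\<integral>x. \<phi> x \<partial>\<nu>)"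
      by (rule weak_conv_imp_integral_bdd_continuous_conv[OF _ _ conv _ B])
         (use assms \<phi>(1) in \<open>simp_all add: real_distribution_iff_prob_measures continuous_on_eq_continuous_at\<close>)
    from topological_tendstoD[OF this V] have "\<forall>\<^sub>F n in sequentially. (\<integral>x. \<phi> x \<partial>\<mu> n) \<in> V"
      using Basis.prems by (simp add: s)
    then show ?case
      by (rule eventually_mono) (use assms(1) Basis.prems in \<open>auto simp: s\<close>)
  qed auto
  have "\<nu> \<in> topspace weak_topology"
    unfolding weak_topology_def topology_generated_by_topspace
    using assms(2) by (intro UnionI[of prob_measures] CollectI exI[of _ "\<lambda>_. 0"] exI[of _ UNIV]) auto
  then show "limitin weak_topology \<mu> \<nu> sequentially"
    using * unfolding limitin_def weak_topology_def openin_topology_generated_by_iff by blast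
qed

definition st_le :: "real measure \<Rightarrow> real measure \<Rightarrow> bool" (infix \<open>\<le>st\<close> 50) where
  "\<mu> \<le>st \<nu> \<longleftrightarrow> (\<forall>s. cdf \<mu> s \<ge> cdf \<nu> s)"

text \<open>\<^term>\<open>\<psi> (max 0 s)\<close> is the extension of \<open>\<psi>\<close> by \<open>\<psi> 0\<close> to the negative half-line.\<close>

definition mu_Min :: "(real \<Rightarrow> real) \<Rightarrow> real \<Rightarrow> real measure" where
  "mu_Min \<psi> M = interval_measure
     (\<lambda>s. if \<psi> (max 0 (- s)) \<le> M then 1 else M / \<psi> (max 0 (- s)))"

definition mu_Max :: "(real \<Rightarrow> real) \<Rightarrow> real \<Rightarrow> real measure" where
  "mu_Max \<psi> M = interval_measure
     (\<lambda>s. if \<psi> (max 0 s) \<le> M then 0 else 1 - M / \<psi> (max 0 s))"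

lemma
  assumes "continuous_on {0..} \<psi>" "strict_mono_on {0..} \<psi>" "\<forall>s\<ge>0. \<psi> s \<ge> (0::real)"
    "filterlim \<psi> at_top at_top" "M > \<psi> 0"
  shows cdf_mu_Min: "cdf (mu_Min \<psi> M) = (\<lambda>s. if \<psi> (max 0 (- s)) \<le> M then 1 else M / \<psi> (max 0 (- s)))"
    and cdf_mu_Max: "cdf (mu_Max \<psi> M) = (\<lambda>s. if \<psi> (max 0 s) \<le> M then 0 else 1 - M / \<psi> (max 0 s))"
proof -
  have M: "M > 0" using assms(3,5) by (meson le_less_trans order_refl)
  define \<Psi> where "\<Psi> s = \<psi> (max 0 s)" for s
  have cont: "continuous_on UNIV \<Psi>" unfolding \<Psi>_def
    by (intro continuous_on_compose2[OF assms(1)] continuous_intros) auto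
  have mono: "\<Psi> s \<le> \<Psi> t" if "s \<le> t" for s t
    unfolding \<Psi>_def using that by (intro monotone_onD[OF strict_mono_on_imp_mono_on[OF assms(2)]]) auto
  have top: "filterlim \<Psi> at_top at_top" 
    using assms(4)
    by (rule filterlim_cong[THEN iffD1, OF refl refl, rotated])
       (rule eventually_mono[OF eventually_ge_at_top[of 0]], simp add: \<Psi>_def)
  define h where "h s = M / max M (\<Psi> s)" for s
  have hcont: "continuous_on UNIV h" unfolding h_def
    by (intro continuous_intros cont) (use M in \<open>auto simp: max_def\<close>)
  have hanti: "h t \<le> h s" if "s \<le> t" for s t
    unfolding h_def using mono[OF that] M by (intro divide_left_mono) (auto simp: max_def)
  have htop: "(h \<longlongrightarrow> 0) at_top"
    unfolding h_def
    by (rule tendsto_divide_0[OF tendsto_const], rule filterlim_at_top_imp_at_infinity,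
        rule filterlim_at_top_mono[OF top], simp)
  have hbot: "(h \<longlongrightarrow> 1) at_bot"
    by (rule tendsto_eventually, rule eventually_mono[OF eventually_le_at_bot[of 0]])
       (use assms(5) M in \<open>auto simp: h_def \<Psi>_def max_def\<close>)
  have e1: "(\<lambda>s. if \<psi> (max 0 (- s)) \<le> M then 1 else M / \<psi> (max 0 (- s))) = (\<lambda>s. h (- s))"
    using M by (auto simp: h_def \<Psi>_def max_def fun_eq_iff)
  have e2: "(\<lambda>s. if \<psi> (max 0 s) \<le> M then 0 else 1 - M / \<psi> (max 0 s)) = (\<lambda>s. 1 - h s)"
    using M by (auto simp: h_def \<Psi>_def max_def fun_eq_iff)
  have c1: "continuous_on UNIV (\<lambda>s. h (- s))" and c2: "continuous_on UNIV (\<lambda>s. 1 - h s)"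
    by (auto intro!: continuous_on_compose2[OF hcont] continuous_on_minus continuous_on_diff continuous_on_id continuous_on_const hcont)
  have "((\<lambda>s. h (- s)) \<longlongrightarrow> 0) at_bot"
    by (rule filterlim_compose[OF htop filterlim_uminus_at_top_at_bot])
  then show "cdf (mu_Min \<psi> M) = (\<lambda>s. if \<psi> (max 0 (- s)) \<le> M then 1 else M / \<psi> (max 0 (- s)))"
    unfolding mu_Min_def e1 using c1 
    by - (rule cdf_interval_measure, rule hanti, simp, simp add: continuous_on_eq_continuous_at continuous_at_imp_continuous_at_within, assumption)
  have "((\<lambda>s. 1 - h s) \<longlongrightarrow> 1 - 1) at_bot" by (rule tendsto_diff[OF tendsto_const hbot])
  then show "cdf (mu_Max \<psi> M) = (\<lambda>s. if \<psi> (max 0 s) \<le> M then 0 else 1 - M / \<psi> (max 0 s))"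
    unfolding mu_Max_def e2 using c2
    by - (rule cdf_interval_measure, simp add: hanti, simp add: continuous_on_eq_continuous_at continuous_at_imp_continuous_at_within, simp)
qed

definition st_interval :: "(real \<Rightarrow> real) \<Rightarrow> real \<Rightarrow> real measure set" where
  "st_interval \<psi> M = {\<mu> \<in> prob_measures. mu_Min \<psi> M \<le>st \<mu> \<and> \<mu> \<le>st mu_Max \<psi> M}"

section \<open>Analytic notions\<close>

text \<open>
  Integral of an extended real valued function as the difference of the integrals of its positive
  and negative parts.  Subtraction on \<^typ>\<open>ereal\<close> makes \<open>\<infinity> - \<infinity> = \<infinity>\<close>, the usual convention for
  minimisation problems.
\<close>

definition ext_integral :: "'b measure \<Rightarrow> ('b \<Rightarrow> ereal) \<Rightarrow> ereal" where
  "ext_integral N h =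
     enn2ereal (\<integral>\<^sup>+ z. e2ennreal (h z) \<partial>N) - enn2ereal (\<integral>\<^sup>+ z. e2ennreal (- h z) \<partial>N)"

definition lsc_on :: "'b::topological_space set \<Rightarrow> ('b \<Rightarrow> real) \<Rightarrow> bool" where
  "lsc_on S h \<longleftrightarrow> (\<forall>z\<in>S. \<forall>c<h z. \<forall>\<^sub>F y in at z within S. c < h y)"

definition submodular :: "(real \<Rightarrow> real measure \<Rightarrow> real) \<Rightarrow> bool" where
  "submodular \<phi> \<longleftrightarrow>
     (\<forall>x x'. \<forall>\<mu>\<in>prob_measures. \<forall>\<mu>'\<in>prob_measures. x \<le> x' \<longrightarrow> \<mu> \<le>st \<mu>' \<longrightarrow>
        \<phi> x' \<mu>' - \<phi> x \<mu>' \<le> \<phi> x' \<mu> - \<phi> x \<mu>)"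

section \<open>Processes on the time interval from 0 to T\<close>

text \<open>
  Processes, filtrations and flows are indexed by all of \<^typ>\<open>real\<close>, but only their values on
  \<^term>\<open>{0..T}\<close> matter.
\<close>

definition filtration_upto :: "'a measure \<Rightarrow> real \<Rightarrow> (real \<Rightarrow> 'a measure) \<Rightarrow> bool" where
  "filtration_upto P T F \<longleftrightarrow>
     (\<forall>t\<in>{0..T}. subalgebra P (F t)) \<and>
     (\<forall>s t. 0 \<le> s \<longrightarrow> s \<le> t \<longrightarrow> t \<le> T \<longrightarrow> sets (F s) \<subseteq> sets (F t))"

definition progressive :: "real \<Rightarrow> (real \<Rightarrow> 'a measure) \<Rightarrow> (real \<Rightarrow> 'a \<Rightarrow> real) \<Rightarrow> bool" where
  "progressive T F Y \<longleftrightarrow>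
     (\<forall>t\<in>{0..T}. (\<lambda>(s, \<omega>). Y s \<omega>) \<in> borel_measurable (restrict_space borel {0..t} \<Otimes>\<^sub>M F t))"

definition brownian_motion ::
    "'a measure \<Rightarrow> real \<Rightarrow> (real \<Rightarrow> 'a measure) \<Rightarrow> (real \<Rightarrow> 'a \<Rightarrow> real) \<Rightarrow> bool" where
  "brownian_motion P T F W \<longleftrightarrow>
     (\<forall>t\<in>{0..T}. W t \<in> borel_measurable (F t)) \<and>
     (AE \<omega> in P. W 0 \<omega> = 0 \<and> continuous_on {0..T} (\<lambda>t. W t \<omega>)) \<and>
     (\<forall>s t. 0 \<le> s \<longrightarrow> s < t \<longrightarrow> t \<le> T \<longrightarrow>
        distributed P lborel (\<lambda>\<omega>. W t \<omega> - W s \<omega>) (normal_density 0 (sqrt (t - s))) \<and>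
        prob_space.indep_set P (sets (F s))
          (sets (vimage_algebra (space P) (\<lambda>\<omega>. W t \<omega> - W s \<omega>) borel)))"

definition time_measure :: "real \<Rightarrow> real measure" where
  "time_measure T = restrict_space lborel {0..T}"

text \<open>The measure \<open>\<delta>\<^sub>0 + dt + \<delta>\<^sub>T\<close> on the Borel sets of \<^term>\<open>{0..T}\<close>.\<close>

definition pi_measure :: "real \<Rightarrow> real measure" where
  "pi_measure T = measure_of {0..T} (sets (restrict_space borel {0..T}))
     (\<lambda>A. emeasure (return borel 0) A + emeasure lborel A + emeasure (return borel T) A)"

lemma emeasure_pi_measure:
  assumes "A \<in> sets (restrict_space borel {0..T})"
  shows "emeasure (pi_measure T) A = indicator A 0 + emeasure lborel A + indicator A T"
proof -
  have sub: "sets (restrict_space borel {0..T}) \<subseteq> sets (borel :: real measure)"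
    by (auto simp: sets_restrict_space)
  have sa: "sigma_algebra {0..T} (sets (restrict_space borel {0..T}))"
    using sets.sigma_algebra_axioms[of "restrict_space borel {0..T}"] by (simp add: space_restrict_space)
  have "emeasure (pi_measure T) A = emeasure (return borel 0) A + emeasure lborel A + emeasure (return borel T) A"
    unfolding pi_measure_def
  proof (rule emeasure_measure_of_sigma[OF sa _ _ assms])
    show "positive (sets (restrict_space borel {0..T}))
       (\<lambda>A. emeasure (return borel 0) A + emeasure lborel A + emeasure (return borel T) A)"
      by (simp add: positive_def)
    show "countably_additive (sets (restrict_space borel {0..T}))
       (\<lambda>A. emeasure (return borel 0) A + emeasure lborel A + emeasure (return borel T) A)"
    proof (rule countably_additiveI)
      fix X :: "nat \<Rightarrow> real set"
      assume X: "range X \<subseteq> sets (restrict_space borel {0..T})" "disjoint_family X"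
      then have "range X \<subseteq> sets borel" using sub by (metis order_trans)
      then show "(\<Sum>i. emeasure (return borel 0) (X i) + emeasure lborel (X i) + emeasure (return borel T) (X i))
        = emeasure (return borel 0) (\<Union>i. X i) + emeasure lborel (\<Union>i. X i) + emeasure (return borel T) (\<Union>i. X i)"
        using X(2) by (simp add: suminf_add[symmetric] suminf_emeasure del: emeasure_return)
    qed
  qed
  moreover have "A \<in> sets borel" using assms sub by blast
  ultimately show ?thesis by simp
qed

text \<open>Measurable flows of probability measures.\<close>

definition flows :: "real \<Rightarrow> (real \<Rightarrow> real measure) set" where
  "flows T = restrict_space borel {0..T} \<rightarrow>\<^sub>M prob_algebra borel"

definition flow_eq :: "real \<Rightarrow> ((real \<Rightarrow> real measure) \<times> (real \<Rightarrow> real measure)) set" where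
  "flow_eq T = {(\<mu>, \<nu>). \<mu> \<in> flows T \<and> \<nu> \<in> flows T \<and> (AE t in pi_measure T. \<mu> t = \<nu> t)}"

section \<open>The mean field game\<close>

text \<open>
  Processes take the time argument first.  The running costs \<open>cost_f\<close>, \<open>cost_l\<close> take time,
  scenario and state followed by the measure and by the control, respectively.
\<close>

record 'a mfg =
  prob_sp :: "'a measure"
  filt :: "real \<Rightarrow> 'a measure"
  horizon :: real
  noise :: "real \<Rightarrow> 'a \<Rightarrow> real"
  init_state :: "'a \<Rightarrow> real"
  volatility :: real
  drift :: "real \<Rightarrow> real \<Rightarrow> real \<Rightarrow> real"
  control_set :: "real set"
  cost_f :: "real \<Rightarrow> 'a \<Rightarrow> real \<Rightarrow> real measure \<Rightarrow> real"
  cost_l :: "real \<Rightarrow> 'a \<Rightarrow> real \<Rightarrow> real \<Rightarrow> real"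
  cost_g :: "'a \<Rightarrow> real \<Rightarrow> real measure \<Rightarrow> real"

text \<open>Standing assumptions on the data, apart from those on the drift.\<close>

definition mfg_game :: "'a mfg \<Rightarrow> bool" where
  "mfg_game G \<longleftrightarrow>
     (let P = prob_sp G; F = filt G; T = horizon G; U = control_set G in
      0 < T \<and> prob_space P \<and> complete_measure P \<and>
      filtration_upto P T F \<and> null_sets P \<subseteq> sets (F 0) \<and>
      brownian_motion P T F (noise G) \<and>
      init_state G \<in> borel_measurable (F 0) \<and> integrable P (\<lambda>\<omega>. (init_state G \<omega>)\<^sup>2) \<and>
      0 \<le> volatility G \<and>
      (\<lambda>(t, \<omega>, x, \<mu>). cost_f G t \<omega> x \<mu>) \<in> borel_measurable
        (restrict_space borel {0..T} \<Otimes>\<^sub>M P \<Otimes>\<^sub>M borel \<Otimes>\<^sub>M prob_algebra borel) \<and>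
      (\<lambda>(t, \<omega>, x, a). cost_l G t \<omega> x a) \<in> borel_measurable
        (restrict_space borel {0..T} \<Otimes>\<^sub>M P \<Otimes>\<^sub>M borel \<Otimes>\<^sub>M restrict_space borel U) \<and>
      (\<lambda>(\<omega>, x, \<mu>). cost_g G \<omega> x \<mu>) \<in> borel_measurable
        (P \<Otimes>\<^sub>M borel \<Otimes>\<^sub>M prob_algebra borel) \<and>
      (\<forall>x. \<forall>\<mu>\<in>prob_measures. progressive T F (\<lambda>t \<omega>. cost_f G t \<omega> x \<mu>)) \<and>
      (\<forall>x. \<forall>a\<in>U. progressive T F (\<lambda>t \<omega>. cost_l G t \<omega> x a)) \<and>
      (\<forall>x. \<forall>\<mu>\<in>prob_measures. (\<lambda>\<omega>. cost_g G \<omega> x \<mu>) \<in> borel_measurable (F T)))"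

definition admissible :: "'a mfg \<Rightarrow> (real \<Rightarrow> 'a \<Rightarrow> real) set" where
  "admissible G = {\<alpha>. progressive (horizon G) (filt G) \<alpha> \<and>
     (\<forall>t\<in>{0..horizon G}. \<forall>\<omega>\<in>space (prob_sp G). \<alpha> t \<omega> \<in> control_set G) \<and>
     integrable (time_measure (horizon G) \<Otimes>\<^sub>M prob_sp G) (\<lambda>(t, \<omega>). (\<alpha> t \<omega>)\<^sup>2)}"

text \<open>
  The volatility is constant, so \<open>\<integral> \<sigma> dW\<close> over the interval from 0 to \<open>t\<close> is \<open>\<sigma> W\<^sub>t\<close>.
\<close>

definition strong_solution ::
    "'a mfg \<Rightarrow> (real \<Rightarrow> 'a \<Rightarrow> real) \<Rightarrow> (real \<Rightarrow> 'a \<Rightarrow> real) \<Rightarrow> bool" where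
  "strong_solution G \<alpha> X \<longleftrightarrow>
     (\<forall>t\<in>{0..horizon G}. X t \<in> borel_measurable (filt G t)) \<and>
     (\<forall>\<omega>\<in>space (prob_sp G). continuous_on {0..horizon G} (\<lambda>t. X t \<omega>)) \<and>
     (AE \<omega> in prob_sp G. \<forall>t\<in>{0..horizon G}.
        set_integrable lborel {0..t} (\<lambda>s. drift G s (X s \<omega>) (\<alpha> s \<omega>)) \<and>
        X t \<omega> = init_state G \<omega> + (LBINT s:{0..t}. drift G s (X s \<omega>) (\<alpha> s \<omega>))
                 + volatility G * noise G t \<omega>)"

definition state :: "'a mfg \<Rightarrow> (real \<Rightarrow> 'a \<Rightarrow> real) \<Rightarrow> real \<Rightarrow> 'a \<Rightarrow> real" where
  "state G \<alpha> = (SOME X. strong_solution G \<alpha> X)"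

definition cost ::
    "'a mfg \<Rightarrow> (real \<Rightarrow> 'a \<Rightarrow> real) \<Rightarrow> (real \<Rightarrow> real measure) \<Rightarrow> ereal" where
  "cost G \<alpha> \<mu> =
     (let T = horizon G; X = state G \<alpha> in
      ext_integral (prob_sp G) (\<lambda>\<omega>.
        ext_integral (time_measure T)
          (\<lambda>t. ereal (cost_f G t \<omega> (X t \<omega>) (\<mu> t) + cost_l G t \<omega> (X t \<omega>) (\<alpha> t \<omega>)))
        + ereal (cost_g G \<omega> (X T \<omega>) (\<mu> T))))"

definition optimal_pair ::
    "'a mfg \<Rightarrow> (real \<Rightarrow> real measure) \<Rightarrow> (real \<Rightarrow> 'a \<Rightarrow> real) \<Rightarrow> (real \<Rightarrow> 'a \<Rightarrow> real) \<Rightarrow> bool" where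
  "optimal_pair G \<mu> X \<alpha> \<longleftrightarrow>
     \<alpha> \<in> admissible G \<and> strong_solution G \<alpha> X \<and> - \<infinity> < cost G \<alpha> \<mu> \<and>
     (\<forall>\<beta>\<in>admissible G. cost G \<alpha> \<mu> \<le> cost G \<beta> \<mu>)"

text \<open>
  State processes are identified up to indistinguishability, controls up to \<open>dt \<otimes> P\<close>-null sets.
\<close>

definition unique_optimal_pair :: "'a mfg \<Rightarrow> (real \<Rightarrow> real measure) \<Rightarrow> bool" where
  "unique_optimal_pair G \<mu> \<longleftrightarrow>
     (\<exists>X \<alpha>. optimal_pair G \<mu> X \<alpha> \<and>
       (\<forall>Y \<beta>. optimal_pair G \<mu> Y \<beta> \<longrightarrow>
          (AE \<omega> in prob_sp G. \<forall>t\<in>{0..horizon G}. Y t \<omega> = X t \<omega>) \<and>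
          (AE (t, \<omega>) in time_measure (horizon G) \<Otimes>\<^sub>M prob_sp G. \<beta> t \<omega> = \<alpha> t \<omega>)))"

definition optimal_state :: "'a mfg \<Rightarrow> (real \<Rightarrow> real measure) \<Rightarrow> real \<Rightarrow> 'a \<Rightarrow> real" where
  "optimal_state G \<mu> = (SOME X. \<exists>\<alpha>. optimal_pair G \<mu> X \<alpha>)"

section \<open>The lattice and the best-response map\<close>

definition lattice_flows ::
    "'a mfg \<Rightarrow> (real \<Rightarrow> real) \<Rightarrow> real \<Rightarrow> (real \<Rightarrow> real measure) set" where
  "lattice_flows G \<psi> M = {\<mu> \<in> flows (horizon G).
     (AE t in pi_measure (horizon G). t \<in> {0<..horizon G} \<longrightarrow> \<mu> t \<in> st_interval \<psi> M) \<and>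
     \<mu> 0 = distr (prob_sp G) borel (init_state G)}"

text \<open>Elements are equivalence classes, so the equality of the order structure is genuine equality.\<close>

definition flow_lattice ::
    "'a mfg \<Rightarrow> (real \<Rightarrow> real) \<Rightarrow> real \<Rightarrow> (real \<Rightarrow> real measure) set gorder" where
  "flow_lattice G \<psi> M =
     \<lparr>carrier = lattice_flows G \<psi> M // flow_eq (horizon G), eq = (=),
      le = (\<lambda>A B. \<exists>\<mu>\<in>A. \<exists>\<nu>\<in>B. AE t in pi_measure (horizon G). \<mu> t \<le>st \<nu> t)\<rparr>"

text \<open>
  The best-response map is lifted to equivalence classes; it respects \<^const>\<open>flow_eq\<close>, because the
  cost functional depends on the flow only through its equivalence class.
\<close>

definition best_response ::
    "'a mfg \<Rightarrow> (real \<Rightarrow> real measure) set \<Rightarrow> (real \<Rightarrow> real measure) set" where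
  "best_response G A =
     (\<Union>\<mu>\<in>A. flow_eq (horizon G) `` {\<lambda>t. distr (prob_sp G) borel (optimal_state G \<mu> t)})"

definition mfg_solutions ::
    "'a mfg \<Rightarrow> (real \<Rightarrow> real) \<Rightarrow> real \<Rightarrow> (real \<Rightarrow> real measure) set set" where
  "mfg_solutions G \<psi> M = {A \<in> carrier (flow_lattice G \<psi> M). best_response G A = A}"

text \<open>Weak convergence almost everywhere, for every choice of representatives.\<close>

definition weak_conv_ae ::
    "real \<Rightarrow> (nat \<Rightarrow> (real \<Rightarrow> real measure) set) \<Rightarrow> (real \<Rightarrow> real measure) set \<Rightarrow> bool" where
  "weak_conv_ae T A B \<longleftrightarrow>
     (\<forall>\<mu> \<nu>. (\<forall>n. \<mu> n \<in> A n) \<longrightarrow> \<nu> \<in> B \<longrightarrow>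
        (AE t in pi_measure T. weak_conv_m (\<lambda>n. \<mu> n t) (\<nu> t)))"

end

theory Submission
  imports Defs
begin

text \<open>Iterating the best response from an extreme point of the lattice converges to the extreme fixed
  point because the best response is monotone, and continuous along its own monotone iterations.

  \<^emph>\<open>Monotonicity.\<close>  Let \<open>X\<close> and \<open>Y\<close> be the optimal states for flows \<open>\<mu>\<close> and \<open>\<nu>\<close> with \<open>\<mu>\<close> below \<open>\<nu>\<close>.  The
  noise is additive, so \<open>X - Y\<close> is an integral, and \<open>max X Y\<close> and \<open>min X Y\<close> are again states: their
  controls switch between the two given ones according to which state is larger
  (\<open>max_min_strong_solution\<close>, by \<open>positive_part_integral\<close>).  Replacing the pair \<open>(X, Y)\<close> by
  \<open>(min X Y, max X Y)\<close> leaves the total control cost unchanged, and by submodularity it does not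
  increase the total of the flow-dependent costs.  Since \<open>min X Y\<close> cannot beat \<open>X\<close> for \<open>\<mu>\<close>, the maximum
  is optimal for \<open>\<nu>\<close>, and uniqueness gives \<open>max X Y = Y\<close>.  So the optimal states are ordered
  path by path (\<open>optimal_state_mono\<close>), which is stronger than the stochastic order of their laws.

  \<^emph>\<open>Passage to the limit.\<close>  Along the iteration the optimal states are therefore monotone in \<open>n\<close> for
  every time and almost every scenario.  They are bounded by an envelope that does not depend on the
  control (\<open>strong_solution_bound\<close>, by Gronwall), hence they converge.  The controls need not
  converge, but suitable convex combinations of their tails do: this is the minimal norm argument in a
  Hilbert space, followed by the passage to an almost everywhere convergent subsequence
  (\<open>midpoint_tails_AE_convergent\<close>).  The state depends affinely on the control, so the same
  combinations of the states solve the state equation, and they have the same limit as the states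
  themselves; the limit state thus belongs to the limit control (\<open>limit_strong_solution\<close>).  The costs \<open>f\<close> and
  \<open>g\<close> pass to the limit by dominated convergence, since the envelope has a finite moment of order \<open>r\<close>
  (Gaussian moments).  Convexity and lower semicontinuity of \<open>l\<close> bound the limiting control cost by
  those along the sequence.  The limit state is therefore optimal for the flow of its own laws
  (\<open>limit_optimal\<close>), which is to say that this flow is a fixed point of the best response.

  \<^emph>\<open>Extremality.\<close>  The iteration from the bottom starts below every fixed point, and monotonicity keeps
  its optimal states below the optimal state of that fixed point; hence so is their limit.  The
  iteration from the top is the same argument with the order reversed, and
  \<open>iteration_from_extreme\<close> treats both directions at once.\<close>

section \<open>Paths: Gronwall, positive parts and linear equations\<close>

lemma gronwall_integral:
  fixes u :: "real \<Rightarrow> real"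
  assumes cont: "continuous_on {0..T} u" and K: "0 \<le> K"
    and le: "\<And>t. t \<in> {0..T} \<Longrightarrow> u t \<le> A + K * (LBINT s:{0..t}. u s)"
    and t: "t \<in> {0..T}"
  shows "u t \<le> A * exp (K * t)"
proof -
  \<comment> \<open>The bound itself, discounted at rate \<open>K\<close>, is nonincreasing.\<close>
  define H where "H s = exp (- K * s) * (A + K * integral {0..s} u)" for s
  have eq: "(LBINT s:{0..x}. u s) = integral {0..x} u" if "x \<in> {0..T}" for x
    by (rule set_borel_integral_eq_integral, rule borel_integrable_atLeastAtMost')
       (use cont that in \<open>auto elim: continuous_on_subset\<close>)
  have contI: "continuous_on {0..T} (\<lambda>s. integral {0..s} u)"
    by (rule indefinite_integral_continuous_1, rule integrable_continuous_real, rule cont)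
  have "H t \<le> H 0"
  proof (cases "t = 0")
    case False
    show ?thesis
    proof (rule DERIV_nonpos_imp_decreasing_open[where f=H])
      show "0 \<le> t" using t by auto
      show "continuous_on {0..t} H"
        unfolding H_def using t
        by (intro continuous_intros continuous_on_subset[OF contI]) auto
      fix x assume x: "0 < x" "x < t"
      have "((\<lambda>s. integral {0..s} u) has_vector_derivative u x) (at x within {0..T})"
        by (rule integral_has_vector_derivative[OF cont]) (use x t in auto)
      then have d: "((\<lambda>s. integral {0..s} u) has_real_derivative u x) (at x)"
        using x t by (subst (asm) at_within_Icc_at)
          (auto simp: has_real_derivative_iff_has_vector_derivative)
      have "(H has_real_derivative
          exp (- K * x) * (K * u x) - K * exp (- K * x) * (A + K * integral {0..x} u)) (at x)"
        unfolding H_def by (auto intro!: derivative_eq_intros d simp: algebra_simps)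
      moreover have "u x \<le> A + K * integral {0..x} u" using le[of x] eq[of x] x t by auto
      then have "exp (- K * x) * K * u x \<le> exp (- K * x) * K * (A + K * integral {0..x} u)"
        using K by (intro mult_left_mono) auto
      ultimately show "\<exists>y. (H has_real_derivative y) (at x) \<and> y \<le> 0"
        by (auto simp: algebra_simps)
    qed
  qed simp
  then have "exp (- K * t) * (A + K * integral {0..t} u) \<le> A" by (simp add: H_def)
  then have "A + K * integral {0..t} u \<le> A * exp (K * t)"
    by (simp add: exp_minus field_simps)
  with le[OF t] eq[OF t] show ?thesis by simp
qed

text \<open>The open set on which \<open>F\<close> is positive is a countable disjoint union of intervals.  By maximality \<open>F\<close>
  vanishes at both ends of each of them, so \<open>h\<close> integrates to zero over each.\<close>

lemma positive_excursions_integral_zero: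
  fixes h F :: "real \<Rightarrow> real"
  assumes int: "set_integrable lborel {0..T} h" and cont: "continuous_on {0..T} F"
    and F: "\<And>t. t \<in> {0..T} \<Longrightarrow> F t = (LBINT s:{0..t}. h s)"
    and a: "a \<in> {0..T}" "F a \<le> 0"
  shows "(LBINT s:{s\<in>{0<..<a}. F s > 0}. h s) = 0"
proof -
  define O' where "O' = {s\<in>{0<..<a}. F s > 0}"
  have "open ({0<..<a} \<inter> F -` {0<..})"
    using continuous_on_subset[OF cont, of "{0<..<a}"] a
    by (intro continuous_open_preimage) (auto simp: subset_eq)
  moreover have "O' = {0<..<a} \<inter> F -` {0<..}" by (auto simp: O'_def)
  ultimately have opO: "open O'" by simp
  have sub: "O' \<subseteq> {0..T}" using a by (auto simp: O'_def)
  have intC: "set_integrable lborel C h" if "open C" "C \<subseteq> O'" for C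
    by (rule set_integrable_subset[OF int]) (use that sub in auto)
  have F0: "F 0 = 0"
  proof -
    have "(LBINT s:{0..0}. h s) = 0"
      unfolding set_lebesgue_integral_def
      by (rule integral_eq_zero_AE, rule AE_mp[OF AE_lborel_singleton[of 0]])
         (auto simp: indicator_def)
    then show ?thesis using F[of 0] a by simp
  qed
  have zero: "(LBINT s:C. h s) = 0" if C: "C \<in> components O'" for C
  proof -
    have opC: "open C" using C opO by (rule open_components[rotated])
    have CO: "C \<subseteq> O'" "C \<noteq> {}" "connected C"
      using C in_components_subset in_components_nonempty in_components_connected by auto
    have bdd: "bdd_above C" "bdd_below C"
      using CO(1) by (auto simp: O'_def intro!: bdd_aboveI[of _ a] bdd_belowI[of _ 0])
    define x y where "x = Inf C" and "y = Sup C"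
    have Ceq: "C = {x<..<y}"
    proof (intro equalityI subsetI)
      fix z assume z: "z \<in> C"
      obtain e where e: "e > 0" "cball z e \<subseteq> C" using opC z open_contains_cball by blast
      then have "z - e \<in> C" "z + e \<in> C" by (auto simp: dist_real_def subset_eq)
      then have "x \<le> z - e" "z + e \<le> y"
        using bdd by (auto simp: x_def y_def intro: cInf_lower cSup_upper)
      then show "z \<in> {x<..<y}" using e by auto
    next
      fix z assume z: "z \<in> {x<..<y}"
      obtain c1 c2 where "c1 \<in> C" "c1 < z" "c2 \<in> C" "z < c2"
        using z bdd CO(2) unfolding x_def y_def
        by (metis cInf_less_iff greaterThanLessThan_iff less_cSup_iff)
      then show "z \<in> C" using connected_contains_Icc[OF CO(3)] by fastforce
    qed
    have xy: "x < y" using CO(2) Ceq by auto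
    have clo: "closure C = {x..y}" using Ceq xy by simp
    have "C \<subseteq> {0..a}" using CO(1) by (auto simp: O'_def)
    then have xya: "{x..y} \<subseteq> {0..a}" using clo closure_minimal[of C "{0..a}"] by simp
    have xya': "0 \<le> x" "y \<le> a" using xya xy by auto
    have ge: "0 \<le> F z" if "z \<in> {x..y}" for z
    proof -
      have "continuous_on (closure C) F"
        by (rule continuous_on_subset[OF cont]) (use clo xya a in auto)
      then show ?thesis
        by (rule continuous_ge_on_closure) (use that clo CO(1) in \<open>auto simp: O'_def\<close>)
    qed
    \<comment> \<open>An end point with \<open>F > 0\<close> could be added to the component.\<close>
    have ext: "F z \<le> 0" if "z = x \<or> z = y" for z
    proof (rule ccontr)
      assume pos: "\<not> F z \<le> 0"
      have "z \<in> O'"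
        using that pos F0 a(2) xya' xy unfolding O'_def
        by (smt (verit) greaterThanLessThan_iff mem_Collect_eq)
      have "connected (insert z C)"
        using that xy by (intro connected_intermediate_closure[OF CO(3)]) (auto simp: clo Ceq)
      then have "insert z C \<subseteq> C"
        using \<open>z \<in> O'\<close> CO C components_maximal[OF C] by blast
      then show False using that Ceq by auto
    qed
    have eqF: "F x = 0" "F y = 0" using ge[of x] ge[of y] ext xy by force+
    have "(LBINT s:{0..y}. h s) = (LBINT s:{0..x} \<union> {x<..y}. h s)"
      using xya' xy by (intro arg_cong[where f="\<lambda>A. set_lebesgue_integral lborel A h"]) auto
    also have "\<dots> = (LBINT s:{0..x}. h s) + (LBINT s:{x<..y}. h s)"
      by (rule set_integral_Un) (use xya' xy a in \<open>auto intro!: set_integrable_subset[OF int]\<close>)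
    finally have "(LBINT s:{x<..y}. h s) = 0"
      using F[of x] F[of y] eqF xya' xy a by auto
    moreover have "(LBINT s:{x<..y}. h s) = (LBINT s:C. h s)"
      unfolding set_lebesgue_integral_def Ceq
    proof (rule integral_cong_AE)
      show "(\<lambda>s. indicator {x<..y} s *\<^sub>R h s) \<in> borel_measurable lborel"
        "(\<lambda>s. indicator {x<..<y} s *\<^sub>R h s) \<in> borel_measurable lborel"
        using set_integrable_subset[OF int, of "{x<..y}"] set_integrable_subset[OF int, of "{x<..<y}"] xya' a
        by (auto simp: set_integrable_def subset_eq intro!: borel_measurable_integrable)
    qed (use AE_lborel_singleton[of y] in \<open>auto simp: indicator_def\<close>)
    ultimately show ?thesis by simp
  qed
  \<comment> \<open>Countable additivity is used for the measures with densities the positive part of \<open>h\<close>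
    (\<open>k = 1\<close>) and its negative part (\<open>k = -1\<close>), which agree on each component.\<close>
  define m where "m k = density lborel (\<lambda>s. ennreal (k * (indicator {0..T} s * h s)))" for k :: real
  have meas[measurable]: "(\<lambda>s. indicator {0..T} s * h s) \<in> borel_measurable borel"
    using int by (auto simp: set_integrable_def)
  have mC: "emeasure (m k) C = (\<integral>\<^sup>+s. ennreal (k * (indicator C s * h s)) \<partial>lborel)"
    if "C \<subseteq> O'" "open C" for C k
  proof -
    have "emeasure (m k) C = (\<integral>\<^sup>+s. ennreal (k * (indicator {0..T} s * h s)) * indicator C s \<partial>lborel)"
      unfolding m_def using that(2) by (intro emeasure_density) auto
    also have "\<dots> = (\<integral>\<^sup>+s. ennreal (k * (indicator C s * h s)) \<partial>lborel)"
      by (rule nn_integral_cong) (use that(1) sub in \<open>auto simp: indicator_def subset_eq\<close>)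
    finally show ?thesis .
  qed
  have intC': "integrable lborel (\<lambda>s. indicator C s * h s)" if "open C" "C \<subseteq> O'" for C
    using intC[OF that] by (simp add: set_integrable_def)
  have split: "(LBINT s:C. h s) = enn2real (emeasure (m 1) C) - enn2real (emeasure (m (-1)) C)"
    if "open C" "C \<subseteq> O'" for C
    unfolding set_lebesgue_integral_def real_scaleR_def
    by (subst real_lebesgue_integral_def[OF intC'[OF that]]) (simp add: mC that)
  have finm: "emeasure (m k) C < \<infinity>" if "open C" "C \<subseteq> O'" "k = 1 \<or> k = -1" for C k
  proof -
    have "integrable lborel (\<lambda>s. k * (indicator C s * h s))"
      by (rule integrable_mult_right[OF intC'[OF that(1,2)]])
    from integrableD(2)[OF this] show ?thesis
      unfolding mC[OF that(2,1)] by (simp add: less_top)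
  qed
  have eqm: "emeasure (m 1) C = emeasure (m (-1)) C" if C: "C \<in> components O'" for C
  proof -
    have C': "open C" "C \<subseteq> O'"
      using C opO in_components_subset open_components by auto
    have "enn2real (emeasure (m 1) C) = enn2real (emeasure (m (-1)) C)"
      using zero[OF C] split[OF C'] by simp
    then show ?thesis
      using finm[OF C', of 1] finm[OF C', of "-1"]
      by (metis ennreal_enn2real infinity_ennreal_def)
  qed
  have opc: "open C" if "C \<in> components O'" for C
    using that opO open_components by auto
  have cnt: "countable (components O')"
    by (rule countable_disjoint_open_subsets[OF opc])
       (use pairwise_disjoint_components in \<open>auto simp: pairwise_def disjnt_def\<close>)
  have sum: "emeasure (m k) O' = (\<integral>\<^sup>+C. emeasure (m k) C \<partial>count_space (components O'))" for k
    using emeasure_UN_countable[of "components O'" "\<lambda>C. C" "m k"] cnt opc pairwise_disjoint_components[of O']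
    by (auto simp: m_def disjoint_family_on_def pairwise_def)
  have "emeasure (m 1) O' = emeasure (m (-1)) O'"
    unfolding sum by (rule nn_integral_cong) (simp add: eqm)
  then show ?thesis unfolding O'_def[symmetric]
    using split[OF opO] by simp
qed

text \<open>Chain rule for the positive part of an absolutely continuous function.  Up to its last zero the
  excursions contribute nothing, and from there on \<open>F\<close> is positive and all of \<open>h\<close> counts.\<close>

lemma positive_part_integral:
  fixes h F :: "real \<Rightarrow> real"
  assumes int: "set_integrable lborel {0..T} h" and cont: "continuous_on {0..T} F"
    and F: "\<And>t. t \<in> {0..T} \<Longrightarrow> F t = (LBINT s:{0..t}. h s)"
    and t: "t \<in> {0..T}"
  shows "set_integrable lborel {0..t} (\<lambda>s. if F s > 0 then h s else 0)"
    and "(LBINT s:{0..t}. if F s > 0 then h s else 0) = max 0 (F t)"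
proof -
  have [measurable]: "(\<lambda>s. indicator {0..T} s * h s) \<in> borel_measurable borel"
    using int by (auto simp: set_integrable_def)
  have posm: "{s\<in>{0..T}. F s > 0} \<in> sets borel"
  proof -
    have "(\<lambda>s. indicator {0..T} s *\<^sub>R F s) \<in> borel_measurable borel"
      using cont by (intro borel_measurable_continuous_on_indicator) auto
    then have "{s\<in>space borel. indicator {0..T} s *\<^sub>R F s > 0} \<in> sets borel" by measurable
    also have "{s\<in>space borel. indicator {0..T} s *\<^sub>R F s > 0} = {s\<in>{0..T}. F s > 0}"
      by (auto simp: indicator_def split: if_splits)
    finally show ?thesis .
  qed
  have intp: "set_integrable lborel {s\<in>{0..T}. F s > 0} h"
    by (rule set_integrable_subset[OF int]) (use posm in auto)
  have intB: "set_integrable lborel {s\<in>B. F s > 0} h" if "B \<in> sets borel" "B \<subseteq> {0..T}" for B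
  proof (rule set_integrable_subset[OF intp])
    have "{s\<in>B. F s > 0} = B \<inter> {s\<in>{0..T}. F s > 0}" using that by auto
    then show "{s\<in>B. F s > 0} \<in> sets lborel" using posm that by auto
  qed (use that in auto)
  have eqB: "indicator B s *\<^sub>R (if F s > 0 then h s else 0) = indicator {s\<in>B. F s > 0} s *\<^sub>R h s" for B s
    by (simp add: indicator_def)
  show "set_integrable lborel {0..t} (\<lambda>s. if F s > 0 then h s else 0)"
    using intB[of "{0..t}"] t unfolding set_integrable_def eqB by auto
  have upto: "(LBINT s:{s\<in>{0..a}. F s > 0}. h s) = 0" if a: "a \<in> {0..T}" "F a \<le> 0" for a
  proof -
    have "(LBINT s:{s\<in>{0..a}. F s > 0}. h s) = (LBINT s:{s\<in>{0<..<a}. F s > 0}. h s)"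
      unfolding set_lebesgue_integral_def
      by (rule integral_cong_AE)
         (use a intB[of "{0..a}"] intB[of "{0<..<a}"] AE_lborel_singleton[of 0] AE_lborel_singleton[of a]
           in \<open>auto simp: set_integrable_def indicator_def subset_eq\<close>)
    then show ?thesis using positive_excursions_integral_zero[OF int cont F a] by simp
  qed
  have F0: "F 0 \<le> 0"
  proof -
    have "(LBINT s:{0..0}. h s) = 0"
      unfolding set_lebesgue_integral_def
      by (rule integral_eq_zero_AE, rule AE_mp[OF AE_lborel_singleton[of 0]])
         (auto simp: indicator_def)
    then show ?thesis using F[of 0] t by simp
  qed
  have "(LBINT s:{s\<in>{0..t}. F s > 0}. h s) = max 0 (F t)"
  proof (cases "F t \<le> 0")
    case True
    then show ?thesis using upto[OF t] by simp
  next
    case False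
    \<comment> \<open>The supremum of this set is the last zero of \<open>F\<close> before \<open>t\<close>.\<close>
    define Z where "Z = {s\<in>{0..t}. F s \<le> 0}"
    have "closed ({0..t} \<inter> F -` {..0})"
      using t by (intro continuous_closed_preimage continuous_on_subset[OF cont]) auto
    moreover have "Z = {0..t} \<inter> F -` {..0}" by (auto simp: Z_def)
    ultimately have "closed Z" by simp
    moreover have "Z \<noteq> {}" "bdd_above Z"
      using F0 t by (auto simp: Z_def intro!: exI[of _ 0] bdd_aboveI[of _ t])
    ultimately have aZ: "Sup Z \<in> Z" by (intro closed_contains_Sup)
    define a where "a = Sup Z"
    have a: "0 \<le> a" "a < t" "F a \<le> 0"
      using aZ False by (auto simp: Z_def a_def order.strict_iff_order)
    have pos: "F s > 0" if "a < s" "s \<le> t" for s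
    proof (rule ccontr)
      assume "\<not> 0 < F s"
      then have "s \<in> Z" using that a(1) by (auto simp: Z_def)
      then show False using cSup_upper[OF _ \<open>bdd_above Z\<close>, of s] that by (simp add: a_def)
    qed
    have "F a = 0"
    proof (rule ccontr)
      assume "F a \<noteq> 0"
      then have "F a < 0" using a by simp
      moreover have "continuous_on {a..t} F" using a t by (intro continuous_on_subset[OF cont]) auto
      ultimately obtain z where "a \<le> z" "z \<le> t" "F z = 0"
        using IVT'[of F a 0 t] a False by auto
      then show False using pos[of z] \<open>F a < 0\<close> by (cases "z = a") auto
    qed
    have "(LBINT s:{s\<in>{0..t}. F s > 0}. h s) = (LBINT s:{s\<in>{0..a}. F s > 0} \<union> {a<..t}. h s)"
      using a pos by (intro arg_cong[where f="\<lambda>A. set_lebesgue_integral lborel A h"]) auto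
    also have "\<dots> = (LBINT s:{s\<in>{0..a}. F s > 0}. h s) + (LBINT s:{a<..t}. h s)"
      using a t by (intro set_integral_Un intB set_integrable_subset[OF int]) auto
    also have "\<dots> = (LBINT s:{a<..t}. h s)"
      using upto[of a] a t by simp
    also have "\<dots> = F t"
    proof -
      have "F t = (LBINT s:{0..a} \<union> {a<..t}. h s)"
        unfolding F[OF t] using a by (intro arg_cong[where f="\<lambda>A. set_lebesgue_integral lborel A h"]) auto
      also have "\<dots> = (LBINT s:{0..a}. h s) + (LBINT s:{a<..t}. h s)"
        using a t by (intro set_integral_Un set_integrable_subset[OF int]) auto
      finally show ?thesis using F[of a] \<open>F a = 0\<close> a t by simp
    qed
    finally show ?thesis using False by simp
  qed
  then show "(LBINT s:{0..t}. if F s > 0 then h s else 0) = max 0 (F t)"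
    unfolding set_lebesgue_integral_def eqB .
qed

lemma set_integrable_continuous_mult:
  fixes g h :: "real \<Rightarrow> real"
  assumes g: "continuous_on {a..b} g" and h: "set_integrable lborel {a..b} h"
  shows "set_integrable lborel {a..b} (\<lambda>s. g s * h s)"
proof -
  have "compact (g ` {a..b})" by (intro compact_continuous_image g compact_Icc)
  then obtain B where B: "\<And>s. s \<in> {a..b} \<Longrightarrow> \<bar>g s\<bar> \<le> B"
    by (meson compact_imp_bounded bounded_real imageI)
  have "set_integrable lborel {a..b} (\<lambda>s. B * h s)" using h by simp
  then show ?thesis
  proof (rule set_integrable_bound)
    have "(\<lambda>s. indicator {a..b} s *\<^sub>R g s) \<in> borel_measurable lborel"
      using borel_measurable_continuous_on_indicator[OF _ g] by simp
    moreover have "(\<lambda>s. indicator {a..b} s *\<^sub>R h s) \<in> borel_measurable lborel"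
      using h unfolding set_integrable_def by (rule borel_measurable_integrable)
    ultimately have "(\<lambda>s. (indicator {a..b} s *\<^sub>R g s) * (indicator {a..b} s *\<^sub>R h s)) \<in> borel_measurable lborel"
      by (rule borel_measurable_times)
    then show "set_borel_measurable lborel {a..b} (\<lambda>s. g s * h s)"
      unfolding set_borel_measurable_def
      by (rule measurable_cong[THEN iffD1, rotated]) (auto simp: indicator_def)
    show "AE s in lborel. s \<in> {a..b} \<longrightarrow> norm (g s * h s) \<le> norm (B * h s)"
    proof (intro AE_I2 impI)
      fix s assume "s \<in> {a..b}"
      then have "\<bar>g s\<bar> \<le> \<bar>B\<bar>" using B[of s] by simp
      then show "norm (g s * h s) \<le> norm (B * h s)" by (simp add: abs_mult mult_right_mono)
    qed
  qed
qed

lemma continuous_on_indefinite_set_integral: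
  fixes h :: "real \<Rightarrow> real"
  assumes "set_integrable lborel {0..T} h"
  shows "continuous_on {0..T} (\<lambda>t. LBINT s:{0..t}. h s)"
proof -
  have "continuous_on {0..T} (\<lambda>t. integral {0..t} h)"
    by (intro indefinite_integral_continuous_1 set_borel_integral_eq_integral assms)
  moreover have "(LBINT s:{0..t}. h s) = integral {0..t} h" if "t \<in> {0..T}" for t
    by (rule set_borel_integral_eq_integral, rule set_integrable_subset[OF assms]) (use that in auto)
  ultimately show ?thesis
    by (rule continuous_on_cong[OF refl, THEN iffD2, rotated])
qed

text \<open>The explicit solution of the linear integral equation with drift \<open>p Z + h\<close>.  As \<open>h\<close> is only
  integrable, the product rule is replaced by exchanging the order of integration over a triangle.\<close>

lemma variation_of_constants:
  fixes h p :: "real \<Rightarrow> real" and z :: real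
  assumes p: "continuous_on {0..T} p" and h: "set_integrable lborel {0..T} h"
  defines "E \<equiv> \<lambda>t. exp (integral {0..t} p)"
  defines "Z \<equiv> \<lambda>t. E t * (z + (LBINT s:{0..t}. h s / E s))"
  shows "continuous_on {0..T} Z" 
    and "t \<in> {0..T} \<Longrightarrow> Z t = z + (LBINT s:{0..t}. h s + p s * Z s)"
proof -
  have contE: "continuous_on {0..T} E" unfolding E_def
    by (intro continuous_intros indefinite_integral_continuous_1 integrable_continuous_real p)
  have Epos: "E s > 0" for s by (simp add: E_def)
  have hE: "set_integrable lborel {0..T} (\<lambda>s. h s / E s)"
  proof -
    have "continuous_on {0..T} (\<lambda>s. inverse (E s))"
      by (intro continuous_intros contE ballI) (use Epos in \<open>simp add: E_def\<close>)
    from set_integrable_continuous_mult[OF this h] show ?thesis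
      by (simp add: divide_inverse mult.commute)
  qed
  define A where "A t = (LBINT s:{0..t}. h s / E s)" for t
  have contA: "continuous_on {0..T} A"
    unfolding A_def by (rule continuous_on_indefinite_set_integral[OF hE])
  show contZ: "continuous_on {0..T} Z"
    using contE contA unfolding Z_def A_def by (intro continuous_intros)
  assume t: "t \<in> {0..T}"
  have contpE: "continuous_on {0..T} (\<lambda>s. p s * E s)"
    by (intro continuous_intros p contE)
  have intc: "set_integrable lborel {u..t} g" if "continuous_on {0..T} g" "0 \<le> u" for g :: "real \<Rightarrow> real" and u
    by (rule borel_integrable_atLeastAtMost', rule continuous_on_subset[OF that(1)]) (use t that in auto)
  have FTC: "(LBINT s:{u..t}. p s * E s) = E t - E u" if u: "0 \<le> u" "u \<le> t" for u
  proof -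
    have d: "(E has_vector_derivative p s * E s) (at s within {u..t})" if s: "s \<in> {u..t}" for s
    proof -
      have "((\<lambda>s. integral {0..s} p) has_real_derivative p s) (at s within {0..T})"
        unfolding has_real_derivative_iff_has_vector_derivative
        by (rule integral_has_vector_derivative[OF p]) (use s u t in auto)
      then have "(E has_real_derivative p s * E s) (at s within {0..T})"
        unfolding E_def by (auto intro!: derivative_eq_intros)
      then show ?thesis
        unfolding has_real_derivative_iff_has_vector_derivative
        by (rule has_vector_derivative_within_subset) (use u t in auto)
    qed
    have "((\<lambda>s. p s * E s) has_integral (E t - E u)) {u..t}"
      by (rule fundamental_theorem_of_calculus[OF u(2) d])
    then show ?thesis
      using set_borel_integral_eq_integral(2)[OF intc[OF contpE u(1)]] by (simp add: integral_unique)
  qed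
  define k where "k s = indicator {0..T} s * (h s / E s)" for s
  define w where "w s = indicator {0..t} s * (p s * E s)" for s
  have intk: "integrable lborel k" using hE by (simp add: k_def[abs_def] set_integrable_def)
  have intw: "integrable lborel w" using intc[OF contpE, of 0] by (simp add: w_def[abs_def] set_integrable_def)
  note [measurable] = borel_measurable_integrable[OF intk] borel_measurable_integrable[OF intw]
  have i1: "integrable (lborel \<Otimes>\<^sub>M lborel) (\<lambda>z. w (fst z) * k (snd z))"
  proof (rule lborel_pair.Fubini_integrable)
    show "integrable lborel (\<lambda>x. LBINT y. norm (w (fst (x, y)) * k (snd (x, y))))"
      using intk intw by (simp add: abs_mult integrable_norm[unfolded real_norm_def])
    show "AE x in lborel. integrable lborel (\<lambda>y. w (fst (x, y)) * k (snd (x, y)))"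
      using intk by simp
  qed measurable
  \<comment> \<open>The integrand on the triangle of all \<open>u\<close> up to \<open>s\<close>.\<close>
  have i2: "integrable (lborel \<Otimes>\<^sub>M lborel) (\<lambda>(s, u). w s * (k u * indicator {..s} u))"
    by (rule Bochner_Integration.integrable_bound[OF i1])
       (auto simp: indicator_def abs_mult split_beta' split del: if_split intro!: AE_I2 borel_measurable_times measurable_If)
  have "(LBINT s:{0..t}. p s * E s * A s) = (LBINT s. LBINT u. w s * (k u * indicator {..s} u))"
    unfolding set_lebesgue_integral_def
  proof (rule Bochner_Integration.integral_cong)
    fix s
    have "w s * (LBINT u. k u * indicator {..s} u) = w s * A s"
    proof (cases "s \<in> {0..t}")
      case True
      then have "(LBINT u. k u * indicator {..s} u) = A s"
        unfolding A_def set_lebesgue_integral_def k_def using t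
        by (intro Bochner_Integration.integral_cong) (auto simp: indicator_def)
      then show ?thesis by simp
    qed (simp add: w_def)
    then show "indicator {0..t} s *\<^sub>R (p s * E s * A s) = (LBINT u. w s * (k u * indicator {..s} u))"
      by (auto simp: w_def)
  qed simp
  also have "\<dots> = (LBINT u. LBINT s. w s * (k u * indicator {..s} u))"
    by (rule lborel_pair.Fubini_integral[symmetric, OF i2])
  also have "\<dots> = (LBINT u. E t * (indicator {0..t} u *\<^sub>R (h u / E u)) - indicator {0..t} u *\<^sub>R h u)"
  proof (rule Bochner_Integration.integral_cong)
    fix u
    have "(LBINT s. w s * (k u * indicator {..s} u)) = (LBINT s. w s * indicator {u..} s) * k u"
      by (subst integral_mult_left_zero[symmetric], rule Bochner_Integration.integral_cong) (auto simp: indicator_def)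
    also have "\<dots> = indicator {0..t} u * (E t - E u) * (h u / E u)"
    proof (cases "u \<in> {0..t}")
      case True
      then have "(LBINT s. w s * indicator {u..} s) = (LBINT s:{u..t}. p s * E s)"
        unfolding set_lebesgue_integral_def w_def
        by (intro Bochner_Integration.integral_cong) (auto simp: indicator_def)
      then show ?thesis using FTC[of u] True t by (simp add: k_def)
    next
      case False
      show ?thesis
      proof (cases "u \<in> {0..T}")
        case True
        then have "(LBINT s. w s * indicator {u..} s) = (LBINT s::real. 0)"
          unfolding w_def using False t
          by (intro Bochner_Integration.integral_cong) (auto simp: indicator_def)
        then show ?thesis using False by simp
      qed (use False in \<open>simp add: k_def\<close>)
    qed
    also have "\<dots> = E t * (indicator {0..t} u *\<^sub>R (h u / E u)) - indicator {0..t} u *\<^sub>R h u"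
      using Epos[of u] by (simp add: field_simps)
    finally show "(LBINT s. w s * (k u * indicator {..s} u)) = 
        E t * (indicator {0..t} u *\<^sub>R (h u / E u)) - indicator {0..t} u *\<^sub>R h u" .
  qed simp
  also have "\<dots> = E t * A t - (LBINT s:{0..t}. h s)"
  proof -
    have 1: "integrable lborel (\<lambda>u. E t * (indicator {0..t} u *\<^sub>R (h u / E u)))"
      using set_integrable_subset[OF hE, of "{0..t}"] t unfolding set_integrable_def
      by (intro integrable_mult_right) auto
    have 2: "integrable lborel (\<lambda>u. indicator {0..t} u *\<^sub>R h u)"
      using set_integrable_subset[OF h, of "{0..t}"] t unfolding set_integrable_def by auto
    show ?thesis unfolding A_def set_lebesgue_integral_def
      by (simp only: Bochner_Integration.integral_diff[OF 1 2] integral_mult_right_zero)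
  qed
  finally have parts: "(LBINT s:{0..t}. p s * E s * A s) = E t * A t - (LBINT s:{0..t}. h s)" .
  have "(LBINT s:{0..t}. h s + p s * Z s) = 
      (LBINT s:{0..t}. h s + (z * (p s * E s) + p s * E s * A s))"
    by (simp add: Z_def A_def algebra_simps)
  also have "\<dots> = (LBINT s:{0..t}. h s) + (z * (LBINT s:{0..t}. p s * E s) + (LBINT s:{0..t}. p s * E s * A s))"
  proof -
    have a: "set_integrable lborel {0..t} h" by (rule set_integrable_subset[OF h]) (use t in auto)
    have b: "set_integrable lborel {0..t} (\<lambda>s. z * (p s * E s))" using intc[OF contpE, of 0] by simp
    have c: "set_integrable lborel {0..t} (\<lambda>s. p s * E s * A s)"
      by (rule intc) (intro continuous_intros contpE contA, simp)
    show ?thesis using a b c by (simp add: set_integral_add)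
  qed
  also have "\<dots> = E t * A t + z * (E t - 1)"
    unfolding parts using FTC[of 0] t by (simp add: E_def)
  finally show "Z t = z + (LBINT s:{0..t}. h s + p s * Z s)"
    by (simp add: Z_def A_def algebra_simps)
qed

section \<open>Measurability and limits of integrals\<close>

text \<open>Freezing the process at the grid point to the left makes it a countable patchwork of
  random variables; refining the grid recovers the process by continuity of its paths.\<close>

lemma continuous_process_jointly_measurable:
  fixes Y :: "real \<Rightarrow> 'a \<Rightarrow> real"
  assumes meas: "\<And>s. s \<in> {0..t} \<Longrightarrow> Y s \<in> borel_measurable M"
    and cont: "\<And>\<omega>. \<omega> \<in> space M \<Longrightarrow> continuous_on {0..t} (\<lambda>s. Y s \<omega>)"
    and t: "0 \<le> t"
  shows "(\<lambda>(s, \<omega>). Y s \<omega>) \<in> borel_measurable (restrict_space borel {0..t} \<Otimes>\<^sub>M M)"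
proof -
  let ?N = "restrict_space borel {0..t} \<Otimes>\<^sub>M M"
  \<comment> \<open>The grid point to the left of \<open>s\<close>, forced into the interval.\<close>
  define g where "g n s = max 0 (min t (real_of_int \<lfloor>real (Suc n) * s\<rfloor> / real (Suc n)))" for n and s :: real
  show ?thesis
  proof (rule borel_measurable_LIMSEQ_real)
    fix n
    have "(\<lambda>z. (\<lambda>(i::int) z. Y (max 0 (min t (real_of_int i / real (Suc n)))) (snd z))
        \<lfloor>real (Suc n) * fst z\<rfloor> z) \<in> borel_measurable ?N"
    proof (rule measurable_compose_countable[where
          f="\<lambda>(i::int) z. Y (max 0 (min t (real_of_int i / real (Suc n)))) (snd z)"])
      fix i :: int
      have "Y (max 0 (min t (real_of_int i / real (Suc n)))) \<in> borel_measurable M"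
        by (rule meas) (use t in auto)
      then show "(\<lambda>z. Y (max 0 (min t (real_of_int i / real (Suc n)))) (snd z)) \<in> borel_measurable ?N"
        by measurable
    next
      have [measurable]: "(\<lambda>s. s) \<in> borel_measurable (restrict_space borel {0..t})"
        by (rule measurable_restrict_space1) simp
      show "(\<lambda>z. \<lfloor>real (Suc n) * fst z\<rfloor>) \<in> ?N \<rightarrow>\<^sub>M count_space UNIV"
        by measurable
    qed
    then show "(\<lambda>z. Y (g n (fst z)) (snd z)) \<in> borel_measurable ?N"
      by (simp add: g_def)
  next
    fix z assume "z \<in> space ?N"
    then obtain s \<omega> where z: "z = (s, \<omega>)" "s \<in> {0..t}" "\<omega> \<in> space M"
      by (auto simp: space_pair_measure space_restrict_space)
    have "(\<lambda>n. g n s) \<longlonglongrightarrow> s"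
    proof (rule real_tendsto_sandwich)
      show "\<forall>\<^sub>F n in sequentially. s - 1 / real (Suc n) \<le> g n s"
      proof (rule always_eventually, rule allI)
        fix n
        have "real (Suc n) * s \<le> real_of_int \<lfloor>real (Suc n) * s\<rfloor> + 1" by linarith
        then have "s \<le> (real_of_int \<lfloor>real (Suc n) * s\<rfloor> + 1) / real (Suc n)"
          by (simp add: pos_le_divide_eq mult.commute)
        then have "s - 1 / real (Suc n) \<le> real_of_int \<lfloor>real (Suc n) * s\<rfloor> / real (Suc n)"
          by (simp add: add_divide_distrib)
        moreover have "s - 1 / real (Suc n) \<le> t" using z by (smt (verit) atLeastAtMost_iff divide_nonneg_nonneg of_nat_0_le_iff)
        ultimately show "s - 1 / real (Suc n) \<le> g n s" by (auto simp: g_def)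
      qed
      show "\<forall>\<^sub>F n in sequentially. g n s \<le> s"
      proof (rule always_eventually, rule allI)
        fix n
        have "real_of_int \<lfloor>real (Suc n) * s\<rfloor> / real (Suc n) \<le> s"
          by (simp add: pos_divide_le_eq mult.commute)
        then show "g n s \<le> s" using z by (auto simp: g_def)
      qed
      have "(\<lambda>n. s - 1 / real (Suc n)) \<longlonglongrightarrow> s - 0"
        using LIMSEQ_inverse_real_of_nat by (intro tendsto_diff tendsto_const) (simp add: inverse_eq_divide)
      then show "(\<lambda>n. s - 1 / real (Suc n)) \<longlonglongrightarrow> s" by simp
    qed simp
    moreover have "\<forall>n. g n s \<in> {0..t}" using t by (auto simp: g_def)
    ultimately have "(\<lambda>n. Y (g n s) \<omega>) \<longlonglongrightarrow> Y s \<omega>"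
      using cont[OF z(3)] z(2) by (auto simp: continuous_on_sequentially comp_def)
    then show "(\<lambda>n. Y (g n (fst z)) (snd z)) \<longlonglongrightarrow> (case z of (s, \<omega>) \<Rightarrow> Y s \<omega>)"
      by (simp add: z)
  qed
qed

lemma law_flow_measurable:
  assumes "prob_space P" and "(\<lambda>(t, \<omega>). X t \<omega>) \<in> borel_measurable (restrict_space borel {0..T} \<Otimes>\<^sub>M P)"
  shows "(\<lambda>t. distr P borel (X t)) \<in> flows T"
proof -
  interpret prob_space P by fact
  have Xt: "X t \<in> borel_measurable P" if "t \<in> {0..T}" for t
    using measurable_compose[OF measurable_Pair1'[of t "restrict_space borel {0..T}" P] assms(2)] that
    by (simp add: space_restrict_space)
  have "(\<lambda>t. distr P borel (X t)) \<in> restrict_space borel {0..T} \<rightarrow>\<^sub>M subprob_algebra borel"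
    by (rule measurable_distr2[where M=P]) (use assms(2) in \<open>auto intro: measurable_const M_in_subprob\<close>)
  moreover have "prob_space (distr P borel (X t))" if "t \<in> {0..T}" for t
    by (rule prob_space_distr) (rule Xt[OF that])
  ultimately show ?thesis
    unfolding flows_def prob_algebra_def
    by (intro measurable_restrict_space2) (auto simp: space_restrict_space)
qed

lemma integrable_powr_add:
  fixes f g :: "'b \<Rightarrow> real"
  assumes [measurable]: "f \<in> borel_measurable N" "g \<in> borel_measurable N" and r: "0 < r"
    and f: "integrable N (\<lambda>x. \<bar>f x\<bar> powr r)" and g: "integrable N (\<lambda>x. \<bar>g x\<bar> powr r)"
  shows "integrable N (\<lambda>x. \<bar>f x + g x\<bar> powr r)"
proof (rule Bochner_Integration.integrable_bound)
  show "integrable N (\<lambda>x. 2 powr r * (\<bar>f x\<bar> powr r + \<bar>g x\<bar> powr r))"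
    using f g by simp
  show "AE x in N. norm (\<bar>f x + g x\<bar> powr r) \<le> norm (2 powr r * (\<bar>f x\<bar> powr r + \<bar>g x\<bar> powr r))"
  proof (rule AE_I2)
    fix x
    have "\<bar>f x + g x\<bar> powr r \<le> (2 * max \<bar>f x\<bar> \<bar>g x\<bar>) powr r"
      using r by (intro powr_mono2) auto
    also have "\<dots> = 2 powr r * max \<bar>f x\<bar> \<bar>g x\<bar> powr r" by (simp add: powr_mult)
    also have "\<dots> \<le> 2 powr r * (\<bar>f x\<bar> powr r + \<bar>g x\<bar> powr r)"
      by (intro mult_left_mono) (auto simp: max_def)
    finally show "norm (\<bar>f x + g x\<bar> powr r) \<le> norm (2 powr r * (\<bar>f x\<bar> powr r + \<bar>g x\<bar> powr r))" by simp
  qed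
qed measurable

lemma integrable_powr_mult:
  fixes f :: "'b \<Rightarrow> real"
  assumes "integrable N (\<lambda>x. \<bar>f x\<bar> powr r)"
  shows "integrable N (\<lambda>x. \<bar>k * f x\<bar> powr r)"
  using assms by (simp add: abs_mult powr_mult)

lemma (in finite_measure) integrable_powr_of_even_power:
  fixes f :: "'a \<Rightarrow> real"
  assumes [measurable]: "f \<in> borel_measurable M" and f: "integrable M (\<lambda>x. f x ^ (2 * k))"
    and r: "0 < r" "r \<le> 2 * real k"
  shows "integrable M (\<lambda>x. \<bar>f x\<bar> powr r)"
proof (rule Bochner_Integration.integrable_bound)
  show "integrable M (\<lambda>x. 1 + f x ^ (2 * k))" using f by simp
  show "AE x in M. norm (\<bar>f x\<bar> powr r) \<le> norm (1 + f x ^ (2 * k))"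
  proof (rule AE_I2)
    fix x
    have e: "f x ^ (2 * k) = \<bar>f x\<bar> ^ (2 * k)" by (simp add: power_mult)
    have "\<bar>f x\<bar> powr r \<le> 1 + f x ^ (2 * k)"
    proof (cases "\<bar>f x\<bar> \<le> 1")
      case True
      then have "\<bar>f x\<bar> powr r \<le> 1 powr r" using r by (intro powr_mono2) auto
      then show ?thesis unfolding e by (simp add: add_increasing2)
    next
      case False
      then have "\<bar>f x\<bar> powr r \<le> \<bar>f x\<bar> powr real (2 * k)" using r by (intro powr_mono) auto
      also have "\<dots> = \<bar>f x\<bar> ^ (2 * k)" using False by (intro powr_realpow) auto
      finally show ?thesis using e by simp
    qed
    moreover have "0 \<le> f x ^ (2 * k)" unfolding e by simp
    ultimately show "norm (\<bar>f x\<bar> powr r) \<le> norm (1 + f x ^ (2 * k))" by simp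
  qed
qed measurable

lemma ext_integral_ereal:
  assumes h: "integrable N (h :: 'b \<Rightarrow> real)"
  shows "ext_integral N (\<lambda>z. ereal (h z)) = ereal (\<integral>z. h z \<partial>N)"
proof -
  have e: "e2ennreal (ereal x) = ennreal x" for x by (simp add: e2ennreal_ereal)
  have "(\<integral>\<^sup>+z. ennreal (h z) \<partial>N) \<noteq> \<infinity>" "(\<integral>\<^sup>+z. ennreal (- h z) \<partial>N) \<noteq> \<infinity>"
    using integrableD(2)[OF h] integrableD(2)[of N "\<lambda>z. - h z"] h by auto
  then obtain a b where ab: "(\<integral>\<^sup>+z. ennreal (h z) \<partial>N) = ennreal a" "0 \<le> a"
      "(\<integral>\<^sup>+z. ennreal (- h z) \<partial>N) = ennreal b" "0 \<le> b"
    by (metis ennreal_cases infinity_ennreal_def)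
  then show ?thesis
    by (simp add: ext_integral_def e real_lebesgue_integral_def[OF h] enn2ereal_ennreal)
qed

lemma ext_integral_cong_AE:
  assumes "AE z in N. h z = k z"
  shows "ext_integral N h = ext_integral N k"
proof -
  have "(\<integral>\<^sup>+z. e2ennreal (h z) \<partial>N) = (\<integral>\<^sup>+z. e2ennreal (k z) \<partial>N)"
    "(\<integral>\<^sup>+z. e2ennreal (- h z) \<partial>N) = (\<integral>\<^sup>+z. e2ennreal (- k z) \<partial>N)"
    using assms by (auto intro!: nn_integral_cong_AE)
  then show ?thesis by (simp add: ext_integral_def)
qed

text \<open>The measure \<open>\<pi>\<close> has atoms at both ends of the time interval and is Lebesgue measure in between, so
  that statements about flows reduce to the two end points and almost every time.\<close>

lemma AE_pi_measure_iff:
  assumes T: "0 < T"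
  shows "(AE t in pi_measure T. R t) \<longleftrightarrow> R 0 \<and> R T \<and> (AE t in time_measure T. R t)"
proof -
  have sets_pi: "sets (pi_measure T) = sets (restrict_space borel {0..T})"
    and space_pi: "space (pi_measure T) = {0..T}"
  proof -
    have "sets (restrict_space borel {0..T}) \<subseteq> Pow {0..T}"
      by (auto simp: sets_restrict_space)
    moreover have "sigma_algebra {0..T} (sets (restrict_space borel {0..T}))"
      using sets.sigma_algebra_axioms[of "restrict_space borel {0..T}"] by (simp add: space_restrict_space)
    ultimately show "sets (pi_measure T) = sets (restrict_space borel {0..T})"
      "space (pi_measure T) = {0..T}"
      by (simp_all add: pi_measure_def sets_measure_of space_measure_of sigma_algebra.sigma_sets_eq)
  qed
  have null_time: "N \<in> null_sets (time_measure T) \<longleftrightarrow> N \<in> sets (restrict_space borel {0..T}) \<and> emeasure lborel N = 0" for N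
    by (auto simp: null_sets_def time_measure_def sets_restrict_space emeasure_restrict_space)
  have null_pi: "N \<in> null_sets (pi_measure T) \<longleftrightarrow> N \<in> sets (restrict_space borel {0..T}) \<and> emeasure lborel N = 0 \<and> 0 \<notin> N \<and> T \<notin> N" for N
    by (auto simp: null_sets_def sets_pi emeasure_pi_measure indicator_def)
  have space_time: "space (time_measure T) = {0..T}" by (simp add: time_measure_def space_restrict_space)
  show ?thesis
  proof
    assume "AE t in pi_measure T. R t"
    then obtain N where "{t\<in>{0..T}. \<not> R t} \<subseteq> N" "N \<in> null_sets (pi_measure T)"
      unfolding eventually_ae_filter space_pi by auto
    then have N: "\<And>t. t \<in> {0..T} \<Longrightarrow> \<not> R t \<Longrightarrow> t \<in> N" "N \<in> null_sets (time_measure T)" "0 \<notin> N" "T \<notin> N"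
      unfolding null_time null_pi by auto
    have "R 0" "R T" using N(1)[of 0] N(1)[of T] N(3,4) T by auto
    moreover have "AE t in time_measure T. R t"
      unfolding eventually_ae_filter space_time using N(1,2) by blast
    ultimately show "R 0 \<and> R T \<and> (AE t in time_measure T. R t)" by blast
  next
    assume R: "R 0 \<and> R T \<and> (AE t in time_measure T. R t)"
    then obtain N where N: "{t\<in>{0..T}. \<not> R t} \<subseteq> N" "N \<in> null_sets (time_measure T)"
      unfolding eventually_ae_filter space_time by auto
    have "{0, T} \<in> sets (restrict_space borel {0..T})"
      using T by (auto simp: sets_restrict_space intro!: image_eqI[of _ _ "{0, T}"])
    then have "N - {0, T} \<in> sets (restrict_space borel {0..T})"
      using N(2) unfolding null_time by auto
    moreover have "emeasure lborel (N - {0, T}) = 0"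
      using N(2) emeasure_mono[of "N - {0, T}" N lborel] unfolding null_time
      by (auto simp: sets_restrict_space)
    ultimately have "N - {0, T} \<in> null_sets (pi_measure T)" unfolding null_pi by auto
    moreover have "{t\<in>{0..T}. \<not> R t} \<subseteq> N - {0, T}" using N(1) R by auto
    ultimately show "AE t in pi_measure T. R t" unfolding eventually_ae_filter space_pi by auto
  qed
qed

text \<open>Fatou's lemma for real functions with a common integrable lower bound, stated for the pointwise
  lower limit that lower semicontinuity provides.\<close>

lemma integral_le_of_lower_limit:
  fixes g :: "'b \<Rightarrow> real" and h :: "nat \<Rightarrow> 'b \<Rightarrow> real"
  assumes g: "integrable N g" and h: "\<And>n. integrable N (h n)" and D: "integrable N D"
    and lower: "AE z in N. - D z \<le> g z" "\<And>n. AE z in N. - D z \<le> h n z"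
    and lsc: "AE z in N. \<forall>c<g z. \<forall>\<^sub>F n in sequentially. c < h n z"
    and B: "\<forall>\<^sub>F n in sequentially. (\<integral>z. h n z \<partial>N) \<le> B"
  shows "(\<integral>z. g z \<partial>N) \<le> B"
proof -
  note [measurable] = borel_measurable_integrable[OF g] borel_measurable_integrable[OF h] borel_measurable_integrable[OF D]
  have nn: "(\<integral>\<^sup>+z. ennreal (k z + D z) \<partial>N) = ennreal ((\<integral>z. k z \<partial>N) + (\<integral>z. D z \<partial>N))"
    and nonneg: "0 \<le> (\<integral>z. k z \<partial>N) + (\<integral>z. D z \<partial>N)"
    if "integrable N k" "AE z in N. - D z \<le> k z" for k
  proof -
    have pos: "AE z in N. 0 \<le> k z + D z" using that(2) by eventually_elim linarith
    show "(\<integral>\<^sup>+z. ennreal (k z + D z) \<partial>N) = ennreal ((\<integral>z. k z \<partial>N) + (\<integral>z. D z \<partial>N))"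
      using nn_integral_eq_integral[OF Bochner_Integration.integrable_add[OF that(1) D] pos] that(1) D by simp
    show "0 \<le> (\<integral>z. k z \<partial>N) + (\<integral>z. D z \<partial>N)"
      using integral_nonneg_AE[OF pos] that(1) D by simp
  qed
  have "ennreal ((\<integral>z. g z \<partial>N) + (\<integral>z. D z \<partial>N)) = (\<integral>\<^sup>+z. ennreal (g z + D z) \<partial>N)"
    by (rule nn[OF g lower(1), symmetric])
  also have "\<dots> \<le> (\<integral>\<^sup>+z. liminf (\<lambda>n. ennreal (h n z + D z)) \<partial>N)"
  proof (rule nn_integral_mono_AE)
    show "AE z in N. ennreal (g z + D z) \<le> liminf (\<lambda>n. ennreal (h n z + D z))"
      using lsc
    proof eventually_elim
      case (elim z)
      show ?case
        unfolding le_Liminf_iff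
      proof (intro allI impI)
        fix y assume y: "y < ennreal (g z + D z)"
        then obtain y' where y': "y = ennreal y'" "0 \<le> y'"
          by (cases y) (auto simp: top.extremum_strict)
        then have "y' - D z < g z" using y by (simp add: ennreal_less_iff)
        then have "\<forall>\<^sub>F n in sequentially. y' - D z < h n z" using elim by blast
        then show "\<forall>\<^sub>F n in sequentially. y < ennreal (h n z + D z)"
          by eventually_elim (use y' in \<open>simp add: ennreal_less_iff\<close>)
      qed
    qed
  qed
  also have "\<dots> \<le> liminf (\<lambda>n. \<integral>\<^sup>+z. ennreal (h n z + D z) \<partial>N)"
    by (rule nn_integral_liminf) measurable
  also have "\<dots> \<le> liminf (\<lambda>n::nat. ennreal (B + (\<integral>z. D z \<partial>N)))"
    by (rule Liminf_mono, rule eventually_mono[OF B]) (simp add: nn[OF h lower(2)] ennreal_leI)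
  also have "\<dots> = ennreal (B + (\<integral>z. D z \<partial>N))" by (simp add: Liminf_const)
  finally have le: "ennreal ((\<integral>z. g z \<partial>N) + (\<integral>z. D z \<partial>N)) \<le> ennreal (B + (\<integral>z. D z \<partial>N))" .
  obtain n where "(\<integral>z. h n z \<partial>N) \<le> B" using B by (auto simp: eventually_sequentially)
  then have "0 \<le> B + (\<integral>z. D z \<partial>N)" using nonneg[OF h lower(2), of n] by linarith
  then show ?thesis using le by (simp add: ennreal_le_iff)
qed

lemma lsc_on_sequentially:
  assumes lsc: "lsc_on S f" and x: "x \<in> S" "\<And>n. y n \<in> S" and lim: "y \<longlonglongrightarrow> x" and c: "c < f x"
  shows "\<forall>\<^sub>F n in sequentially. c < f (y n)"
proof -
  have "\<forall>\<^sub>F z in nhds x. z \<noteq> x \<longrightarrow> z \<in> S \<longrightarrow> c < f z"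
    using lsc x(1) c by (auto simp: lsc_on_def eventually_at_filter)
  then have "\<forall>\<^sub>F n in sequentially. y n \<noteq> x \<longrightarrow> y n \<in> S \<longrightarrow> c < f (y n)"
    using lim by (rule eventually_compose_filterlim)
  then show ?thesis by eventually_elim (use x(2) c in metis)
qed

lemma weak_conv_m_distr:
  fixes Y :: "nat \<Rightarrow> 'b \<Rightarrow> real"
  assumes P: "prob_space P" and Y: "\<And>n. Y n \<in> borel_measurable P" and Z: "Z \<in> borel_measurable P"
    and conv: "AE \<omega> in P. (\<lambda>n. Y n \<omega>) \<longlonglongrightarrow> Z \<omega>"
  shows "weak_conv_m (\<lambda>n. distr P borel (Y n)) (distr P borel Z)"
proof -
  interpret prob_space P by fact
  note [measurable] = Y Z
  show ?thesis
  proof (rule integral_bdd_continuous_conv_imp_weak_conv)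
    show "real_distribution (distr P borel (Y n))" for n
      by (rule real_distribution_distr) (rule Y)
    show "real_distribution (distr P borel Z)"
      by (rule real_distribution_distr) (rule Z)
    fix \<phi> :: "real \<Rightarrow> real"
    assume \<phi>: "\<And>x. isCont \<phi> x" "\<And>x. \<bar>\<phi> x\<bar> \<le> 1"
    have [measurable]: "\<phi> \<in> borel_measurable borel"
      using \<phi>(1) by (intro borel_measurable_continuous_onI) (simp add: continuous_at_imp_continuous_on)
    have "(\<lambda>n. \<integral>\<omega>. \<phi> (Y n \<omega>) \<partial>P) \<longlonglongrightarrow> (\<integral>\<omega>. \<phi> (Z \<omega>) \<partial>P)"
    proof (rule integral_dominated_convergence[where w="\<lambda>_. 1"])
      show "AE \<omega> in P. (\<lambda>n. \<phi> (Y n \<omega>)) \<longlonglongrightarrow> \<phi> (Z \<omega>)"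
        using conv by eventually_elim (rule isCont_tendsto_compose[OF \<phi>(1)])
    qed (use \<phi>(2) in auto)
    then show "(\<lambda>n. \<integral>x. \<phi> x \<partial>distr P borel (Y n)) \<longlonglongrightarrow> (\<integral>x. \<phi> x \<partial>distr P borel Z)"
      by (simp add: integral_distr)
  qed
qed

lemma joint_continuity_limit:
  assumes "continuous_map (prod_topology euclidean weak_topology) euclidean (\<lambda>(x, \<mu>). h x \<mu> :: real)"
    and "x \<longlonglongrightarrow> (y :: real)" and "\<And>n. \<mu> n \<in> prob_measures" and "\<nu> \<in> prob_measures" and "weak_conv_m \<mu> \<nu>"
  shows "(\<lambda>n. h (x n) (\<mu> n)) \<longlonglongrightarrow> h y \<nu>"
proof -
  have "limitin (prod_topology euclidean weak_topology) (\<lambda>n. (x n, \<mu> n)) (y, \<nu>) sequentially"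
    using assms(2,5) limitin_weak_topology_iff[OF assms(3,4)]
    by (auto simp: limitin_pairwise comp_def)
  from continuous_map_limit[OF assms(1) this] show ?thesis by (simp add: comp_def)
qed

section \<open>Convergent selections from tails of a bounded sequence\<close>

text \<open>Elements of almost minimal \<open>L\<^sup>2\<close>-norm in decreasing sets that are closed under midpoints form a Cauchy
  sequence: by the parallelogram law two of them that are far apart would have a midpoint of
  noticeably smaller norm.  Closure under midpoints is a form of convexity without weights, so that
  membership can be exploited by a plain induction.\<close>

lemma midpoint_tails_AE_convergent:
  fixes V :: "nat \<Rightarrow> ('b \<Rightarrow> real) set"
  assumes "finite_measure N"
    and nonempty: "\<And>n. V n \<noteq> {}" and anti: "\<And>m n. m \<le> n \<Longrightarrow> V n \<subseteq> V m"
    and mid: "\<And>n a b. a \<in> V n \<Longrightarrow> b \<in> V n \<Longrightarrow> (\<lambda>z. (a z + b z) / 2) \<in> V n"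
    and meas: "\<And>a. a \<in> V 0 \<Longrightarrow> a \<in> borel_measurable N"
    and bdd: "\<And>a z. a \<in> V 0 \<Longrightarrow> z \<in> space N \<Longrightarrow> \<bar>a z\<bar> \<le> K"
  obtains y where "\<And>n. y n \<in> V n" and "AE z in N. convergent (\<lambda>n. y n z)"
proof -
  interpret finite_measure N by fact
  have V0: "a \<in> V 0" if "a \<in> V n" for a n using anti[of 0 n] that by auto
  have ms: "a \<in> borel_measurable N" if "a \<in> V n" for a n using meas[OF V0[OF that]] .
  have bd: "\<bar>a z\<bar> \<le> K" if "a \<in> V n" "z \<in> space N" for a n z using bdd[OF V0[OF that(1)] that(2)] .
  define Q where "Q a = (\<integral>z. (a z)\<^sup>2 \<partial>N)" for a :: "'b \<Rightarrow> real"
  have sq_le: "(a z)\<^sup>2 \<le> K\<^sup>2" if "a \<in> V n" "z \<in> space N" for a n z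
    using bd[OF that] power_mono[of "\<bar>a z\<bar>" K 2] by simp
  have int: "integrable N (\<lambda>z. a z * b z)" if "a \<in> V n" "b \<in> V m" for a b n m
  proof (rule integrable_const_bound[where B="K * K"])
    show "AE z in N. norm (a z * b z) \<le> K * K"
      using bd[OF that(1)] bd[OF that(2)]
      by (auto simp: abs_mult intro!: AE_I2 mult_mono abs_ge_zero order_trans[OF abs_ge_zero bd[OF that(1)]])
  qed (use ms that in measurable)
  have Q_nonneg: "0 \<le> Q a" for a by (simp add: Q_def)
  have Q_le: "Q a \<le> K\<^sup>2 * measure N (space N)" if "a \<in> V n" for a n
    unfolding Q_def using integral_mono[of N "\<lambda>z. (a z)\<^sup>2" "\<lambda>_. K\<^sup>2"] int[OF that that] sq_le[OF that]
    by (simp add: power2_eq_square mult.commute)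
  \<comment> \<open>The least squared norms increase with \<open>n\<close> and are bounded, hence form a Cauchy sequence.\<close>
  define d where "d n = Inf (Q ` V n)" for n
  have bb: "bdd_below (Q ` V n)" for n by (rule bdd_belowI2[where m=0]) (rule Q_nonneg)
  have d_le: "d n \<le> Q a" if "a \<in> V n" for a n
    unfolding d_def using bb that by (auto intro: cInf_lower)
  have "incseq d"
    unfolding d_def incseq_def
    by (intro allI impI cInf_superset_mono image_mono anti bb) (use nonempty in auto)
  moreover have "d n \<le> K\<^sup>2 * measure N (space N)" for n
    using nonempty[of n] d_le Q_le by (meson ex_in_conv order_trans)
  ultimately have "convergent d" 
    unfolding convergent_def by (meson incseq_convergent)
  then have "Cauchy d" by (rule convergent_Cauchy)
  have "\<exists>a\<in>V n. Q a < d n + 1 / real (Suc n)" for n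
  proof -
    have "Inf (Q ` V n) < d n + 1 / real (Suc n)" by (simp add: d_def)
    then show ?thesis using cInf_lessD[of "Q ` V n"] nonempty[of n] by auto
  qed
  then obtain y where y: "\<And>n. y n \<in> V n" "\<And>n. Q (y n) < d n + 1 / real (Suc n)" by metis
  have L2: "(\<integral>z. (y n z - y m z)\<^sup>2 \<partial>N) \<le> 2 * (d m - d n) + 4 * (1 / real (Suc n))" if "n \<le> m" for n m
  proof -
    have ym: "y m \<in> V n" using y(1) anti[OF that] by auto
    define c where "c = (\<lambda>z. (y n z + y m z) / 2)"
    have c: "c \<in> V n" unfolding c_def by (rule mid[OF y(1) ym])
    have "(\<integral>z. (y n z - y m z)\<^sup>2 \<partial>N) = 
      (\<integral>z. 2 * (y n z * y n z) + 2 * (y m z * y m z) - 4 * (c z * c z) \<partial>N)"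
      by (intro Bochner_Integration.integral_cong) (auto simp: c_def power2_eq_square field_simps)
    also have "\<dots> = 2 * Q (y n) + 2 * Q (y m) - 4 * Q c"
      using int[OF y(1) y(1)] int[OF ym ym] int[OF c c]
      by (simp add: Q_def power2_eq_square del: times_divide_eq_left times_divide_eq_right)
    also have "\<dots> \<le> 2 * (d n + 1 / real (Suc n)) + 2 * (d m + 1 / real (Suc n)) - 4 * d n"
    proof -
      have "2 * q1 + 2 * q2 - 4 * q \<le> 2 * (a + e) + 2 * (b + e) - 4 * a"
        if "e' \<le> e" "q1 < a + e" "q2 < b + e'" "a \<le> q" for q1 q2 q a b e e' :: real
        using that by argo
      moreover have "1 / real (Suc m) \<le> 1 / real (Suc n)" using that by (simp add: frac_le)
      ultimately show ?thesis using y(2)[of n] y(2)[of m] d_le[OF c] by blast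
    qed
    also have "\<dots> = 2 * (d m - d n) + 4 * (1 / real (Suc n))" by (simp add: algebra_simps)
    finally show ?thesis .
  qed
  have inty: "integrable N (y n)" for n
    by (rule integrable_const_bound[where B=K]) (use bd[OF y(1)] ms[OF y(1)] in auto)
  have intsq: "integrable N (\<lambda>z. (y n z - y m z)\<^sup>2)" for n m
    unfolding power2_diff using int[OF y(1) y(1), of n n] int[OF y(1) y(1), of m m] int[OF y(1) y(1), of n m]
    by (simp add: power2_eq_square mult.assoc)
  have L1: "(\<integral>z. norm (y n z - y m z) \<partial>N) \<le> \<epsilon> * measure N (space N) + (\<integral>z. (y n z - y m z)\<^sup>2 \<partial>N) / \<epsilon>"
    if "\<epsilon> > 0" for \<epsilon> n m
  proof -
    have "\<bar>x\<bar> \<le> \<epsilon> + x\<^sup>2 / \<epsilon>" for x :: real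
    proof (cases "\<bar>x\<bar> \<le> \<epsilon>")
      case True then show ?thesis using that by (smt (verit) divide_nonneg_pos zero_le_power2)
    next
      case False
      then have "\<epsilon> * \<bar>x\<bar> \<le> \<bar>x\<bar> * \<bar>x\<bar>" by (intro mult_right_mono) auto
      then have "\<bar>x\<bar> \<le> x\<^sup>2 / \<epsilon>" using that by (simp add: pos_le_divide_eq power2_eq_square mult.commute)
      then show ?thesis using that by simp
    qed
    then have "(\<integral>z. norm (y n z - y m z) \<partial>N) \<le> (\<integral>z. \<epsilon> + (y n z - y m z)\<^sup>2 / \<epsilon> \<partial>N)"
      using inty intsq by (intro integral_mono) auto
    also have "\<dots> = \<epsilon> * measure N (space N) + (\<integral>z. (y n z - y m z)\<^sup>2 \<partial>N) / \<epsilon>"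
      using intsq by simp
    finally show ?thesis .
  qed
  have "\<exists>n0. \<forall>i\<ge>n0. \<forall>j\<ge>n0. (LINT z|N. norm (y i z - y j z)) < e" if "e > 0" for e :: real
  proof -
    let ?\<mu> = "measure N (space N)"
    \<comment> \<open>This choice makes the first term of the estimate \<open>L1\<close> less than \<open>e / 2\<close>.\<close>
    define \<epsilon> where "\<epsilon> = e / (2 * (?\<mu> + 1))"
    have \<epsilon>: "\<epsilon> > 0" "\<epsilon> * ?\<mu> < e / 2"
    proof -
      have \<mu>: "0 \<le> ?\<mu>" by simp
      then show pos: "\<epsilon> > 0" unfolding \<epsilon>_def using that by (intro divide_pos_pos) argo+
      have "\<epsilon> * ?\<mu> < \<epsilon> * (?\<mu> + 1)" using pos by simp
      also have "\<dots> = e / 2" using \<mu> by (simp add: \<epsilon>_def add_nonneg_eq_0_iff field_simps)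
      finally show "\<epsilon> * ?\<mu> < e / 2" .
    qed
    have \<delta>2: "\<epsilon> * e / 16 > 0" using \<epsilon> that by simp
    have \<delta>: "\<epsilon> * e / 8 > 0" using \<epsilon> that by simp
    obtain n1 where n1: "\<And>m n. m \<ge> n1 \<Longrightarrow> n \<ge> n1 \<Longrightarrow> \<bar>d m - d n\<bar> < \<epsilon> * e / 8"
      using \<open>Cauchy d\<close>[unfolded Cauchy_def dist_real_def, rule_format, OF \<delta>] by blast
    obtain n2 where n2: "1 / real (Suc n2) < \<epsilon> * e / 16"
      using nat_approx_posE[OF \<delta>2] by blast
    have *: "(LINT z|N. norm (y i z - y j z)) < e" if "max n1 n2 \<le> i" "i \<le> j" for i j
    proof -
      have gen: "q < c / 2" if "e' \<le> f" "f < c / 16" "\<bar>a - b\<bar> < c / 8" "q \<le> 2 * (a - b) + 4 * e'" for a b c q e' f :: real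
        using that by argo
      have "1 / real (Suc i) \<le> 1 / real (Suc n2)" using that by (simp add: frac_le)
      moreover have "\<bar>d j - d i\<bar> < \<epsilon> * e / 8" by (rule n1) (use that in auto)
      ultimately have "(\<integral>z. (y i z - y j z)\<^sup>2 \<partial>N) < \<epsilon> * e / 2"
        using n2 L2[OF that(2)] by (intro gen)
      then have "(\<integral>z. (y i z - y j z)\<^sup>2 \<partial>N) / \<epsilon> < e / 2"
        using \<epsilon>(1) by (simp only: pos_divide_less_eq) (simp add: mult.commute)
      then show ?thesis using L1[OF \<epsilon>(1), of i j] \<epsilon>(2) by linarith
    qed
    show ?thesis
    proof (intro exI[of _ "max n1 n2"] allI impI)
      fix i j assume "max n1 n2 \<le> i" "max n1 n2 \<le> j"
      then show "(LINT z|N. norm (y i z - y j z)) < e"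
        using *[of i j] *[of j i] by (cases "i \<le> j") (auto simp: abs_minus_commute)
    qed
  qed
  then obtain r where r: "strict_mono r" "AE z in N. Cauchy (\<lambda>i. y (r i) z)"
    using cauchy_L1_AE_cauchy_subseq[of N y] inty by blast
  show ?thesis
  proof
    show "y (r n) \<in> V n" for n
      using y(1)[of "r n"] anti[OF seq_suble[OF r(1)], of n] by auto
    show "AE z in N. convergent (\<lambda>n. y (r n) z)"
      using r(2) by (simp add: Cauchy_convergent_iff)
  qed
qed

text \<open>The dyadic convex hull of the tail of a sequence of pairs (control, state).  Pairs are combined
  simultaneously, so that the state of a combined control is the combined state.\<close>

inductive_set tail_hull :: "(nat \<Rightarrow> ('t \<Rightarrow> 'a \<Rightarrow> real) \<times> ('t \<Rightarrow> 'a \<Rightarrow> real)) \<Rightarrow> nat \<Rightarrow>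
    (('t \<Rightarrow> 'a \<Rightarrow> real) \<times> ('t \<Rightarrow> 'a \<Rightarrow> real)) set"
  for s :: "nat \<Rightarrow> ('t \<Rightarrow> 'a \<Rightarrow> real) \<times> ('t \<Rightarrow> 'a \<Rightarrow> real)" and n :: nat where
  tail: "n \<le> k \<Longrightarrow> s k \<in> tail_hull s n"
| midpoint: "(a, Y) \<in> tail_hull s n \<Longrightarrow> (b, Z) \<in> tail_hull s n \<Longrightarrow>
    (\<lambda>t \<omega>. (a t \<omega> + b t \<omega>) / 2, \<lambda>t \<omega>. (Y t \<omega> + Z t \<omega>) / 2) \<in> tail_hull s n"

lemma tail_hull_antimono: "m \<le> n \<Longrightarrow> tail_hull s n \<subseteq> tail_hull s m"
proof (rule subsetI)
  fix x assume "x \<in> tail_hull s n" "m \<le> n"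
  then show "x \<in> tail_hull s m"
    by induction (auto intro: tail_hull.intros)
qed

lemma tail_hull_close:
  assumes "(a, Y) \<in> tail_hull s n" and "\<And>k. n \<le> k \<Longrightarrow> \<bar>snd (s k) t \<omega> - x\<bar> \<le> \<epsilon>"
  shows "\<bar>Y t \<omega> - x\<bar> \<le> \<epsilon>"
  using assms(1)
proof (induction "(a, Y)" arbitrary: a Y)
  case (tail k)
  then show ?case using assms(2)[of k] by (metis snd_conv)
next
  case (midpoint a Y b Z)
  then show ?case by (auto simp: abs_le_iff field_simps)
qed

section \<open>Stochastic order in both directions\<close>

lemma st_le_refl: "\<mu> \<le>st \<mu>" and st_le_trans: "\<mu> \<le>st \<nu> \<Longrightarrow> \<nu> \<le>st \<rho> \<Longrightarrow> \<mu> \<le>st \<rho>"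
  by (auto simp: st_le_def intro: order_trans)

text \<open>Whenever \<open>Z\<close> is at most \<open>s\<close>, so is \<open>Y\<close>.\<close>

lemma st_le_distr:
  assumes P: "prob_space P" and [measurable]: "Y \<in> borel_measurable P" "Z \<in> borel_measurable P"
    and le: "AE \<omega> in P. Y \<omega> \<le> (Z \<omega> :: real)"
  shows "distr P borel Y \<le>st distr P borel Z"
  unfolding st_le_def
proof
  fix s
  interpret prob_space P by fact
  have "measure P (Z -` {..s} \<inter> space P) \<le> measure P (Y -` {..s} \<inter> space P)"
    using le by (intro finite_measure_mono_AE) auto
  then show "cdf (distr P borel Z) s \<le> cdf (distr P borel Y) s"
    by (simp add: cdf_def measure_distr)
qed

text \<open>A relation or its converse, according to a Boolean.  With it the increasing iteration
  from the bottom and the decreasing iteration from the top are a single argument.\<close>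

definition dir :: "bool \<Rightarrow> ('b \<Rightarrow> 'b \<Rightarrow> bool) \<Rightarrow> 'b \<Rightarrow> 'b \<Rightarrow> bool" where
  "dir up R x y = (if up then R x y else R y x)"

lemma dir_st_le_trans: "dir up (\<le>st) \<mu> \<nu> \<Longrightarrow> dir up (\<le>st) \<nu> \<rho> \<Longrightarrow> dir up (\<le>st) \<mu> \<rho>"
  by (auto simp: dir_def intro: st_le_trans split: if_splits)

lemma dir_st_le_chain:
  assumes "\<And>n::nat. dir up (\<le>st) (m n) (m (Suc n))" and "i \<le> j"
  shows "dir up (\<le>st) (m i) (m j)"
  using assms(2)
proof (induction j rule: dec_induct)
  case base
  show ?case by (simp add: dir_def st_le_refl)
next
  case (step k)
  from dir_st_le_trans[OF step(3) assms(1)] show ?case .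
qed

lemma dir_bounded_convergent:
  fixes x :: "nat \<Rightarrow> real"
  assumes step: "\<And>n. dir up (\<le>) (x n) (x (Suc n))" and bound: "\<And>n. \<bar>x n\<bar> \<le> b"
  shows "convergent x"
proof -
  have "monoseq x"
    using step by (cases up) (auto simp: dir_def monoseq_Suc)
  moreover have "Bseq x" by (rule BseqI'[of _ b]) (simp add: bound)
  ultimately show ?thesis by (intro Bseq_monoseq_convergent)
qed

lemma dir_limit:
  fixes x :: "nat \<Rightarrow> real"
  assumes "x \<longlonglongrightarrow> l" and "\<And>n. dir up (\<le>) (x n) b"
  shows "dir up (\<le>) l b"
  using assms(2) LIMSEQ_le_const2[OF assms(1), of b] LIMSEQ_le_const[OF assms(1), of b]
  by (cases up) (auto simp: dir_def)

text \<open>Both distribution functions are built from one continuous antitone function \<open>h\<close>: the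
  upper one is \<open>1 - h\<close> and the lower one is the reflection of \<open>h\<close>.\<close>

lemma prob_measures_mu_Min_mu_Max:
  assumes "continuous_on {0..} \<psi>" "strict_mono_on {0..} \<psi>" "\<forall>s\<ge>0. \<psi> s \<ge> (0::real)"
    "filterlim \<psi> at_top at_top" "M > \<psi> 0"
  shows "mu_Min \<psi> M \<in> prob_measures" and "mu_Max \<psi> M \<in> prob_measures"
proof -
  have M: "M > 0" using assms(3,5) by (meson le_less_trans order_refl)
  define h where "h s = M / max M (\<psi> (max 0 s))" for s
  have mono: "\<psi> (max 0 s) \<le> \<psi> (max 0 t)" if "s \<le> t" for s t
    using that by (intro monotone_onD[OF strict_mono_on_imp_mono_on[OF assms(2)]]) auto
  have "continuous_on UNIV (\<lambda>s. \<psi> (max 0 s))"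
    by (intro continuous_on_compose2[OF assms(1)] continuous_intros) auto
  then have cont: "continuous_on UNIV h" unfolding h_def
    by (intro continuous_intros) (use M in \<open>auto simp: max_def\<close>)
  have anti: "h t \<le> h s" if "s \<le> t" for s t
    unfolding h_def using mono[OF that] M by (intro divide_left_mono) (auto simp: max_def)
  have top: "(h \<longlongrightarrow> 0) at_top"
  proof -
    have "filterlim (\<lambda>s. max M (\<psi> (max 0 s))) at_top at_top"
    proof (rule filterlim_at_top_mono[OF assms(4)])
      show "\<forall>\<^sub>F s in at_top. \<psi> s \<le> max M (\<psi> (max 0 s))"
        using eventually_ge_at_top[of 0] by eventually_elim (auto simp: max_def)
    qed
    then show ?thesis unfolding h_def
      by (intro tendsto_divide_0[OF tendsto_const] filterlim_at_top_imp_at_infinity)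
  qed
  have bot: "(h \<longlongrightarrow> 1) at_bot"
    by (rule tendsto_eventually, rule eventually_mono[OF eventually_le_at_bot[of 0]])
       (use assms(5) M in \<open>auto simp: h_def max_def\<close>)
  have contr: "continuous (at_right a) g" if "continuous_on UNIV g" for g :: "real \<Rightarrow> real" and a
    using that by (simp add: continuous_on_eq_continuous_at continuous_at_imp_continuous_at_within)
  have "mu_Min \<psi> M = interval_measure (\<lambda>s. h (- s))"
    unfolding mu_Min_def h_def using M by (intro arg_cong[where f=interval_measure]) (auto simp: max_def fun_eq_iff)
  moreover have "real_distribution (interval_measure (\<lambda>s. h (- s)))"
  proof (rule real_distribution_interval_measure)
    show "((\<lambda>s. h (- s)) \<longlongrightarrow> 0) at_bot"
      by (rule filterlim_compose[OF top filterlim_uminus_at_top_at_bot])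
    show "((\<lambda>s. h (- s)) \<longlongrightarrow> 1) at_top"
      by (rule filterlim_compose[OF bot filterlim_uminus_at_bot_at_top])
    show "continuous (at_right a) (\<lambda>s. h (- s))" for a
      by (intro contr continuous_on_compose2[OF cont] continuous_intros) auto
  qed (use anti in auto)
  ultimately show "mu_Min \<psi> M \<in> prob_measures" by (simp add: real_distribution_iff_prob_measures)
  have "mu_Max \<psi> M = interval_measure (\<lambda>s. 1 - h s)"
    unfolding mu_Max_def h_def using M by (intro arg_cong[where f=interval_measure]) (auto simp: max_def fun_eq_iff)
  moreover have "real_distribution (interval_measure (\<lambda>s. 1 - h s))"
  proof (rule real_distribution_interval_measure)
    show "((\<lambda>s. 1 - h s) \<longlongrightarrow> 0) at_bot" using tendsto_diff[OF tendsto_const bot, of 1] by simp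
    show "((\<lambda>s. 1 - h s) \<longlongrightarrow> 1) at_top" using tendsto_diff[OF tendsto_const top, of 1] by simp
    show "continuous (at_right a) (\<lambda>s. 1 - h s)" for a
      by (intro contr continuous_intros cont)
  qed (use anti in auto)
  ultimately show "mu_Max \<psi> M \<in> prob_measures" by (simp add: real_distribution_iff_prob_measures)
qed

section \<open>The state equation\<close>

locale mfg_setting =
  fixes G :: "'a mfg"
    and \<psi> c p q :: "real \<Rightarrow> real"
    and M r C :: real
  assumes game: "mfg_game G"
    and unique_optimum: "\<And>\<mu>. \<mu> \<in> flows (horizon G) \<Longrightarrow> unique_optimal_pair G \<mu>"
    and psi: "\<forall>s\<ge>0. \<psi> s \<ge> 0" "continuous_on {0..} \<psi>" "strict_mono_on {0..} \<psi>"
      "filterlim \<psi> at_top at_top" "M > \<psi> 0"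
    and psi_bound: "\<And>\<mu> t. \<mu> \<in> flows (horizon G) \<Longrightarrow> t \<in> {0..horizon G} \<Longrightarrow>
      (\<integral>\<^sup>+ \<omega>. ennreal (\<psi> \<bar>optimal_state G \<mu> t \<omega>\<bar>) \<partial>prob_sp G) \<le> ennreal M"
    and submod: "AE (t, \<omega>) in time_measure (horizon G) \<Otimes>\<^sub>M prob_sp G.
      \<forall>\<phi>\<in>{cost_f G t \<omega>, cost_g G \<omega>}. submodular \<phi>"
    and compact_controls: "compact (control_set G)"
    and r_gt_1: "r > 1"
    and init_moment: "integrable (prob_sp G) (\<lambda>\<omega>. \<bar>init_state G \<omega>\<bar> powr r)"
    and drift_affine: "\<And>t x a. t \<in> {0..horizon G} \<Longrightarrow> a \<in> control_set G \<Longrightarrow>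
      drift G t x a = c t + p t * x + q t * a"
    and coeff_cont: "continuous_on {0..horizon G} c" "continuous_on {0..horizon G} p"
      "continuous_on {0..horizon G} q"
    and f_cont: "\<And>t \<omega>. t \<in> {0..horizon G} \<Longrightarrow> \<omega> \<in> space (prob_sp G) \<Longrightarrow>
      continuous_map (prod_topology euclidean weak_topology) euclidean (\<lambda>(x, \<mu>). cost_f G t \<omega> x \<mu>)"
    and g_cont: "\<And>\<omega>. \<omega> \<in> space (prob_sp G) \<Longrightarrow>
      continuous_map (prod_topology euclidean weak_topology) euclidean (\<lambda>(x, \<mu>). cost_g G \<omega> x \<mu>)"
    and l_convex: "\<And>t \<omega>. t \<in> {0..horizon G} \<Longrightarrow> \<omega> \<in> space (prob_sp G) \<Longrightarrow>
      convex_on (UNIV \<times> control_set G) (\<lambda>(x, a). cost_l G t \<omega> x a)"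
    and l_lsc: "\<And>t \<omega>. t \<in> {0..horizon G} \<Longrightarrow> \<omega> \<in> space (prob_sp G) \<Longrightarrow>
      lsc_on (UNIV \<times> control_set G) (\<lambda>(x, a). cost_l G t \<omega> x a)"
    and C_pos: "C > 0"
    and growth: "\<And>\<omega> t x a \<mu>. \<omega> \<in> space (prob_sp G) \<Longrightarrow> t \<in> {0..horizon G} \<Longrightarrow>
      a \<in> control_set G \<Longrightarrow> \<mu> \<in> st_interval \<psi> M \<Longrightarrow>
        \<bar>cost_f G t \<omega> x \<mu>\<bar> + \<bar>cost_l G t \<omega> x a\<bar> + \<bar>cost_g G \<omega> x \<mu>\<bar> \<le> C * (1 + \<bar>x\<bar> powr r)"
begin

abbreviation "P \<equiv> prob_sp G"
abbreviation "F \<equiv> filt G"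
abbreviation "T \<equiv> horizon G"
abbreviation "\<xi> \<equiv> init_state G"
abbreviation "\<sigma> \<equiv> volatility G"
abbreviation "U \<equiv> control_set G"
abbreviation "Q \<equiv> time_measure T \<Otimes>\<^sub>M P"

lemma T_pos: "0 < T" and prob_space_P: "prob_space P"
  and subalgebra_F: "t \<in> {0..T} \<Longrightarrow> subalgebra P (F t)"
  and filtration_mono: "0 \<le> s \<Longrightarrow> s \<le> t \<Longrightarrow> t \<le> T \<Longrightarrow> sets (F s) \<subseteq> sets (F t)"
  and null_sets_F: "null_sets P \<subseteq> sets (F 0)"
  and brownian: "brownian_motion P T F (noise G)"
  and xi_measurable: "\<xi> \<in> borel_measurable (F 0)"
  and sigma_nonneg: "0 \<le> \<sigma>"
  using game by (auto simp: mfg_game_def filtration_upto_def Let_def)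

sublocale P: prob_space P by (rule prob_space_P)

lemma space_F: "t \<in> {0..T} \<Longrightarrow> space (F t) = space P"
  using subalgebra_F by (auto simp: subalgebra_def)

lemma F_measurable_mono:
  assumes "Y \<in> borel_measurable (F s)" "0 \<le> s" "s \<le> t" "t \<le> T"
  shows "Y \<in> borel_measurable (F t)"
  by (rule measurable_from_subalg[OF _ assms(1)])
     (use filtration_mono[OF assms(2-4)] space_F assms in \<open>auto simp: subalgebra_def\<close>)

lemma F_measurable_P: "Y \<in> borel_measurable (F t) \<Longrightarrow> t \<in> {0..T} \<Longrightarrow> Y \<in> borel_measurable P"
  using measurable_from_subalg[OF subalgebra_F] by auto

lemma xi_measurable_F: "t \<in> {0..T} \<Longrightarrow> \<xi> \<in> borel_measurable (F t)"
  using F_measurable_mono[OF xi_measurable, of t] by auto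

lemma xi_measurable_P [measurable]: "\<xi> \<in> borel_measurable P"
  using F_measurable_P[OF xi_measurable] T_pos by auto

lemma null_sets_in_F:
  assumes "N \<in> null_sets P" "t \<in> {0..T}"
  shows "N \<in> sets (F t)"
  using null_sets_F filtration_mono[of 0 t] assms by auto

lemma sets_time_measure: "sets (time_measure T) = sets (restrict_space borel {0..T})"
  by (simp add: time_measure_def sets_restrict_space)

lemma space_time_measure: "space (time_measure T) = {0..T}"
  by (simp add: time_measure_def space_restrict_space)

sublocale time: finite_measure "time_measure T"
  using T_pos by (intro finite_measureI) (simp add: time_measure_def emeasure_restrict_space space_restrict_space)

sublocale Q: pair_sigma_finite "time_measure T" P ..

sublocale Qfin: finite_measure Q
proof
  show "emeasure Q (space Q) \<noteq> \<infinity>"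
    by (simp add: space_pair_measure P.emeasure_pair_measure_Times ennreal_mult_eq_top_iff P.emeasure_space_1)
qed

lemma space_Q: "space Q = {0..T} \<times> space P"
  by (simp add: space_pair_measure space_time_measure)

lemma integral_time_measure: "(\<integral>t. h t \<partial>time_measure T) = (LBINT t:{0..T}. (h t :: real))"
  by (simp add: time_measure_def integral_restrict_space set_lebesgue_integral_def)

lemma integrable_time_measure: "integrable (time_measure T) (h :: real \<Rightarrow> real) \<longleftrightarrow> set_integrable lborel {0..T} h"
  by (simp add: time_measure_def integrable_restrict_space set_integrable_def)

lemma progressive_measurable:
  assumes "progressive T F Y"
  shows "(\<lambda>(t, \<omega>). Y t \<omega>) \<in> borel_measurable Q"
proof -
  have T: "T \<in> {0..T}" using T_pos by auto
  have "(\<lambda>(s, \<omega>). Y s \<omega>) \<in> borel_measurable (restrict_space borel {0..T} \<Otimes>\<^sub>M F T)"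
    using assms T by (auto simp: progressive_def)
  moreover have "(\<lambda>z. z) \<in> restrict_space borel {0..T} \<Otimes>\<^sub>M P \<rightarrow>\<^sub>M restrict_space borel {0..T} \<Otimes>\<^sub>M F T"
  proof (rule measurable_pair)
    show "fst \<circ> (\<lambda>z. z) \<in> restrict_space borel {0..T} \<Otimes>\<^sub>M P \<rightarrow>\<^sub>M restrict_space borel {0..T}"
      by (simp add: comp_def)
    have "(\<lambda>x. x) \<in> P \<rightarrow>\<^sub>M F T" by (rule measurable_from_subalg[OF subalgebra_F[OF T]]) simp
    then show "snd \<circ> (\<lambda>z. z) \<in> restrict_space borel {0..T} \<Otimes>\<^sub>M P \<rightarrow>\<^sub>M F T"
      using measurable_compose[OF measurable_snd] by (simp add: comp_def)
  qed
  ultimately have "(\<lambda>(t, \<omega>). Y t \<omega>) \<in> borel_measurable (restrict_space borel {0..T} \<Otimes>\<^sub>M P)"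
    by (rule measurable_compose[rotated])
  also have "borel_measurable (restrict_space borel {0..T} \<Otimes>\<^sub>M P) = borel_measurable Q"
    by (intro measurable_cong_sets sets_pair_measure_cong refl) (simp add: sets_time_measure)
  finally show ?thesis .
qed

lemma continuous_adapted_progressive:
  assumes "\<And>t. t \<in> {0..T} \<Longrightarrow> Y t \<in> borel_measurable (F t)"
    and "\<And>\<omega>. \<omega> \<in> space P \<Longrightarrow> continuous_on {0..T} (\<lambda>t. Y t \<omega>)"
  shows "progressive T F Y"
  unfolding progressive_def
proof
  fix t assume t: "t \<in> {0..T}"
  show "(\<lambda>(s, \<omega>). Y s \<omega>) \<in> borel_measurable (restrict_space borel {0..t} \<Otimes>\<^sub>M F t)"
  proof (rule continuous_process_jointly_measurable)
    show "Y s \<in> borel_measurable (F t)" if "s \<in> {0..t}" for s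
      using F_measurable_mono[OF assms(1)[of s], of t] that t by auto
    show "continuous_on {0..t} (\<lambda>s. Y s \<omega>)" if "\<omega> \<in> space (F t)" for \<omega>
      using continuous_on_subset[OF assms(2)[of \<omega>], of "{0..t}"] that t space_F by auto
  qed (use t in auto)
qed

lemma progressive_section:
  assumes "progressive T F Y" "\<omega> \<in> space P"
  shows "(\<lambda>t. Y t \<omega>) \<in> borel_measurable (time_measure T)"
  using measurable_compose[OF measurable_Pair2'[OF assms(2)] progressive_measurable[OF assms(1)]] by simp

text \<open>A version of the noise all of whose paths are continuous; it is again adapted, because the
  filtration contains the null sets.\<close>

definition bad_noise :: "'a set" where
  "bad_noise = (SOME N. N \<in> null_sets P \<and>
     (\<forall>\<omega>\<in>space P - N. noise G 0 \<omega> = 0 \<and> continuous_on {0..T} (\<lambda>t. noise G t \<omega>)))"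

definition W :: "real \<Rightarrow> 'a \<Rightarrow> real" where
  "W t \<omega> = (if \<omega> \<in> bad_noise then 0 else noise G t \<omega>)"

lemma bad_noise: "bad_noise \<in> null_sets P"
  "\<omega> \<in> space P \<Longrightarrow> \<omega> \<notin> bad_noise \<Longrightarrow> noise G 0 \<omega> = 0 \<and> continuous_on {0..T} (\<lambda>t. noise G t \<omega>)"
proof -
  have "AE \<omega> in P. noise G 0 \<omega> = 0 \<and> continuous_on {0..T} (\<lambda>t. noise G t \<omega>)"
    using brownian by (simp add: brownian_motion_def)
  then obtain N where "N \<in> null_sets P" 
    "{\<omega> \<in> space P. \<not> (noise G 0 \<omega> = 0 \<and> continuous_on {0..T} (\<lambda>t. noise G t \<omega>))} \<subseteq> N"
    unfolding eventually_ae_filter by auto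
  then have "\<exists>N. N \<in> null_sets P \<and>
     (\<forall>\<omega>\<in>space P - N. noise G 0 \<omega> = 0 \<and> continuous_on {0..T} (\<lambda>t. noise G t \<omega>))" by blast
  from someI_ex[OF this, folded bad_noise_def]
  show "bad_noise \<in> null_sets P"
    "\<omega> \<in> space P \<Longrightarrow> \<omega> \<notin> bad_noise \<Longrightarrow> noise G 0 \<omega> = 0 \<and> continuous_on {0..T} (\<lambda>t. noise G t \<omega>)"
    by auto
qed

lemma W_AE: "AE \<omega> in P. \<forall>t. noise G t \<omega> = W t \<omega>"
  by (rule AE_I'[OF bad_noise(1)]) (auto simp: W_def)

lemma W_zero: "\<omega> \<in> space P \<Longrightarrow> W 0 \<omega> = 0"
  using bad_noise(2) by (auto simp: W_def)

lemma W_cont: "\<omega> \<in> space P \<Longrightarrow> continuous_on {0..T} (\<lambda>t. W t \<omega>)"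
  using bad_noise(2)[of \<omega>] by (cases "\<omega> \<in> bad_noise") (auto simp: W_def)

lemma W_adapted: "t \<in> {0..T} \<Longrightarrow> W t \<in> borel_measurable (F t)"
  unfolding W_def using brownian null_sets_in_F[OF bad_noise(1)]
  by (intro measurable_If_set) (auto simp: brownian_motion_def intro: sets.Int_space_eq2)

lemma W_progressive: "progressive T F W"
  by (rule continuous_adapted_progressive[OF W_adapted W_cont])

lemma W_measurable [measurable]: "t \<in> {0..T} \<Longrightarrow> W t \<in> borel_measurable P"
  by (rule F_measurable_P[OF W_adapted])

text \<open>A single constant for the coefficients and the controls keeps the pathwise estimates short.\<close>

definition K :: real where
  "K = (SOME k. 0 < k \<and> (\<forall>t\<in>{0..T}. \<bar>c t\<bar> \<le> k \<and> \<bar>p t\<bar> \<le> k \<and> \<bar>q t\<bar> \<le> k) \<and> (\<forall>a\<in>U. \<bar>a\<bar> \<le> k))"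

lemma K_pos: "0 < K" and K_coeff: "t \<in> {0..T} \<Longrightarrow> \<bar>c t\<bar> \<le> K" "t \<in> {0..T} \<Longrightarrow> \<bar>p t\<bar> \<le> K"
    "t \<in> {0..T} \<Longrightarrow> \<bar>q t\<bar> \<le> K"
  and K_control: "a \<in> U \<Longrightarrow> \<bar>a\<bar> \<le> K"
proof -
  have b: "\<exists>k. \<forall>t\<in>{0..T}. \<bar>h t\<bar> \<le> k" if "continuous_on {0..T} h" for h :: "real \<Rightarrow> real"
    using compact_imp_bounded[OF compact_continuous_image[OF that compact_Icc]] by (auto simp: bounded_real)
  obtain k1 k2 k3 where k: "\<And>t. t \<in> {0..T} \<Longrightarrow> \<bar>c t\<bar> \<le> k1" "\<And>t. t \<in> {0..T} \<Longrightarrow> \<bar>p t\<bar> \<le> k2"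
      "\<And>t. t \<in> {0..T} \<Longrightarrow> \<bar>q t\<bar> \<le> k3"
    using b[OF coeff_cont(1)] b[OF coeff_cont(2)] b[OF coeff_cont(3)] by metis
  obtain k4 where k4: "\<And>a. a \<in> U \<Longrightarrow> \<bar>a\<bar> \<le> k4"
    using compact_imp_bounded[OF compact_controls] by (auto simp: bounded_real)
  let ?k = "max 1 (max (max k1 k2) (max k3 k4))"
  have "0 < ?k \<and> (\<forall>t\<in>{0..T}. \<bar>c t\<bar> \<le> ?k \<and> \<bar>p t\<bar> \<le> ?k \<and> \<bar>q t\<bar> \<le> ?k) \<and> (\<forall>a\<in>U. \<bar>a\<bar> \<le> ?k)"
    using k k4 by (auto simp: le_max_iff_disj)
  from someI[of "\<lambda>k. 0 < k \<and> (\<forall>t\<in>{0..T}. \<bar>c t\<bar> \<le> k \<and> \<bar>p t\<bar> \<le> k \<and> \<bar>q t\<bar> \<le> k) \<and> (\<forall>a\<in>U. \<bar>a\<bar> \<le> k)", OF this]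
  show "0 < K" "t \<in> {0..T} \<Longrightarrow> \<bar>c t\<bar> \<le> K" "t \<in> {0..T} \<Longrightarrow> \<bar>p t\<bar> \<le> K"
    "t \<in> {0..T} \<Longrightarrow> \<bar>q t\<bar> \<le> K" "a \<in> U \<Longrightarrow> \<bar>a\<bar> \<le> K"
    unfolding K_def[symmetric] by auto
qed

text \<open>Controls are bounded, hence square integrable on the finite product space.\<close>

lemma admissible_iff:
  "\<alpha> \<in> admissible G \<longleftrightarrow> progressive T F \<alpha> \<and> (\<forall>t\<in>{0..T}. \<forall>\<omega>\<in>space P. \<alpha> t \<omega> \<in> U)"
proof -
  have "integrable Q (\<lambda>(t, \<omega>). (\<alpha> t \<omega>)\<^sup>2)"
    if "progressive T F \<alpha>" "\<forall>t\<in>{0..T}. \<forall>\<omega>\<in>space P. \<alpha> t \<omega> \<in> U"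
  proof (rule Qfin.integrable_const_bound[where B="K\<^sup>2"])
    show "AE z in Q. norm (case z of (t, \<omega>) \<Rightarrow> (\<alpha> t \<omega>)\<^sup>2) \<le> K\<^sup>2"
    proof (rule AE_I2)
      fix z assume "z \<in> space Q"
      then have "\<bar>\<alpha> (fst z) (snd z)\<bar> \<le> K" using that(2) K_control by (auto simp: space_Q)
      then show "norm (case z of (t, \<omega>) \<Rightarrow> (\<alpha> t \<omega>)\<^sup>2) \<le> K\<^sup>2"
        using power_mono[of "\<bar>\<alpha> (fst z) (snd z)\<bar>" K 2] by (simp add: split_beta')
    qed
    show "(\<lambda>(t, \<omega>). (\<alpha> t \<omega>)\<^sup>2) \<in> borel_measurable Q"
      using borel_measurable_power[OF progressive_measurable[OF that(1)], of 2] by (simp add: split_beta')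
  qed
  then show ?thesis by (auto simp: admissible_def)
qed

lemma control_path_integrable:
  assumes "\<alpha> \<in> admissible G" "\<omega> \<in> space P"
  shows "set_integrable lborel {0..T} (\<lambda>s. \<alpha> s \<omega>)"
  unfolding integrable_time_measure[symmetric]
  by (rule time.integrable_const_bound[where B=K])
     (use assms K_control progressive_section[OF _ assms(2), of \<alpha>] 
      in \<open>auto simp: admissible_iff space_time_measure intro!: AE_I2\<close>)

lemma affine_path_integrable:
  assumes "\<alpha> \<in> admissible G" "\<omega> \<in> space P" "continuous_on {0..T} x" "t \<in> {0..T}"
  shows "set_integrable lborel {0..t} (\<lambda>s. c s + p s * x s + q s * \<alpha> s \<omega>)"
proof -
  have "set_integrable lborel {0..T} (\<lambda>s. c s + p s * x s)"
    by (intro borel_integrable_atLeastAtMost' continuous_intros coeff_cont assms(3))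
  moreover have "set_integrable lborel {0..T} (\<lambda>s. q s * \<alpha> s \<omega>)"
    by (rule set_integrable_continuous_mult[OF coeff_cont(3) control_path_integrable[OF assms(1,2)]])
  ultimately have "set_integrable lborel {0..T} (\<lambda>s. c s + p s * x s + q s * \<alpha> s \<omega>)"
    by (rule set_integral_add)
  then show ?thesis by (rule set_integrable_subset) (use assms(4) in auto)
qed

text \<open>The drift along a state and its control, and the right-hand side of the state equation.\<close>

abbreviation (input) rate :: "(real \<Rightarrow> 'a \<Rightarrow> real) \<Rightarrow> (real \<Rightarrow> 'a \<Rightarrow> real) \<Rightarrow> real \<Rightarrow> 'a \<Rightarrow> real" where
  "rate \<alpha> X s \<omega> \<equiv> c s + p s * X s \<omega> + q s * \<alpha> s \<omega>"

abbreviation (input) evolved :: "(real \<Rightarrow> 'a \<Rightarrow> real) \<Rightarrow> (real \<Rightarrow> 'a \<Rightarrow> real) \<Rightarrow> real \<Rightarrow> 'a \<Rightarrow> real" where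
  "evolved \<alpha> X t \<omega> \<equiv> \<xi> \<omega> + (LBINT s:{0..t}. rate \<alpha> X s \<omega>) + \<sigma> * W t \<omega>"

text \<open>For admissible controls the drift is the affine expression, which is integrable along every continuous
  path, and the noise may be exchanged for its continuous version.\<close>

lemma strong_solution_iff:
  assumes "\<alpha> \<in> admissible G"
  shows "strong_solution G \<alpha> X \<longleftrightarrow>
     (\<forall>t\<in>{0..T}. X t \<in> borel_measurable (F t)) \<and>
     (\<forall>\<omega>\<in>space P. continuous_on {0..T} (\<lambda>t. X t \<omega>)) \<and>
     (AE \<omega> in P. \<forall>t\<in>{0..T}. 
        X t \<omega> = evolved \<alpha> X t \<omega>)"
proof -
  have drift: "drift G s (X s \<omega>) (\<alpha> s \<omega>) = rate \<alpha> X s \<omega>"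
    if "s \<in> {0..t}" "t \<in> {0..T}" "\<omega> \<in> space P" for s t \<omega>
    using that assms by (intro drift_affine) (auto simp: admissible_iff)
  have "(\<forall>t\<in>{0..T}. set_integrable lborel {0..t} (\<lambda>s. drift G s (X s \<omega>) (\<alpha> s \<omega>)) \<and>
        X t \<omega> = \<xi> \<omega> + (LBINT s:{0..t}. drift G s (X s \<omega>) (\<alpha> s \<omega>)) + \<sigma> * noise G t \<omega>) \<longleftrightarrow>
     (\<forall>t\<in>{0..T}. 
        X t \<omega> = evolved \<alpha> X t \<omega>)"
    if X: "continuous_on {0..T} (\<lambda>t. X t \<omega>)" and w: "\<omega> \<in> space P" "\<forall>t. noise G t \<omega> = W t \<omega>" for \<omega>
  proof (rule ball_cong[OF refl])
    fix t assume t: "t \<in> {0..T}"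
    have "set_integrable lborel {0..t} (\<lambda>s. drift G s (X s \<omega>) (\<alpha> s \<omega>))"
      using affine_path_integrable[OF assms w(1) X t]
      by (rule set_integrable_cong[THEN iffD2, rotated -1]) (use drift[OF _ t w(1)] in auto)
    moreover have "(LBINT s:{0..t}. drift G s (X s \<omega>) (\<alpha> s \<omega>)) = 
        (LBINT s:{0..t}. rate \<alpha> X s \<omega>)"
      by (rule set_lebesgue_integral_cong) (use drift[OF _ t w(1)] in auto)
    ultimately show "(set_integrable lborel {0..t} (\<lambda>s. drift G s (X s \<omega>) (\<alpha> s \<omega>)) \<and>
        X t \<omega> = \<xi> \<omega> + (LBINT s:{0..t}. drift G s (X s \<omega>) (\<alpha> s \<omega>)) + \<sigma> * noise G t \<omega>) \<longleftrightarrow>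
        X t \<omega> = evolved \<alpha> X t \<omega>"
      using w by simp
  qed
  note eq = this
  show ?thesis
    unfolding strong_solution_def
  proof (intro conj_cong refl)
    assume c: "\<forall>\<omega>\<in>space P. continuous_on {0..T} (\<lambda>t. X t \<omega>)"
    have "AE \<omega> in P. (\<forall>t\<in>{0..T}. set_integrable lborel {0..t} (\<lambda>s. drift G s (X s \<omega>) (\<alpha> s \<omega>)) \<and>
        X t \<omega> = \<xi> \<omega> + (LBINT s:{0..t}. drift G s (X s \<omega>) (\<alpha> s \<omega>)) + \<sigma> * noise G t \<omega>) \<longleftrightarrow>
     (\<forall>t\<in>{0..T}. 
        X t \<omega> = evolved \<alpha> X t \<omega>)"
      using W_AE AE_space by eventually_elim (rule eq, use c in auto)
    then show "(AE \<omega> in P. \<forall>t\<in>{0..T}. set_integrable lborel {0..t} (\<lambda>s. drift G s (X s \<omega>) (\<alpha> s \<omega>)) \<and>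
        X t \<omega> = \<xi> \<omega> + (LBINT s:{0..t}. drift G s (X s \<omega>) (\<alpha> s \<omega>)) + \<sigma> * noise G t \<omega>) \<longleftrightarrow>
     (AE \<omega> in P. \<forall>t\<in>{0..T}. 
        X t \<omega> = evolved \<alpha> X t \<omega>)"
      by (rule eventually_cong)
  qed
qed

text \<open>Subtracting the noise \<open>\<sigma> W\<close> from the state leaves a linear equation path by path, which variation of
  constants solves by a formula that is visibly adapted.  Existence for every admissible control is
  needed because the cost functional chooses some state of each competitor.\<close>

lemma strong_solution_exists:
  assumes \<alpha>: "\<alpha> \<in> admissible G"
  shows "\<exists>X. strong_solution G \<alpha> X"
proof -
  define E where "E t = exp (integral {0..t} p)" for t
  define h where "h s \<omega> = c s + p s * (\<sigma> * W s \<omega>) + q s * \<alpha> s \<omega>" for s \<omega>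
  define X where "X t \<omega> = E t * (\<xi> \<omega> + (LBINT s:{0..t}. h s \<omega> / E s)) + \<sigma> * W t \<omega>" for t \<omega>
  have contE: "continuous_on {0..T} E" unfolding E_def
    by (intro continuous_intros indefinite_integral_continuous_1 integrable_continuous_real coeff_cont)
  have hint: "set_integrable lborel {0..t} (\<lambda>s. h s \<omega>)" if "\<omega> \<in> space P" "t \<in> {0..T}" for \<omega> t
    unfolding h_def by (intro affine_path_integrable[OF \<alpha>] continuous_intros W_cont that)
  have voc: "continuous_on {0..T} (\<lambda>t. E t * (\<xi> \<omega> + (LBINT s:{0..t}. h s \<omega> / E s)))"
    "t \<in> {0..T} \<Longrightarrow> E t * (\<xi> \<omega> + (LBINT s:{0..t}. h s \<omega> / E s)) =
      \<xi> \<omega> + (LBINT s:{0..t}. h s \<omega> + p s * (E s * (\<xi> \<omega> + (LBINT s:{0..s}. h s \<omega> / E s))))"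
    if "\<omega> \<in> space P" for \<omega> t
    using variation_of_constants[OF coeff_cont(2) hint[OF that, of T], where z="\<xi> \<omega>"] T_pos
    by (simp_all add: E_def)
  have "strong_solution G \<alpha> X"
    unfolding strong_solution_iff[OF \<alpha>]
  proof (intro conjI ballI AE_I2)
    fix \<omega> assume w: "\<omega> \<in> space P"
    show "continuous_on {0..T} (\<lambda>t. X t \<omega>)"
      unfolding X_def by (intro continuous_intros voc(1) W_cont w)
    fix t assume t: "t \<in> {0..T}"
    have "(LBINT s:{0..t}. h s \<omega> + p s * (E s * (\<xi> \<omega> + (LBINT s:{0..s}. h s \<omega> / E s)))) =
      (LBINT s:{0..t}. rate \<alpha> X s \<omega>)"
      by (simp add: h_def X_def algebra_simps)
    then show "X t \<omega> = evolved \<alpha> X t \<omega>"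
      using voc(2)[OF w t] by (simp add: X_def)
  next
    fix t assume t: "t \<in> {0..T}"
    let ?R = "restrict_space borel {0..t}"
    have [measurable]: "(\<lambda>z. \<alpha> (fst z) (snd z)) \<in> borel_measurable (?R \<Otimes>\<^sub>M F t)"
      "(\<lambda>z. W (fst z) (snd z)) \<in> borel_measurable (?R \<Otimes>\<^sub>M F t)"
      using \<alpha> W_progressive t by (auto simp: admissible_iff progressive_def split_beta')
    have m: "g \<in> borel_measurable ?R" if "continuous_on {0..T} g" for g :: "real \<Rightarrow> real"
      by (rule borel_measurable_continuous_on_restrict, rule continuous_on_subset[OF that]) (use t in auto)
    note [measurable] = m[OF coeff_cont(1)] m[OF coeff_cont(2)] m[OF coeff_cont(3)] m[OF contE]
    have "(\<lambda>z. h (fst z) (snd z) / E (fst z)) \<in> borel_measurable (?R \<Otimes>\<^sub>M F t)"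
      unfolding h_def by measurable
    also have "borel_measurable (?R \<Otimes>\<^sub>M F t) = borel_measurable (restrict_space lborel {0..t} \<Otimes>\<^sub>M F t)"
      by (intro measurable_cong_sets sets_pair_measure_cong refl) (simp add: sets_restrict_space)
    finally have meas: "(\<lambda>z. h (fst z) (snd z) / E (fst z)) \<in> borel_measurable (restrict_space lborel {0..t} \<Otimes>\<^sub>M F t)" .
    interpret R: sigma_finite_measure "restrict_space lborel {0..t}"
      by (intro finite_measure.axioms(1) finite_measureI)
         (use t in \<open>auto simp: emeasure_restrict_space space_restrict_space\<close>)
    have "(\<lambda>\<omega>. \<integral>s. h s \<omega> / E s \<partial>restrict_space lborel {0..t}) \<in> borel_measurable (F t)"
      using measurable_compose[OF measurable_pair_swap' meas]
      by (intro R.borel_measurable_lebesgue_integral) (simp add: split_beta')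
    then have [measurable]: "(\<lambda>\<omega>. LBINT s:{0..t}. h s \<omega> / E s) \<in> borel_measurable (F t)"
      by (simp add: integral_restrict_space set_lebesgue_integral_def)
    note [measurable] = xi_measurable_F[OF t] W_adapted[OF t]
    show "X t \<in> borel_measurable (F t)"
      unfolding X_def by measurable
  qed
  then show ?thesis by blast
qed

lemma strong_solution_state: "\<alpha> \<in> admissible G \<Longrightarrow> strong_solution G \<alpha> (state G \<alpha>)"
  unfolding state_def by (rule someI_ex[OF strong_solution_exists])

lemma strong_solution_unique:
  assumes \<alpha>: "\<alpha> \<in> admissible G" and X: "strong_solution G \<alpha> X" and Y: "strong_solution G \<alpha> Y"
  shows "AE \<omega> in P. \<forall>t\<in>{0..T}. X t \<omega> = Y t \<omega>"
proof -
  note X = X[unfolded strong_solution_iff[OF \<alpha>]] and Y = Y[unfolded strong_solution_iff[OF \<alpha>]]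
  show ?thesis
    using X[THEN conjunct2, THEN conjunct2] Y[THEN conjunct2, THEN conjunct2] AE_space
  proof eventually_elim
    case (elim \<omega>)
    have cont: "continuous_on {0..T} (\<lambda>t. X t \<omega>)" "continuous_on {0..T} (\<lambda>t. Y t \<omega>)"
      using X Y elim by auto
    have "\<bar>X t \<omega> - Y t \<omega>\<bar> \<le> 0 * exp (K * t)" if t: "t \<in> {0..T}" for t
    proof (rule gronwall_integral[OF _ _ _ t])
      show "continuous_on {0..T} (\<lambda>t. \<bar>X t \<omega> - Y t \<omega>\<bar>)" by (intro continuous_intros cont)
      show "0 \<le> K" using K_pos by simp
      fix u assume u: "u \<in> {0..T}"
      have i: "set_integrable lborel {0..u} (\<lambda>s. \<bar>X s \<omega> - Y s \<omega>\<bar>)"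
        by (intro borel_integrable_atLeastAtMost' continuous_intros continuous_on_subset[OF cont(1)] 
            continuous_on_subset[OF cont(2)]) (use u in auto)
      have "\<bar>X u \<omega> - Y u \<omega>\<bar> = \<bar>LBINT s:{0..u}. p s * (X s \<omega> - Y s \<omega>)\<bar>"
      proof -
        have "X u \<omega> - Y u \<omega> = (LBINT s:{0..u}. rate \<alpha> X s \<omega>) -
          (LBINT s:{0..u}. rate \<alpha> Y s \<omega>)"
          using elim(1,2) u by simp
        also have "\<dots> = (LBINT s:{0..u}. (rate \<alpha> X s \<omega>) - (rate \<alpha> Y s \<omega>))"
          by (rule set_integral_diff(2)[symmetric]) (intro affine_path_integrable[OF \<alpha>] elim cont u)+
        finally show ?thesis by (simp add: algebra_simps)
      qed
      also have "\<dots> \<le> (LBINT s:{0..u}. \<bar>p s * (X s \<omega> - Y s \<omega>)\<bar>)"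
        unfolding set_lebesgue_integral_def using integral_abs_bound[of lborel "\<lambda>s. indicator {0..u} s *\<^sub>R (p s * (X s \<omega> - Y s \<omega>))"]
        by (simp add: abs_mult)
      also have "\<dots> \<le> (LBINT s:{0..u}. K * \<bar>X s \<omega> - Y s \<omega>\<bar>)"
      proof (rule set_integral_mono)
        show "set_integrable lborel {0..u} (\<lambda>s. \<bar>p s * (X s \<omega> - Y s \<omega>)\<bar>)"
          by (intro borel_integrable_atLeastAtMost' continuous_intros continuous_on_subset[OF cont(1)] 
            continuous_on_subset[OF cont(2)] continuous_on_subset[OF coeff_cont(2)]) (use u in auto)
        show "set_integrable lborel {0..u} (\<lambda>s. K * \<bar>X s \<omega> - Y s \<omega>\<bar>)" using i by simp
      qed (use K_coeff(2) u in \<open>auto simp: abs_mult intro!: mult_right_mono\<close>)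
      finally show "\<bar>X u \<omega> - Y u \<omega>\<bar> \<le> 0 + K * (LBINT s:{0..u}. \<bar>X s \<omega> - Y s \<omega>\<bar>)" by simp
    qed
    then show ?case by simp
  qed
qed

text \<open>The Gronwall bound for the state; it contains no control and is therefore common to all states.\<close>

definition envelope :: "real \<Rightarrow> 'a \<Rightarrow> real" where
  "envelope t \<omega> = exp (K * T) * (\<bar>\<xi> \<omega>\<bar> + T * (K + K * K) + K * \<sigma> * (LBINT s:{0..T}. \<bar>W s \<omega>\<bar>)) + \<sigma> * \<bar>W t \<omega>\<bar>"

lemma envelope_nonneg: "0 \<le> envelope t \<omega>"
proof -
  have "0 \<le> (LBINT s:{0..T}. \<bar>W s \<omega>\<bar>)" unfolding set_lebesgue_integral_def
    by (rule Bochner_Integration.integral_nonneg) simp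
  then show ?thesis unfolding envelope_def using K_pos sigma_nonneg T_pos by simp
qed

text \<open>Gronwall's inequality for the state minus the noise \<open>\<sigma> W\<close>, which has an absolutely continuous path.\<close>

lemma strong_solution_bound:
  assumes \<alpha>: "\<alpha> \<in> admissible G" and X: "strong_solution G \<alpha> X"
  shows "AE \<omega> in P. \<forall>t\<in>{0..T}. \<bar>X t \<omega>\<bar> \<le> envelope t \<omega>"
proof -
  note X = X[unfolded strong_solution_iff[OF \<alpha>]]
  show ?thesis
    using X[THEN conjunct2, THEN conjunct2] AE_space
  proof eventually_elim
    case (elim \<omega>)
    let ?Z = "\<lambda>t. X t \<omega> - \<sigma> * W t \<omega>"
    let ?I = "LBINT s:{0..T}. \<bar>W s \<omega>\<bar>"
    let ?A = "\<bar>\<xi> \<omega>\<bar> + T * (K + K * K) + K * \<sigma> * ?I"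
    have contW: "continuous_on {0..T} (\<lambda>t. W t \<omega>)" by (rule W_cont[OF elim(2)])
    have contX: "continuous_on {0..T} (\<lambda>t. X t \<omega>)" using X elim by auto
    have contZ: "continuous_on {0..T} ?Z" by (intro continuous_intros contX contW)
    have Z: "\<bar>?Z t\<bar> \<le> ?A * exp (K * t)" if t: "t \<in> {0..T}" for t
    proof (rule gronwall_integral[OF _ _ _ t])
      show "continuous_on {0..T} (\<lambda>t. \<bar>?Z t\<bar>)" by (intro continuous_intros contZ)
      show "0 \<le> K" using K_pos by simp
      fix u assume u: "u \<in> {0..T}"
      have cu: "continuous_on {0..u} g" if "continuous_on {0..T} g" for g :: "real \<Rightarrow> real"
        by (rule continuous_on_subset[OF that]) (use u in auto)
      have "\<bar>?Z u\<bar> = \<bar>\<xi> \<omega> + (LBINT s:{0..u}. rate \<alpha> X s \<omega>)\<bar>"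
        using elim(1) u by simp
      also have "\<dots> \<le> \<bar>\<xi> \<omega>\<bar> + (LBINT s:{0..u}. \<bar>rate \<alpha> X s \<omega>\<bar>)"
      proof -
        have "\<bar>LBINT s:{0..u}. rate \<alpha> X s \<omega>\<bar> \<le> (LBINT s:{0..u}. \<bar>rate \<alpha> X s \<omega>\<bar>)"
          unfolding set_lebesgue_integral_def
          using integral_abs_bound[of lborel "\<lambda>s. indicator {0..u} s *\<^sub>R (rate \<alpha> X s \<omega>)"]
          by (simp add: abs_mult)
        then show ?thesis by linarith
      qed
      also have "(LBINT s:{0..u}. \<bar>rate \<alpha> X s \<omega>\<bar>) \<le>
          (LBINT s:{0..u}. (K + K * K) + K * \<sigma> * \<bar>W s \<omega>\<bar> + K * \<bar>?Z s\<bar>)"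
      proof (rule set_integral_mono)
        show "set_integrable lborel {0..u} (\<lambda>s. \<bar>rate \<alpha> X s \<omega>\<bar>)"
          by (intro set_integrable_abs affine_path_integrable[OF \<alpha> elim(2) contX u])
        show "set_integrable lborel {0..u} (\<lambda>s. (K + K * K) + K * \<sigma> * \<bar>W s \<omega>\<bar> + K * \<bar>?Z s\<bar>)"
          by (intro borel_integrable_atLeastAtMost' continuous_intros cu contX contW)
        fix s assume "s \<in> {0..u}"
        then have s: "s \<in> {0..T}" using u by auto
        have a: "\<bar>\<alpha> s \<omega>\<bar> \<le> K" using \<alpha> s elim(2) K_control by (auto simp: admissible_iff)
        have "\<bar>rate \<alpha> X s \<omega>\<bar> \<le> \<bar>c s\<bar> + \<bar>p s\<bar> * \<bar>X s \<omega>\<bar> + \<bar>q s\<bar> * \<bar>\<alpha> s \<omega>\<bar>"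
          by (simp add: abs_mult[symmetric])
        also have "\<dots> \<le> K + K * \<bar>X s \<omega>\<bar> + K * K"
          using K_coeff[OF s] a K_pos by (intro add_mono mult_mono) auto
        also have "K * \<bar>X s \<omega>\<bar> \<le> K * (\<sigma> * \<bar>W s \<omega>\<bar> + \<bar>?Z s\<bar>)"
        proof (rule mult_left_mono)
          have "\<bar>X s \<omega>\<bar> \<le> \<bar>\<sigma> * W s \<omega>\<bar> + \<bar>?Z s\<bar>" by linarith
          then show "\<bar>X s \<omega>\<bar> \<le> \<sigma> * \<bar>W s \<omega>\<bar> + \<bar>?Z s\<bar>" using sigma_nonneg by (simp add: abs_mult)
        qed (use K_pos in simp)
        finally show "\<bar>rate \<alpha> X s \<omega>\<bar> \<le> (K + K * K) + K * \<sigma> * \<bar>W s \<omega>\<bar> + K * \<bar>?Z s\<bar>"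
          by (simp add: algebra_simps)
      qed
      also have "\<dots> = u * (K + K * K) + K * \<sigma> * (LBINT s:{0..u}. \<bar>W s \<omega>\<bar>) + K * (LBINT s:{0..u}. \<bar>?Z s\<bar>)"
      proof -
        have i: "set_integrable lborel {0..u} (\<lambda>s. K + K * K)"
          "set_integrable lborel {0..u} (\<lambda>s. K * \<sigma> * \<bar>W s \<omega>\<bar>)"
          "set_integrable lborel {0..u} (\<lambda>s. K * \<bar>?Z s\<bar>)"
          by (intro borel_integrable_atLeastAtMost' continuous_intros cu contX contW)+
        have "(LBINT s:{0..u}. K + K * K) = u * (K + K * K)"
          using u by (simp add: set_lebesgue_integral_def)
        then show ?thesis
          using set_integral_add(2)[OF set_integral_add(1)[OF i(1,2)] i(3)] set_integral_add(2)[OF i(1,2)]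
          by (simp only: set_integral_mult_right)
      qed
      also have "K * \<sigma> * (LBINT s:{0..u}. \<bar>W s \<omega>\<bar>) \<le> K * \<sigma> * ?I"
      proof (rule mult_left_mono)
        have "set_integrable lborel {0..T} (\<lambda>s. \<bar>W s \<omega>\<bar>)"
          by (intro borel_integrable_atLeastAtMost' continuous_intros contW)
        then show "(LBINT s:{0..u}. \<bar>W s \<omega>\<bar>) \<le> ?I"
          using u set_integrable_subset[of lborel "{0..T}" "\<lambda>s. \<bar>W s \<omega>\<bar>" "{0..u}"]
          unfolding set_lebesgue_integral_def set_integrable_def
          by (intro integral_mono) (auto simp: indicator_def)
      qed (use K_pos sigma_nonneg in simp)
      also have "u * (K + K * K) \<le> T * (K + K * K)"
        using u K_pos by (intro mult_right_mono) auto
      finally show "\<bar>?Z u\<bar> \<le> ?A + K * (LBINT s:{0..u}. \<bar>?Z s\<bar>)" by simp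
    qed
    show ?case
    proof
      fix t assume t: "t \<in> {0..T}"
      have "0 \<le> ?I" unfolding set_lebesgue_integral_def
        by (rule Bochner_Integration.integral_nonneg) simp
      then have A0: "0 \<le> ?A" using K_pos sigma_nonneg T_pos by simp
      have "\<bar>X t \<omega>\<bar> \<le> \<bar>?Z t\<bar> + \<bar>\<sigma> * W t \<omega>\<bar>" by linarith
      also have "\<dots> \<le> ?A * exp (K * t) + \<sigma> * \<bar>W t \<omega>\<bar>" using Z[OF t] sigma_nonneg by (simp add: abs_mult)
      also have "\<dots> \<le> ?A * exp (K * T) + \<sigma> * \<bar>W t \<omega>\<bar>"
        using A0 t K_pos by (intro add_right_mono mult_left_mono) auto
      finally show "\<bar>X t \<omega>\<bar> \<le> envelope t \<omega>" by (simp add: envelope_def mult.commute)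
    qed
  qed
qed

section \<open>Moments of the states\<close>

text \<open>A bound that is uniform in time, read off from the even moments of the normal distribution.\<close>

lemma W_even_moment:
  assumes t: "t \<in> {0..T}" and k: "0 < k"
  shows "(\<integral>\<^sup>+\<omega>. ennreal (W t \<omega> ^ (2 * k)) \<partial>P) \<le> ennreal (fact (2 * k) / fact k * T ^ k)"
proof (cases "t = 0")
  case True
  have "(\<integral>\<^sup>+\<omega>. ennreal (W t \<omega> ^ (2 * k)) \<partial>P) = (\<integral>\<^sup>+\<omega>. 0 \<partial>P)"
    by (rule nn_integral_cong) (use True k in \<open>simp add: W_zero\<close>)
  then show ?thesis by simp
next
  case False
  then have t0: "0 < t" using t by auto
  have D: "distributed P lborel (\<lambda>\<omega>. noise G t \<omega> - noise G 0 \<omega>) (normal_density 0 (sqrt (t - 0)))"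
    using brownian t t0 by (auto simp: brownian_motion_def)
  have "(\<integral>\<^sup>+\<omega>. ennreal (W t \<omega> ^ (2 * k)) \<partial>P) = (\<integral>\<^sup>+\<omega>. ennreal ((noise G t \<omega> - noise G 0 \<omega>) ^ (2 * k)) \<partial>P)"
  proof (rule nn_integral_cong_AE)
    show "AE \<omega> in P. ennreal (W t \<omega> ^ (2 * k)) = ennreal ((noise G t \<omega> - noise G 0 \<omega>) ^ (2 * k))"
      using W_AE AE_space by eventually_elim (simp add: W_zero)
  qed
  also have "\<dots> = (\<integral>\<^sup>+x. ennreal (normal_density 0 (sqrt t) x) * ennreal (x ^ (2 * k)) \<partial>lborel)"
    using distributed_nn_integral[OF D, of "\<lambda>x. ennreal (x ^ (2 * k))"] by simp
  also have "\<dots> = (\<integral>\<^sup>+x. ennreal (normal_density 0 (sqrt t) x * (x - 0) ^ (2 * k)) \<partial>lborel)"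
    by (simp add: ennreal_mult')
  also have "\<dots> = ennreal (fact (2 * k) / ((2 / (sqrt t)\<^sup>2) ^ k * fact k))"
  proof -
    have "has_bochner_integral lborel (\<lambda>x. normal_density 0 (sqrt t) x * (x - 0) ^ (2 * k))
      (fact (2 * k) / ((2 / (sqrt t)\<^sup>2) ^ k * fact k))"
      by (rule normal_moment_even) (use t0 in simp)
    then show ?thesis
      by (subst nn_integral_eq_integral) (auto simp: has_bochner_integral_iff power_mult)
  qed
  also have "\<dots> \<le> ennreal (fact (2 * k) / fact k * T ^ k)"
  proof (rule ennreal_leI)
    have "fact (2 * k) / ((2 / (sqrt t)\<^sup>2) ^ k * fact k) = fact (2 * k) / fact k * (t / 2) ^ k"
      using t0 by (simp add: power_divide field_simps)
    also have "\<dots> \<le> fact (2 * k) / fact k * T ^ k"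
      using t t0 by (intro mult_left_mono power_mono) auto
    finally show "fact (2 * k) / ((2 / (sqrt t)\<^sup>2) ^ k * fact k) \<le> fact (2 * k) / fact k * T ^ k" .
  qed
  finally show ?thesis .
qed

lemma W_measurable_Q [measurable]: "(\<lambda>z. W (fst z) (snd z)) \<in> borel_measurable Q"
  using progressive_measurable[OF W_progressive] by (simp add: split_beta')

lemma W_even_integrable:
  assumes k: "0 < k"
  shows "t \<in> {0..T} \<Longrightarrow> integrable P (\<lambda>\<omega>. W t \<omega> ^ (2 * k))"
    and "integrable Q (\<lambda>z. W (fst z) (snd z) ^ (2 * k))"
proof -
  have nn: "norm (x ^ (2 * k)) = x ^ (2 * k)" for x :: real by (simp add: power_mult)
  show "integrable P (\<lambda>\<omega>. W t \<omega> ^ (2 * k))" if "t \<in> {0..T}"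
    unfolding integrable_iff_bounded nn using W_even_moment[OF that k] that
    by (auto intro: le_less_trans)
  have "(\<integral>\<^sup>+z. ennreal (W (fst z) (snd z) ^ (2 * k)) \<partial>Q) = 
      (\<integral>\<^sup>+t. \<integral>\<^sup>+\<omega>. ennreal (W t \<omega> ^ (2 * k)) \<partial>P \<partial>time_measure T)"
    by (subst P.nn_integral_fst[symmetric]) auto
  also have "\<dots> \<le> (\<integral>\<^sup>+t. ennreal (fact (2 * k) / fact k * T ^ k) \<partial>time_measure T)"
    by (rule nn_integral_mono) (use W_even_moment[OF _ k] in \<open>auto simp: space_time_measure\<close>)
  also have "\<dots> < \<infinity>" using time.emeasure_finite[of "space (time_measure T)"]
    by (simp add: ennreal_mult_less_top less_top del: time.emeasure_finite)
  finally show "integrable Q (\<lambda>z. W (fst z) (snd z) ^ (2 * k))"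
    unfolding integrable_iff_bounded nn by auto
qed

abbreviation "IW \<omega> \<equiv> LBINT s:{0..T}. \<bar>W s \<omega>\<bar>"

lemma IW_measurable [measurable]: "IW \<in> borel_measurable P"
proof -
  have "(\<lambda>z. \<bar>W (fst z) (snd z)\<bar>) \<in> borel_measurable Q" by measurable
  then have "(\<lambda>\<omega>. \<integral>s. \<bar>W s \<omega>\<bar> \<partial>time_measure T) \<in> borel_measurable P"
    using measurable_compose[OF measurable_pair_swap' \<open>(\<lambda>z. \<bar>W (fst z) (snd z)\<bar>) \<in> borel_measurable Q\<close>]
    by (intro time.borel_measurable_lebesgue_integral) (simp add: split_beta')
  then show ?thesis by (simp add: integral_time_measure)
qed

text \<open>Jensen's inequality for an even power and the average over time, from the tangent
  line to the power function at the average.\<close>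

lemma IW_even_power_le:
  assumes k: "0 < k" and w: "\<omega> \<in> space P"
  shows "IW \<omega> ^ (2 * k) \<le> T ^ (2 * k - 1) * (LBINT s:{0..T}. W s \<omega> ^ (2 * k))"
proof -
  \<comment> \<open>The average of \<open>\<bar>W\<bar>\<close> over time, where the tangent touches.\<close>
  define a where "a = IW \<omega> / T"
  let ?m = "2 * k"
  have tangent: "x ^ ?m \<ge> a ^ ?m + real ?m * a ^ (?m - 1) * (x - a)" for x :: real
  proof -
    have "x ^ ?m - a ^ ?m \<ge> (real ?m * a ^ (?m - 1)) * (x - a)"
    proof (rule convex_on_imp_above_tangent[where A=UNIV and f="\<lambda>x. x ^ ?m"])
      show "convex_on UNIV (\<lambda>x::real. x ^ ?m)" using convex_power_even[of ?m] by simp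
      show "((\<lambda>x. x ^ ?m) has_real_derivative real ?m * a ^ (?m - 1)) (at a within UNIV)"
        by (auto intro!: derivative_eq_intros)
    qed auto
    then show ?thesis by linarith
  qed
  have contW: "continuous_on {0..T} (\<lambda>t. W t \<omega>)" by (rule W_cont[OF w])
  have "(LBINT s:{0..T}. a ^ ?m + real ?m * a ^ (?m - 1) * (\<bar>W s \<omega>\<bar> - a)) \<le> (LBINT s:{0..T}. W s \<omega> ^ ?m)"
  proof (rule set_integral_mono)
    show "a ^ ?m + real ?m * a ^ (?m - 1) * (\<bar>W s \<omega>\<bar> - a) \<le> W s \<omega> ^ ?m" for s
      using tangent[of "\<bar>W s \<omega>\<bar>"] by (simp only: power_even_abs dvd_triv_left)
  qed (intro borel_integrable_atLeastAtMost' continuous_intros contW)+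
  also have "(LBINT s:{0..T}. a ^ ?m + real ?m * a ^ (?m - 1) * (\<bar>W s \<omega>\<bar> - a)) = T * a ^ ?m"
  proof -
    have i: "set_integrable lborel {0..T} (\<lambda>s. a ^ ?m - real ?m * a ^ (?m - 1) * a)"
      "set_integrable lborel {0..T} (\<lambda>s. real ?m * a ^ (?m - 1) * \<bar>W s \<omega>\<bar>)"
      by (intro borel_integrable_atLeastAtMost' continuous_intros contW)+
    have c: "(LBINT s:{0..T}. x) = T * x" for x :: real
      using T_pos by (simp add: set_lebesgue_integral_def)
    have "(LBINT s:{0..T}. a ^ ?m + real ?m * a ^ (?m - 1) * (\<bar>W s \<omega>\<bar> - a)) = 
       (LBINT s:{0..T}. (a ^ ?m - real ?m * a ^ (?m - 1) * a) + real ?m * a ^ (?m - 1) * \<bar>W s \<omega>\<bar>)"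
      by (simp only: right_diff_distrib add_diff_eq diff_add_eq)
    also have "\<dots> = T * (a ^ ?m - real ?m * a ^ (?m - 1) * a) + real ?m * a ^ (?m - 1) * IW \<omega>"
      by (simp only: set_integral_add(2)[OF i] set_integral_mult_right c)
    also have "IW \<omega> = T * a" using T_pos by (simp add: a_def)
    finally show ?thesis by (simp add: algebra_simps)
  qed
  finally have le: "T * a ^ ?m \<le> (LBINT s:{0..T}. W s \<omega> ^ ?m)" .
  have "IW \<omega> ^ ?m = T ^ ?m * a ^ ?m" using T_pos by (simp add: a_def power_divide)
  also have "T ^ ?m = T ^ (?m - 1) * T" using k by (simp add: power_eq_if)
  also have "T ^ (?m - 1) * T * a ^ ?m \<le> T ^ (?m - 1) * (LBINT s:{0..T}. W s \<omega> ^ ?m)"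
    using le T_pos by (simp add: mult.assoc)
  finally show ?thesis .
qed

lemma integrable_Q_of_P:
  fixes h :: "'a \<Rightarrow> real"
  assumes "integrable P h"
  shows "integrable Q (\<lambda>z. h (snd z))"
  by (rule Q.Fubini_integrable) (use assms in \<open>auto intro!: measurable_compose[OF measurable_snd]\<close>)

text \<open>The order \<open>r\<close> need not be an integer, so it is dominated by an even integer, for which the moments of
  the noise are known.  For the initial state the moment of order \<open>r\<close> is a hypothesis.\<close>

lemma envelope_integrable:
  shows "(\<lambda>z. envelope (fst z) (snd z)) \<in> borel_measurable Q"
    and "integrable Q (\<lambda>z. envelope (fst z) (snd z) powr r)"
    and "t \<in> {0..T} \<Longrightarrow> integrable P (\<lambda>\<omega>. envelope t \<omega> powr r)"
proof -
  have r0: "0 < r" using r_gt_1 by simp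
  obtain k :: nat where k: "r \<le> real k" using real_arch_simple by blast
  have k0: "0 < k" using k r0 by (cases k) auto
  have kr: "r \<le> 2 * real k" using k by simp
  have "integrable P (\<lambda>\<omega>. IW \<omega> ^ (2 * k))"
  proof (rule Bochner_Integration.integrable_bound)
    have "integrable P (\<lambda>\<omega>. \<integral>s. W s \<omega> ^ (2 * k) \<partial>time_measure T)"
      using Q.integrable_snd[of "\<lambda>s \<omega>. W s \<omega> ^ (2 * k)"] W_even_integrable(2)[OF k0]
      by (simp add: split_beta')
    then show "integrable P (\<lambda>\<omega>. T ^ (2 * k - 1) * (LBINT s:{0..T}. W s \<omega> ^ (2 * k)))"
      by (simp add: integral_time_measure)
    show "AE \<omega> in P. norm (IW \<omega> ^ (2 * k)) \<le> norm (T ^ (2 * k - 1) * (LBINT s:{0..T}. W s \<omega> ^ (2 * k)))"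
    proof (rule AE_I2)
      fix \<omega> assume "\<omega> \<in> space P"
      from IW_even_power_le[OF k0 this]
      show "norm (IW \<omega> ^ (2 * k)) \<le> norm (T ^ (2 * k - 1) * (LBINT s:{0..T}. W s \<omega> ^ (2 * k)))"
        by (simp add: power_mult)
    qed
  qed measurable
  then have IW: "integrable P (\<lambda>\<omega>. \<bar>IW \<omega>\<bar> powr r)"
    by (rule P.integrable_powr_of_even_power[OF IW_measurable _ r0 kr])
  have \<xi>: "integrable P (\<lambda>\<omega>. \<bar>\<bar>\<xi> \<omega>\<bar>\<bar> powr r)" using init_moment by simp
  have WP: "integrable P (\<lambda>\<omega>. \<bar>W t \<omega>\<bar> powr r)" if "t \<in> {0..T}" for t
    by (rule P.integrable_powr_of_even_power[OF W_measurable[OF that] W_even_integrable(1)[OF k0 that] r0 kr])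
  have WQ: "integrable Q (\<lambda>z. \<bar>W (fst z) (snd z)\<bar> powr r)"
    by (rule Qfin.integrable_powr_of_even_power[OF W_measurable_Q W_even_integrable(2)[OF k0] r0 kr])
  define h where "h \<omega> = exp (K * T) * (\<bar>\<xi> \<omega>\<bar> + T * (K + K * K) + K * \<sigma> * IW \<omega>)" for \<omega>
  have hm [measurable]: "h \<in> borel_measurable P" unfolding h_def by measurable
  have h: "integrable P (\<lambda>\<omega>. \<bar>h \<omega>\<bar> powr r)"
    unfolding h_def
    by (intro integrable_powr_mult integrable_powr_add r0 \<xi> IW) auto
  have envelope_eq: "envelope t \<omega> = h \<omega> + \<sigma> * \<bar>W t \<omega>\<bar>" for t \<omega> by (simp add: envelope_def h_def)
  show "(\<lambda>z. envelope (fst z) (snd z)) \<in> borel_measurable Q"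
    unfolding envelope_eq by measurable
  have "integrable Q (\<lambda>z. \<bar>h (snd z) + \<sigma> * \<bar>W (fst z) (snd z)\<bar>\<bar> powr r)"
    by (intro integrable_powr_mult integrable_powr_add r0 integrable_Q_of_P[OF h]) (use WQ in auto)
  then show "integrable Q (\<lambda>z. envelope (fst z) (snd z) powr r)"
    unfolding envelope_eq[symmetric] using envelope_nonneg by simp
  show "integrable P (\<lambda>\<omega>. envelope t \<omega> powr r)" if "t \<in> {0..T}"
  proof -
    note [measurable] = W_measurable[OF that]
    have "integrable P (\<lambda>\<omega>. \<bar>h \<omega> + \<sigma> * \<bar>W t \<omega>\<bar>\<bar> powr r)"
      by (intro integrable_powr_mult integrable_powr_add r0 h) (use WP[OF that] in auto)
    then show ?thesis unfolding envelope_eq[symmetric] using envelope_nonneg by simp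
  qed
qed

section \<open>Costs as finite integrals\<close>

text \<open>The exceptional scenarios are covered by a null set, whose product with the time interval is again a
  null set.\<close>

lemma AE_Q_of_P:
  assumes "AE \<omega> in P. \<forall>t\<in>{0..T}. R t \<omega>"
  shows "AE z in Q. R (fst z) (snd z)"
proof -
  obtain N where N: "{\<omega>\<in>space P. \<not> (\<forall>t\<in>{0..T}. R t \<omega>)} \<subseteq> N" "N \<in> null_sets P"
    using assms unfolding eventually_ae_filter by auto
  have "space (time_measure T) \<times> N \<in> null_sets Q"
    using N(2) by (auto simp: null_sets_def P.emeasure_pair_measure_Times)
  then show ?thesis
    by (rule AE_I') (use N(1) in \<open>fastforce simp: space_Q space_time_measure\<close>)
qed

lemma AE_Q_of_time:
  assumes "AE t in time_measure T. R t"
  shows "AE z in Q. R (fst z)"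
proof -
  obtain N where N: "{t\<in>space (time_measure T). \<not> R t} \<subseteq> N" "N \<in> null_sets (time_measure T)"
    using assms unfolding eventually_ae_filter by auto
  have "N \<times> space P \<in> null_sets Q"
    using N(2) by (auto simp: null_sets_def P.emeasure_pair_measure_Times)
  then show ?thesis
    by (rule AE_I') (use N(1) in \<open>auto simp: space_Q space_time_measure\<close>)
qed

text \<open>Flows along which the growth bound on the costs applies wherever the costs see the flow.  The time
  \<open>0\<close> is left out: no moment bound by \<open>M\<close> is imposed on the initial law of a lattice flow, and \<open>dt\<close> does not
  charge it.\<close>

definition tight_flow :: "(real \<Rightarrow> real measure) \<Rightarrow> bool" where
  "tight_flow \<mu> \<longleftrightarrow> \<mu> \<in> flows T \<and> (AE t in time_measure T. \<mu> t \<in> st_interval \<psi> M) \<and> \<mu> T \<in> st_interval \<psi> M"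

definition running :: "(real \<Rightarrow> 'a \<Rightarrow> real) \<Rightarrow> (real \<Rightarrow> real measure) \<Rightarrow> real \<times> 'a \<Rightarrow> real" where
  "running X \<mu> z = cost_f G (fst z) (snd z) (X (fst z) (snd z)) (\<mu> (fst z))"

definition effort :: "(real \<Rightarrow> 'a \<Rightarrow> real) \<Rightarrow> (real \<Rightarrow> 'a \<Rightarrow> real) \<Rightarrow> real \<times> 'a \<Rightarrow> real" where
  "effort X \<alpha> z = cost_l G (fst z) (snd z) (X (fst z) (snd z)) (\<alpha> (fst z) (snd z))"

definition terminal :: "(real \<Rightarrow> 'a \<Rightarrow> real) \<Rightarrow> (real \<Rightarrow> real measure) \<Rightarrow> 'a \<Rightarrow> real" where
  "terminal X \<mu> \<omega> = cost_g G \<omega> (X T \<omega>) (\<mu> T)"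

text \<open>The cost functional as a real number, with the flow-dependent running cost, the control cost
  and the terminal cost kept apart because they behave differently under limits and comparison.\<close>

definition J :: "(real \<Rightarrow> 'a \<Rightarrow> real) \<Rightarrow> (real \<Rightarrow> 'a \<Rightarrow> real) \<Rightarrow> (real \<Rightarrow> real measure) \<Rightarrow> real" where
  "J X \<alpha> \<mu> = (\<integral>z. running X \<mu> z \<partial>Q) + (\<integral>z. effort X \<alpha> z \<partial>Q) + (\<integral>\<omega>. terminal X \<mu> \<omega> \<partial>P)"

lemma strong_solution_progressive:
  "strong_solution G \<alpha> X \<Longrightarrow> progressive T F X"
  by (rule continuous_adapted_progressive) (auto simp: strong_solution_def)

lemma strong_solution_measurable:
  assumes "strong_solution G \<alpha> X"
  shows "(\<lambda>z. X (fst z) (snd z)) \<in> borel_measurable Q"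
    and "t \<in> {0..T} \<Longrightarrow> X t \<in> borel_measurable P"
  using progressive_measurable[OF strong_solution_progressive[OF assms]]
    F_measurable_P[of "X t" t] assms
  by (auto simp: split_beta' strong_solution_def)

lemma fst_measurable_Q: "fst \<in> Q \<rightarrow>\<^sub>M restrict_space borel {0..T}"
proof -
  have "fst \<in> Q \<rightarrow>\<^sub>M time_measure T" by (rule measurable_fst)
  also have "Q \<rightarrow>\<^sub>M time_measure T = Q \<rightarrow>\<^sub>M restrict_space borel {0..T}"
    by (intro measurable_cong_sets refl sets_time_measure)
  finally show ?thesis .
qed

lemma running_measurable:
  assumes X: "strong_solution G \<alpha> X" and \<mu>: "\<mu> \<in> flows T"
  shows "running X \<mu> \<in> borel_measurable Q"
proof -
  have "(\<lambda>(t, \<omega>, x, \<mu>). cost_f G t \<omega> x \<mu>) \<in> borel_measurable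
        (restrict_space borel {0..T} \<Otimes>\<^sub>M P \<Otimes>\<^sub>M borel \<Otimes>\<^sub>M prob_algebra borel)"
    using game by (simp add: mfg_game_def Let_def)
  moreover have "(\<lambda>z. (fst z, snd z, X (fst z) (snd z), \<mu> (fst z))) \<in> Q \<rightarrow>\<^sub>M
      restrict_space borel {0..T} \<Otimes>\<^sub>M P \<Otimes>\<^sub>M borel \<Otimes>\<^sub>M prob_algebra borel"
    by (intro measurable_Pair fst_measurable_Q measurable_snd strong_solution_measurable[OF X]
        measurable_compose[OF fst_measurable_Q \<mu>[unfolded flows_def]])
  ultimately show ?thesis
    unfolding running_def[abs_def] by (auto dest: measurable_compose[rotated])
qed

lemma effort_measurable:
  assumes X: "strong_solution G \<alpha>' X" and \<alpha>: "\<alpha> \<in> admissible G"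
  shows "effort X \<alpha> \<in> borel_measurable Q"
proof -
  have "(\<lambda>(t, \<omega>, x, a). cost_l G t \<omega> x a) \<in> borel_measurable
        (restrict_space borel {0..T} \<Otimes>\<^sub>M P \<Otimes>\<^sub>M borel \<Otimes>\<^sub>M restrict_space borel U)"
    using game by (simp add: mfg_game_def Let_def)
  moreover have "(\<lambda>z. \<alpha> (fst z) (snd z)) \<in> Q \<rightarrow>\<^sub>M restrict_space borel U"
    using \<alpha> progressive_measurable[of \<alpha>]
    by (intro measurable_restrict_space2) (auto simp: admissible_iff space_Q split_beta')
  then have "(\<lambda>z. (fst z, snd z, X (fst z) (snd z), \<alpha> (fst z) (snd z))) \<in> Q \<rightarrow>\<^sub>M
      restrict_space borel {0..T} \<Otimes>\<^sub>M P \<Otimes>\<^sub>M borel \<Otimes>\<^sub>M restrict_space borel U"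
    by (intro measurable_Pair fst_measurable_Q measurable_snd strong_solution_measurable[OF X])
  ultimately show ?thesis
    unfolding effort_def[abs_def] by (auto dest: measurable_compose[rotated])
qed

lemma terminal_measurable:
  assumes X: "strong_solution G \<alpha> X" and \<mu>: "\<mu> T \<in> prob_measures"
  shows "terminal X \<mu> \<in> borel_measurable P"
proof -
  have "(\<lambda>(\<omega>, x, \<mu>). cost_g G \<omega> x \<mu>) \<in> borel_measurable (P \<Otimes>\<^sub>M borel \<Otimes>\<^sub>M prob_algebra borel)"
    using game by (simp add: mfg_game_def Let_def)
  moreover have "(\<lambda>\<omega>. (\<omega>, X T \<omega>, \<mu> T)) \<in> P \<rightarrow>\<^sub>M P \<Otimes>\<^sub>M borel \<Otimes>\<^sub>M prob_algebra borel"
    by (intro measurable_Pair measurable_ident_sets refl strong_solution_measurable[OF X] measurable_const \<mu>)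
       (use T_pos in auto)
  ultimately show ?thesis
    unfolding terminal_def[abs_def] by (auto dest: measurable_compose[rotated])
qed

definition cost_bound :: "real \<Rightarrow> 'a \<Rightarrow> real" where "cost_bound t \<omega> = C * (1 + envelope t \<omega> powr r)"

lemma cost_bound_integrable: "integrable Q (\<lambda>z. cost_bound (fst z) (snd z))" 
    "t \<in> {0..T} \<Longrightarrow> integrable P (cost_bound t)"
  unfolding cost_bound_def using envelope_integrable by simp_all

lemma growth_le_cost_bound:
  assumes "\<bar>x\<bar> \<le> envelope t \<omega>"
  shows "C * (1 + \<bar>x\<bar> powr r) \<le> cost_bound t \<omega>"
  unfolding cost_bound_def using assms C_pos r_gt_1 by (intro mult_left_mono add_left_mono powr_mono2) auto

lemma controls_nonempty: "\<alpha> \<in> admissible G \<Longrightarrow> \<exists>a. a \<in> U"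
  using P.not_empty T_pos by (force simp: admissible_iff)

lemma running_bound:
  assumes \<alpha>: "\<alpha> \<in> admissible G" and X: "strong_solution G \<alpha> X" and \<mu>: "tight_flow \<mu>"
  shows "AE z in Q. \<bar>running X \<mu> z\<bar> \<le> cost_bound (fst z) (snd z)"
    and "AE \<omega> in P. \<bar>terminal X \<mu> \<omega>\<bar> \<le> cost_bound T \<omega>"
    and "AE z in Q. \<bar>effort X \<alpha> z\<bar> \<le> cost_bound (fst z) (snd z)"
proof -
  obtain a where a: "a \<in> U" using controls_nonempty[OF \<alpha>] by blast
  have b: "AE \<omega> in P. \<forall>t\<in>{0..T}. \<bar>X t \<omega>\<bar> \<le> envelope t \<omega>" by (rule strong_solution_bound[OF \<alpha> X])
  have muT: "\<mu> T \<in> st_interval \<psi> M" and mut: "AE z in Q. \<mu> (fst z) \<in> st_interval \<psi> M"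
    using \<mu> AE_Q_of_time unfolding tight_flow_def by auto
  show "AE z in Q. \<bar>running X \<mu> z\<bar> \<le> cost_bound (fst z) (snd z)"
    using AE_Q_of_P[OF b] mut AE_space
  proof eventually_elim
    case (elim z)
    then show ?case
      using growth[of "snd z" "fst z" a "\<mu> (fst z)" "X (fst z) (snd z)"] a 
        growth_le_cost_bound[OF elim(1)] by (auto simp: running_def space_Q)
  qed
  show "AE z in Q. \<bar>effort X \<alpha> z\<bar> \<le> cost_bound (fst z) (snd z)"
    using AE_Q_of_P[OF b] AE_space
  proof eventually_elim
    case (elim z)
    then have "\<alpha> (fst z) (snd z) \<in> U" using \<alpha> by (auto simp: space_Q admissible_iff)
    then show ?case
      using growth[of "snd z" "fst z" _ "\<mu> T" "X (fst z) (snd z)"] muT elim(2)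
        growth_le_cost_bound[OF elim(1)] by (fastforce simp: effort_def space_Q)
  qed
  show "AE \<omega> in P. \<bar>terminal X \<mu> \<omega>\<bar> \<le> cost_bound T \<omega>"
    using b AE_space
  proof eventually_elim
    case (elim \<omega>)
    have "\<bar>X T \<omega>\<bar> \<le> envelope T \<omega>" using elim T_pos by auto
    from growth_le_cost_bound[OF this] show ?case
      using growth[of \<omega> T a "\<mu> T" "X T \<omega>"] muT elim(2) a T_pos by (auto simp: terminal_def)
  qed
qed

lemma cost_integrable:
  assumes \<alpha>: "\<alpha> \<in> admissible G" and X: "strong_solution G \<alpha> X" and \<mu>: "tight_flow \<mu>"
  shows "integrable Q (running X \<mu>)" and "integrable Q (effort X \<alpha>)" and "integrable P (terminal X \<mu>)"
proof -
  have m: "\<mu> \<in> flows T" "\<mu> T \<in> prob_measures" using \<mu> by (auto simp: tight_flow_def st_interval_def)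
  note b = running_bound[OF assms]
  have T: "T \<in> {0..T}" using T_pos by auto
  show "integrable Q (running X \<mu>)"
    by (rule Bochner_Integration.integrable_bound[OF cost_bound_integrable(1) running_measurable[OF X m(1)]])
       (use b(1) in \<open>eventually_elim, auto\<close>)
  show "integrable Q (effort X \<alpha>)"
    by (rule Bochner_Integration.integrable_bound[OF cost_bound_integrable(1) effort_measurable[OF X \<alpha>]])
       (use b(3) in \<open>eventually_elim, auto\<close>)
  show "integrable P (terminal X \<mu>)"
    by (rule Bochner_Integration.integrable_bound[OF cost_bound_integrable(2)[OF T] terminal_measurable[of \<alpha> X \<mu>, OF X m(2)]])
       (use b(2) in \<open>eventually_elim, auto\<close>)
qed

lemma J_cong:
  assumes \<alpha>: "\<alpha> \<in> admissible G" and X: "strong_solution G \<alpha> X" and Y: "strong_solution G \<alpha> Y" 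
    and \<mu>: "tight_flow \<mu>"
  shows "J X \<alpha> \<mu> = J Y \<alpha> \<mu>"
proof -
  have eq: "AE \<omega> in P. \<forall>t\<in>{0..T}. X t \<omega> = Y t \<omega>" by (rule strong_solution_unique[OF \<alpha> X Y])
  note X' = cost_integrable[OF \<alpha> X \<mu>, THEN borel_measurable_integrable]
    and Y' = cost_integrable[OF \<alpha> Y \<mu>, THEN borel_measurable_integrable]
  have "AE z in Q. running X \<mu> z = running Y \<mu> z"
    using AE_Q_of_P[OF eq] by eventually_elim (simp add: running_def)
  moreover have "AE z in Q. effort X \<alpha> z = effort Y \<alpha> z"
    using AE_Q_of_P[OF eq] by eventually_elim (simp add: effort_def)
  moreover have "AE \<omega> in P. terminal X \<mu> \<omega> = terminal Y \<mu> \<omega>"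
    using eq by eventually_elim (use T_pos in \<open>auto simp: terminal_def\<close>)
  ultimately have "(\<integral>z. running X \<mu> z \<partial>Q) = (\<integral>z. running Y \<mu> z \<partial>Q)"
    "(\<integral>z. effort X \<alpha> z \<partial>Q) = (\<integral>z. effort Y \<alpha> z \<partial>Q)"
    "(\<integral>\<omega>. terminal X \<mu> \<omega> \<partial>P) = (\<integral>\<omega>. terminal Y \<mu> \<omega> \<partial>P)"
    using integral_cong_AE[OF X'(1) Y'(1)] integral_cong_AE[OF X'(2) Y'(2)] integral_cong_AE[OF X'(3) Y'(3)]
    by blast+
  then show ?thesis by (simp add: J_def)
qed

text \<open>By the growth bound and the integrability of the envelope all costs are integrable, so
  the extended integrals of the cost functional are ordinary ones and Fubini's theorem applies.\<close>

lemma cost_eq_J: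
  assumes \<alpha>: "\<alpha> \<in> admissible G" and X: "strong_solution G \<alpha> X" and \<mu>: "tight_flow \<mu>"
  shows "cost G \<alpha> \<mu> = ereal (J X \<alpha> \<mu>)"
proof -
  let ?X = "state G \<alpha>"
  have S: "strong_solution G \<alpha> ?X" by (rule strong_solution_state[OF \<alpha>])
  note i = cost_integrable[OF \<alpha> S \<mu>]
  have int: "integrable Q (\<lambda>(t, \<omega>). running ?X \<mu> (t, \<omega>) + effort ?X \<alpha> (t, \<omega>))"
    using i by (simp add: split_beta')
  have inner: "AE \<omega> in P. ext_integral (time_measure T)
      (\<lambda>t. ereal (cost_f G t \<omega> (?X t \<omega>) (\<mu> t) + cost_l G t \<omega> (?X t \<omega>) (\<alpha> t \<omega>))) 
      + ereal (cost_g G \<omega> (?X T \<omega>) (\<mu> T)) =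
    ereal ((\<integral>t. running ?X \<mu> (t, \<omega>) + effort ?X \<alpha> (t, \<omega>) \<partial>time_measure T) + terminal ?X \<mu> \<omega>)"
    using Q.AE_integrable_snd[OF int]
    by eventually_elim (auto simp: running_def effort_def terminal_def ext_integral_ereal)
  have "cost G \<alpha> \<mu> = ext_integral P (\<lambda>\<omega>. ereal 
    ((\<integral>t. running ?X \<mu> (t, \<omega>) + effort ?X \<alpha> (t, \<omega>) \<partial>time_measure T) + terminal ?X \<mu> \<omega>))"
    unfolding cost_def Let_def by (rule ext_integral_cong_AE[OF inner])
  also have "\<dots> = ereal (\<integral>\<omega>. (\<integral>t. running ?X \<mu> (t, \<omega>) + effort ?X \<alpha> (t, \<omega>) \<partial>time_measure T) + terminal ?X \<mu> \<omega> \<partial>P)"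
    by (rule ext_integral_ereal) (intro Bochner_Integration.integrable_add Q.integrable_snd int i)
  also have "(\<integral>\<omega>. (\<integral>t. running ?X \<mu> (t, \<omega>) + effort ?X \<alpha> (t, \<omega>) \<partial>time_measure T) + terminal ?X \<mu> \<omega> \<partial>P) = J ?X \<alpha> \<mu>"
  proof -
    have "(\<integral>\<omega>. \<integral>t. running ?X \<mu> (t, \<omega>) + effort ?X \<alpha> (t, \<omega>) \<partial>time_measure T \<partial>P) =
        (\<integral>z. running ?X \<mu> z + effort ?X \<alpha> z \<partial>Q)"
      using Q.integral_snd[OF int] by (simp add: split_beta')
    then show ?thesis
      unfolding J_def using Q.integrable_snd[OF int] i by simp
  qed
  also have "J ?X \<alpha> \<mu> = J X \<alpha> \<mu>" by (rule J_cong[OF \<alpha> S X \<mu>])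
  finally show ?thesis .
qed

text \<open>A competitor may be paired with any of its states, since all of them have the same cost.\<close>

lemma optimal_pair_iff:
  assumes "tight_flow \<mu>"
  shows "optimal_pair G \<mu> X \<alpha> \<longleftrightarrow> \<alpha> \<in> admissible G \<and> strong_solution G \<alpha> X \<and>
    (\<forall>\<beta> Y. \<beta> \<in> admissible G \<longrightarrow> strong_solution G \<beta> Y \<longrightarrow> J X \<alpha> \<mu> \<le> J Y \<beta> \<mu>)"
  unfolding optimal_pair_def using cost_eq_J[OF _ _ assms] strong_solution_state
  by (metis MInfty_neq_ereal(1) ereal_infty_less(2) ereal_less_eq(3))

lemma optimal_pair_unique:
  assumes "\<mu> \<in> flows T" "optimal_pair G \<mu> X \<alpha>" "optimal_pair G \<mu> Y \<beta>"
  shows "AE \<omega> in P. \<forall>t\<in>{0..T}. X t \<omega> = Y t \<omega>"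
proof -
  obtain Z where "\<And>Y \<beta>. optimal_pair G \<mu> Y \<beta> \<Longrightarrow> AE \<omega> in P. \<forall>t\<in>{0..T}. Y t \<omega> = Z t \<omega>"
    using unique_optimum[OF assms(1)] unfolding unique_optimal_pair_def by blast
  from this[OF assms(2)] this[OF assms(3)] show ?thesis by eventually_elim auto
qed

section \<open>Monotonicity of the optimal state\<close>

text \<open>The difference of two states of the same noise is an integral.  Its positive part has to be added to
  \<open>Y\<close> to obtain the maximum and subtracted from \<open>X\<close> to obtain the minimum, and this
  exchanges the two drifts exactly while \<open>Y\<close> is below \<open>X\<close>.\<close>

lemma max_min_strong_solution:
  assumes \<alpha>: "\<alpha> \<in> admissible G" and X: "strong_solution G \<alpha> X"
    and \<beta>: "\<beta> \<in> admissible G" and Y: "strong_solution G \<beta> Y"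
  defines "hi \<equiv> \<lambda>t \<omega>. if Y t \<omega> < X t \<omega> then \<alpha> t \<omega> else \<beta> t \<omega>"
    and "lo \<equiv> \<lambda>t \<omega>. if Y t \<omega> < X t \<omega> then \<beta> t \<omega> else \<alpha> t \<omega>"
  shows "hi \<in> admissible G" and "lo \<in> admissible G"
    and "strong_solution G hi (\<lambda>t \<omega>. max (X t \<omega>) (Y t \<omega>))"
    and "strong_solution G lo (\<lambda>t \<omega>. min (X t \<omega>) (Y t \<omega>))"
proof -
  have prog: "progressive T F (\<lambda>t \<omega>. if Y t \<omega> < X t \<omega> then \<gamma> t \<omega> else \<delta> t \<omega>)"
    if "\<gamma> \<in> admissible G" "\<delta> \<in> admissible G" for \<gamma> \<delta>
    unfolding progressive_def split_beta'
  proof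
    fix t assume t: "t \<in> {0..T}"
    let ?N = "restrict_space borel {0..t} \<Otimes>\<^sub>M F t"
    have [measurable]: "(\<lambda>z. X (fst z) (snd z)) \<in> borel_measurable ?N" "(\<lambda>z. Y (fst z) (snd z)) \<in> borel_measurable ?N"
      "(\<lambda>z. \<gamma> (fst z) (snd z)) \<in> borel_measurable ?N" "(\<lambda>z. \<delta> (fst z) (snd z)) \<in> borel_measurable ?N"
      using strong_solution_progressive[OF X] strong_solution_progressive[OF Y] that t
      by (auto simp: progressive_def admissible_iff split_beta')
    show "(\<lambda>z. if Y (fst z) (snd z) < X (fst z) (snd z) then \<gamma> (fst z) (snd z) else \<delta> (fst z) (snd z)) \<in> borel_measurable ?N"
      by measurable
  qed
  show hi: "hi \<in> admissible G" and lo: "lo \<in> admissible G"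
    using prog[OF \<alpha> \<beta>] prog[OF \<beta> \<alpha>] \<alpha> \<beta> by (auto simp: admissible_iff hi_def lo_def)
  note X' = X[unfolded strong_solution_iff[OF \<alpha>]] and Y' = Y[unfolded strong_solution_iff[OF \<beta>]]
  have both: "AE \<omega> in P. \<forall>t\<in>{0..T}.
      max (X t \<omega>) (Y t \<omega>) = \<xi> \<omega> + (LBINT s:{0..t}. c s + p s * max (X s \<omega>) (Y s \<omega>) + q s * hi s \<omega>) + \<sigma> * W t \<omega> \<and>
      min (X t \<omega>) (Y t \<omega>) = \<xi> \<omega> + (LBINT s:{0..t}. c s + p s * min (X s \<omega>) (Y s \<omega>) + q s * lo s \<omega>) + \<sigma> * W t \<omega>"
    using X'[THEN conjunct2, THEN conjunct2] Y'[THEN conjunct2, THEN conjunct2] AE_space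
  proof eventually_elim
    case (elim \<omega>)
    let ?x = "\<lambda>s. rate \<alpha> X s \<omega>" and ?y = "\<lambda>s. rate \<beta> Y s \<omega>"
    let ?F = "\<lambda>s. X s \<omega> - Y s \<omega>"
    have cont: "continuous_on {0..T} (\<lambda>t. X t \<omega>)" "continuous_on {0..T} (\<lambda>t. Y t \<omega>)"
      using X' Y' elim by auto
    have ix: "set_integrable lborel {0..t} ?x" and iy: "set_integrable lborel {0..t} ?y" if "t \<in> {0..T}" for t
      using affine_path_integrable[OF \<alpha> elim(3) cont(1) that] affine_path_integrable[OF \<beta> elim(3) cont(2) that] by auto
    have Tin: "T \<in> {0..T}" using T_pos by auto
    have ih: "set_integrable lborel {0..T} (\<lambda>s. ?x s - ?y s)"
      by (rule set_integral_diff(1)[OF ix[OF Tin] iy[OF Tin]])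
    have cF: "continuous_on {0..T} ?F" by (intro continuous_intros cont)
    have F: "?F t = (LBINT s:{0..t}. ?x s - ?y s)" if "t \<in> {0..T}" for t
      using elim(1,2) that set_integral_diff(2)[OF ix[OF that] iy[OF that]] by simp
    show ?case
    proof
      fix t assume t: "t \<in> {0..T}"
      let ?h = "\<lambda>s. if ?F s > 0 then ?x s - ?y s else 0"
      have pp: "set_integrable lborel {0..t} ?h" "(LBINT s:{0..t}. ?h s) = max 0 (?F t)"
        by (rule positive_part_integral[OF ih cF F t]; assumption)+
      have "(LBINT s:{0..t}. c s + p s * max (X s \<omega>) (Y s \<omega>) + q s * hi s \<omega>) = (LBINT s:{0..t}. ?y s + ?h s)"
        by (rule set_lebesgue_integral_cong) (auto simp: hi_def max_def)
      also have "\<dots> = (LBINT s:{0..t}. ?y s) + max 0 (?F t)"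
        using set_integral_add(2)[OF iy[OF t] pp(1)] pp(2) by argo
      finally have 1: "(LBINT s:{0..t}. c s + p s * max (X s \<omega>) (Y s \<omega>) + q s * hi s \<omega>) = 
        (LBINT s:{0..t}. ?y s) + max 0 (?F t)" .
      have "(LBINT s:{0..t}. c s + p s * min (X s \<omega>) (Y s \<omega>) + q s * lo s \<omega>) = (LBINT s:{0..t}. ?x s - ?h s)"
        by (rule set_lebesgue_integral_cong) (auto simp: lo_def min_def)
      also have "\<dots> = (LBINT s:{0..t}. ?x s) - max 0 (?F t)"
        using set_integral_diff(2)[OF ix[OF t] pp(1)] pp(2) by argo
      finally have 2: "(LBINT s:{0..t}. c s + p s * min (X s \<omega>) (Y s \<omega>) + q s * lo s \<omega>) =
        (LBINT s:{0..t}. ?x s) - max 0 (?F t)" .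
      have "X t \<omega> = \<xi> \<omega> + (LBINT s:{0..t}. ?x s) + \<sigma> * W t \<omega>" "Y t \<omega> = \<xi> \<omega> + (LBINT s:{0..t}. ?y s) + \<sigma> * W t \<omega>"
        using elim(1,2) t by blast+
      then show "max (X t \<omega>) (Y t \<omega>) = \<xi> \<omega> + (LBINT s:{0..t}. c s + p s * max (X s \<omega>) (Y s \<omega>) + q s * hi s \<omega>) + \<sigma> * W t \<omega> \<and>
      min (X t \<omega>) (Y t \<omega>) = \<xi> \<omega> + (LBINT s:{0..t}. c s + p s * min (X s \<omega>) (Y s \<omega>) + q s * lo s \<omega>) + \<sigma> * W t \<omega>"
        unfolding 1 2 by (simp add: max_def min_def)
    qed
  qed
  show "strong_solution G hi (\<lambda>t \<omega>. max (X t \<omega>) (Y t \<omega>))"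
    unfolding strong_solution_iff[OF hi]
  proof (intro conjI ballI)
    show "(\<lambda>\<omega>. max (X t \<omega>) (Y t \<omega>)) \<in> borel_measurable (F t)" if "t \<in> {0..T}" for t
      using X' Y' that by (intro borel_measurable_max) auto
    show "continuous_on {0..T} (\<lambda>t. max (X t \<omega>) (Y t \<omega>))" if "\<omega> \<in> space P" for \<omega>
      using X' Y' that by (intro continuous_on_max) auto
  qed (use both in \<open>eventually_elim, blast\<close>)
  show "strong_solution G lo (\<lambda>t \<omega>. min (X t \<omega>) (Y t \<omega>))"
    unfolding strong_solution_iff[OF lo]
  proof (intro conjI ballI)
    show "(\<lambda>\<omega>. min (X t \<omega>) (Y t \<omega>)) \<in> borel_measurable (F t)" if "t \<in> {0..T}" for t
      using X' Y' that by (intro borel_measurable_min) auto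
    show "continuous_on {0..T} (\<lambda>t. min (X t \<omega>) (Y t \<omega>))" if "\<omega> \<in> space P" for \<omega>
      using X' Y' that by (intro continuous_on_min) auto
  qed (use both in \<open>eventually_elim, blast\<close>)
qed

lemma submodular_f: "AE z in Q. submodular (cost_f G (fst z) (snd z))"
  using submod by eventually_elim auto

text \<open>The terminal cost does not depend on time, so a single good time suffices.\<close>

lemma submodular_g: "AE \<omega> in P. submodular (cost_g G \<omega>)"
proof -
  have "AE t in time_measure T. AE \<omega> in P. submodular (cost_g G \<omega>)"
    using Q.AE_pair[OF submod] by (rule eventually_mono) (auto elim: eventually_mono)
  moreover have "ae_filter (time_measure T) \<noteq> bot"
    using T_pos unfolding ae_filter_eq_bot_iff
    by (simp add: time_measure_def emeasure_restrict_space space_restrict_space)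
  ultimately show ?thesis by simp
qed

lemma submodularD:
  assumes "submodular \<phi>" "x \<le> x'" "\<mu> \<le>st \<mu>'" "\<mu> \<in> prob_measures" "\<mu>' \<in> prob_measures"
  shows "\<phi> x' \<mu>' + \<phi> x \<mu> \<le> \<phi> x' \<mu> + \<phi> x \<mu>'"
  using assms unfolding submodular_def by fastforce

text \<open>The exchange argument: maximum and minimum together cost no more than the two given pairs, and the
  minimum costs at least as much as the optimum for the lower flow, so the maximum is optimal for
  the upper flow.\<close>

lemma optimal_state_mono:
  assumes \<mu>: "tight_flow \<mu>" and \<nu>: "tight_flow \<nu>"
    and le: "AE t in time_measure T. \<mu> t \<le>st \<nu> t" and leT: "\<mu> T \<le>st \<nu> T"
    and X: "optimal_pair G \<mu> X \<alpha>" and Y: "optimal_pair G \<nu> Y \<beta>"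
  shows "AE \<omega> in P. \<forall>t\<in>{0..T}. X t \<omega> \<le> Y t \<omega>"
proof -
  have X': "\<alpha> \<in> admissible G" "strong_solution G \<alpha> X"
    "\<And>\<gamma> Z. \<gamma> \<in> admissible G \<Longrightarrow> strong_solution G \<gamma> Z \<Longrightarrow> J X \<alpha> \<mu> \<le> J Z \<gamma> \<mu>"
    using X optimal_pair_iff[OF \<mu>] by auto
  have Y': "\<beta> \<in> admissible G" "strong_solution G \<beta> Y"
    "\<And>\<gamma> Z. \<gamma> \<in> admissible G \<Longrightarrow> strong_solution G \<gamma> Z \<Longrightarrow> J Y \<beta> \<nu> \<le> J Z \<gamma> \<nu>"
    using Y optimal_pair_iff[OF \<nu>] by auto
  let ?hi = "\<lambda>t \<omega>. if Y t \<omega> < X t \<omega> then \<alpha> t \<omega> else \<beta> t \<omega>"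
  let ?lo = "\<lambda>t \<omega>. if Y t \<omega> < X t \<omega> then \<beta> t \<omega> else \<alpha> t \<omega>"
  let ?V = "\<lambda>t \<omega>. max (X t \<omega>) (Y t \<omega>)" and ?A = "\<lambda>t \<omega>. min (X t \<omega>) (Y t \<omega>)"
  note mm = max_min_strong_solution[OF X'(1,2) Y'(1,2)]
  note iV = cost_integrable[OF mm(1,3) \<nu>] and iA = cost_integrable[OF mm(2,4) \<mu>]
    and iX = cost_integrable[OF X'(1,2) \<mu>] and iY = cost_integrable[OF Y'(1,2) \<nu>]
  have pm: "AE t in time_measure T. \<mu> t \<in> prob_measures \<and> \<nu> t \<in> prob_measures"
    using \<mu> \<nu> unfolding tight_flow_def st_interval_def by auto
  have pmT: "\<mu> T \<in> prob_measures" "\<nu> T \<in> prob_measures"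
    using \<mu> \<nu> unfolding tight_flow_def st_interval_def by auto
  have "(\<integral>z. running ?V \<nu> z + running ?A \<mu> z \<partial>Q) \<le> (\<integral>z. running X \<mu> z + running Y \<nu> z \<partial>Q)"
  proof (rule integral_mono_AE)
    show "AE z in Q. running ?V \<nu> z + running ?A \<mu> z \<le> running X \<mu> z + running Y \<nu> z"
      using AE_Q_of_time[OF pm] AE_Q_of_time[OF le] submodular_f
    proof eventually_elim
      case (elim z)
      from submodularD[OF elim(3) _ elim(2), of "Y (fst z) (snd z)" "X (fst z) (snd z)"] elim(1)
      show ?case by (auto simp: running_def max_def min_def)
    qed
  qed (use iV iA iX iY in auto)
  then have r: "(\<integral>z. running ?V \<nu> z \<partial>Q) + (\<integral>z. running ?A \<mu> z \<partial>Q) \<le> (\<integral>z. running X \<mu> z \<partial>Q) + (\<integral>z. running Y \<nu> z \<partial>Q)"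
    using iV iA iX iY by simp
  have "(\<integral>z. effort ?V ?hi z + effort ?A ?lo z \<partial>Q) = (\<integral>z. effort X \<alpha> z + effort Y \<beta> z \<partial>Q)"
    by (rule Bochner_Integration.integral_cong) (auto simp: effort_def max_def min_def)
  then have e: "(\<integral>z. effort ?V ?hi z \<partial>Q) + (\<integral>z. effort ?A ?lo z \<partial>Q) = (\<integral>z. effort X \<alpha> z \<partial>Q) + (\<integral>z. effort Y \<beta> z \<partial>Q)"
    using Bochner_Integration.integral_add[OF iV(2) iA(2)] Bochner_Integration.integral_add[OF iX(2) iY(2)] by simp
  have "(\<integral>\<omega>. terminal ?V \<nu> \<omega> + terminal ?A \<mu> \<omega> \<partial>P) \<le> (\<integral>\<omega>. terminal X \<mu> \<omega> + terminal Y \<nu> \<omega> \<partial>P)"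
  proof (rule integral_mono_AE)
    show "AE \<omega> in P. terminal ?V \<nu> \<omega> + terminal ?A \<mu> \<omega> \<le> terminal X \<mu> \<omega> + terminal Y \<nu> \<omega>"
      using submodular_g
    proof eventually_elim
      case (elim \<omega>)
      from submodularD[OF elim _ leT, of "Y T \<omega>" "X T \<omega>"] pmT
      show ?case by (auto simp: terminal_def max_def min_def)
    qed
  qed (use iV iA iX iY in auto)
  then have t: "(\<integral>\<omega>. terminal ?V \<nu> \<omega> \<partial>P) + (\<integral>\<omega>. terminal ?A \<mu> \<omega> \<partial>P) \<le> (\<integral>\<omega>. terminal X \<mu> \<omega> \<partial>P) + (\<integral>\<omega>. terminal Y \<nu> \<omega> \<partial>P)"
    using iV iA iX iY by simp
  have "J ?V ?hi \<nu> + J ?A ?lo \<mu> \<le> J X \<alpha> \<mu> + J Y \<beta> \<nu>"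
    using r e t by (simp add: J_def)
  moreover have "J X \<alpha> \<mu> \<le> J ?A ?lo \<mu>" by (rule X'(3)[OF mm(2,4)])
  ultimately have "J ?V ?hi \<nu> \<le> J Y \<beta> \<nu>" by linarith
  then have "optimal_pair G \<nu> ?V ?hi"
    unfolding optimal_pair_iff[OF \<nu>] using mm(1,3) Y'(3) by (meson order_trans)
  then have "AE \<omega> in P. \<forall>t\<in>{0..T}. ?V t \<omega> = Y t \<omega>"
    using optimal_pair_unique[of \<nu>] Y \<nu> by (auto simp: tight_flow_def)
  then show ?thesis by eventually_elim (metis max.cobounded1)
qed

section \<open>Limits of optimal states\<close>

lemma convex_controls: "convex U"
proof -
  obtain \<omega> where "\<omega> \<in> space P" using P.not_empty by blast
  then have "convex ((UNIV :: real set) \<times> U)"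
    using l_convex[of 0] T_pos by (auto simp: convex_on_def)
  then have "convex (snd ` ((UNIV :: real set) \<times> U))"
    by (rule convex_linear_image[OF linear_snd])
  then show ?thesis by (simp add: image_def)
qed

lemma midpoint_control: "a \<in> U \<Longrightarrow> b \<in> U \<Longrightarrow> (a + b) / 2 \<in> U"
  using convexD[OF convex_controls, of a b "1/2" "1/2"] by (simp add: field_simps)

text \<open>The state equation is affine in the control, and the set of controls is convex.\<close>

lemma tail_hull_strong_solution:
  assumes adm: "\<And>n. \<alpha> n \<in> admissible G" and sol: "\<And>n. strong_solution G (\<alpha> n) (X n)"
    and h: "(a, Y) \<in> tail_hull (\<lambda>n. (\<alpha> n, X n)) n"
  shows "a \<in> admissible G \<and> strong_solution G a Y"
  using h
proof (induction "(a, Y)" arbitrary: a Y)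
  case (tail k)
  then show ?case using adm[of k] sol[of k] by simp
next
  case (midpoint a Y b Z)
  let ?c = "\<lambda>t \<omega>. (a t \<omega> + b t \<omega>) / 2" and ?V = "\<lambda>t \<omega>. (Y t \<omega> + Z t \<omega>) / 2"
  have a: "a \<in> admissible G" "strong_solution G a Y" and b: "b \<in> admissible G" "strong_solution G b Z"
    using midpoint by auto
  note a' = a(2)[unfolded strong_solution_iff[OF a(1)]] and b' = b(2)[unfolded strong_solution_iff[OF b(1)]]
  have c: "?c \<in> admissible G"
    unfolding admissible_iff
  proof
    show "progressive T F ?c"
      unfolding progressive_def split_beta'
    proof
      fix t assume "t \<in> {0..T}"
      then have [measurable]: "(\<lambda>z. a (fst z) (snd z)) \<in> borel_measurable (restrict_space borel {0..t} \<Otimes>\<^sub>M F t)"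
        "(\<lambda>z. b (fst z) (snd z)) \<in> borel_measurable (restrict_space borel {0..t} \<Otimes>\<^sub>M F t)"
        using a(1) b(1) by (auto simp: admissible_iff progressive_def split_beta')
      show "(\<lambda>z. (a (fst z) (snd z) + b (fst z) (snd z)) / 2) \<in> borel_measurable (restrict_space borel {0..t} \<Otimes>\<^sub>M F t)"
        by measurable
    qed
  qed (use a(1) b(1) midpoint_control in \<open>auto simp: admissible_iff\<close>)
  have "strong_solution G ?c ?V"
    unfolding strong_solution_iff[OF c]
  proof (intro conjI ballI)
    fix t assume "t \<in> {0..T}"
    then have [measurable]: "Y t \<in> borel_measurable (F t)" "Z t \<in> borel_measurable (F t)" using a' b' by auto
    show "(\<lambda>\<omega>. (Y t \<omega> + Z t \<omega>) / 2) \<in> borel_measurable (F t)" by measurable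
  next
    fix \<omega> assume "\<omega> \<in> space P"
    then show "continuous_on {0..T} (\<lambda>t. (Y t \<omega> + Z t \<omega>) / 2)"
      using a' b' by (intro continuous_intros) auto
  next
    show "AE \<omega> in P. \<forall>t\<in>{0..T}. ?V t \<omega> = evolved ?c ?V t \<omega>"
      using a'[THEN conjunct2, THEN conjunct2] b'[THEN conjunct2, THEN conjunct2] AE_space
    proof eventually_elim
      case (elim \<omega>)
      show ?case
      proof
        fix t assume t: "t \<in> {0..T}"
        let ?x = "\<lambda>s. rate a Y s \<omega>" and ?y = "\<lambda>s. rate b Z s \<omega>"
        have i: "set_integrable lborel {0..t} ?x" "set_integrable lborel {0..t} ?y"
          by (rule affine_path_integrable; use a b a' b' elim(3) t in blast)+
        have "(LBINT s:{0..t}. rate ?c ?V s \<omega>) = (LBINT s:{0..t}. (1 / 2) * (?x s + ?y s))"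
          by (rule set_lebesgue_integral_cong) (auto simp: field_simps)
        also have "\<dots> = (1 / 2) * ((LBINT s:{0..t}. ?x s) + (LBINT s:{0..t}. ?y s))"
          by (simp only: set_integral_mult_right set_integral_add(2)[OF i])
        finally have 1: "(LBINT s:{0..t}. rate ?c ?V s \<omega>) =
          (1 / 2) * ((LBINT s:{0..t}. ?x s) + (LBINT s:{0..t}. ?y s))" .
        have "Y t \<omega> = \<xi> \<omega> + (LBINT s:{0..t}. ?x s) + \<sigma> * W t \<omega>" "Z t \<omega> = \<xi> \<omega> + (LBINT s:{0..t}. ?y s) + \<sigma> * W t \<omega>"
          using elim(1,2) t by blast+
        then show "?V t \<omega> = evolved ?c ?V t \<omega>"
          unfolding 1 by argo
      qed
    qed
  qed
  then show ?case using c by blast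
qed

text \<open>Convexity of the control cost, jointly in state and control.\<close>

lemma tail_hull_effort_le:
  assumes adm: "\<And>n. \<alpha> n \<in> admissible G" and sol: "\<And>n. strong_solution G (\<alpha> n) (X n)"
    and \<mu>: "tight_flow \<mu>" and B: "\<And>k. n \<le> k \<Longrightarrow> (\<integral>z. effort (X k) (\<alpha> k) z \<partial>Q) \<le> B"
    and h: "(a, Y) \<in> tail_hull (\<lambda>n. (\<alpha> n, X n)) n"
  shows "(\<integral>z. effort Y a z \<partial>Q) \<le> B"
  using h
proof (induction "(a, Y)" arbitrary: a Y)
  case (tail k)
  then show ?case using B[of k] by simp
next
  case (midpoint a Y b Z)
  let ?c = "\<lambda>t \<omega>. (a t \<omega> + b t \<omega>) / 2" and ?V = "\<lambda>t \<omega>. (Y t \<omega> + Z t \<omega>) / 2"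
  have a: "a \<in> admissible G" "strong_solution G a Y" and b: "b \<in> admissible G" "strong_solution G b Z"
    and c: "?c \<in> admissible G" "strong_solution G ?c ?V"
    using tail_hull_strong_solution[where n=n and \<alpha>=\<alpha> and X=X, OF adm sol] midpoint(1,3) tail_hull.midpoint[OF midpoint(1,3)] by blast+
  note ia = cost_integrable(2)[OF a \<mu>] and ib = cost_integrable(2)[OF b \<mu>] and ic = cost_integrable(2)[OF c \<mu>]
  have "(\<integral>z. effort ?V ?c z \<partial>Q) \<le> (\<integral>z. (effort Y a z + effort Z b z) / 2 \<partial>Q)"
  proof (rule integral_mono)
    fix z assume "z \<in> space Q"
    then obtain t \<omega> where z: "z = (t, \<omega>)" "t \<in> {0..T}" "\<omega> \<in> space P" by (auto simp: space_Q)
    have U: "a t \<omega> \<in> U" "b t \<omega> \<in> U" using a(1) b(1) z by (auto simp: admissible_iff)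
    have "(\<lambda>(x, a). cost_l G t \<omega> x a) ((1 / 2) *\<^sub>R (Y t \<omega>, a t \<omega>) + (1 / 2) *\<^sub>R (Z t \<omega>, b t \<omega>)) \<le>
      1 / 2 * (\<lambda>(x, a). cost_l G t \<omega> x a) (Y t \<omega>, a t \<omega>) + 1 / 2 * (\<lambda>(x, a). cost_l G t \<omega> x a) (Z t \<omega>, b t \<omega>)"
    proof -
      have cx: "\<And>x y u v. x \<in> UNIV \<times> U \<Longrightarrow> y \<in> UNIV \<times> U \<Longrightarrow> 0 \<le> u \<Longrightarrow> 0 \<le> v \<Longrightarrow> u + v = 1 \<Longrightarrow>
        (\<lambda>(x, a). cost_l G t \<omega> x a) (u *\<^sub>R x + v *\<^sub>R y) \<le>
        u * (\<lambda>(x, a). cost_l G t \<omega> x a) x + v * (\<lambda>(x, a). cost_l G t \<omega> x a) y"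
        using l_convex[OF z(2,3)] unfolding convex_on_def by blast
      show ?thesis by (rule cx) (use U in auto)
    qed
    then show "effort ?V ?c z \<le> (effort Y a z + effort Z b z) / 2"
      by (simp add: effort_def z add_divide_distrib)
  qed (use ia ib ic in auto)
  also have "\<dots> = ((\<integral>z. effort Y a z \<partial>Q) + (\<integral>z. effort Z b z \<partial>Q)) / 2"
    using ia ib by simp
  also have "\<dots> \<le> B" using midpoint(2,4) by argo
  finally show ?case .
qed

lemma AE_Q_sections:
  assumes "AE z in Q. R (fst z) (snd z)"
  shows "AE \<omega> in P. AE t in time_measure T. R t \<omega>"
proof -
  obtain N where N: "{z\<in>space Q. \<not> R (fst z) (snd z)} \<subseteq> N" "N \<in> null_sets Q"
    using assms unfolding eventually_ae_filter by auto
  have Ns: "N \<in> sets Q" using N(2) by auto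
  have "(\<integral>\<^sup>+\<omega>. emeasure (time_measure T) ((\<lambda>t. (t, \<omega>)) -` N) \<partial>P) = 0"
    using N(2) Q.emeasure_pair_measure_alt2[OF Ns] by auto
  then have "AE \<omega> in P. emeasure (time_measure T) ((\<lambda>t. (t, \<omega>)) -` N) = 0"
    using Ns by (subst (asm) nn_integral_0_iff_AE) (auto intro: Q.measurable_emeasure_Pair2)
  then show ?thesis
    using AE_space
  proof eventually_elim
    case (elim \<omega>)
    have "(\<lambda>t. (t, \<omega>)) -` N \<in> null_sets (time_measure T)"
      using elim(1) sets_Pair2[OF Ns] by (auto simp: null_sets_def)
    then show ?case
      by (rule AE_I') (use N(1) elim(2) in \<open>fastforce simp: space_Q space_time_measure\<close>)
  qed
qed

text \<open>Combinations of the tails of the controls converge almost everywhere; the same combinations of the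
  states are squeezed to the limit of the states.  Passing to the limit in the state
  equation shows that the limit state is driven by the limit control.\<close>

lemma limit_strong_solution:
  assumes adm: "\<And>n. \<alpha> n \<in> admissible G" and sol: "\<And>n. strong_solution G (\<alpha> n) (X n)"
    and conv: "AE \<omega> in P. \<forall>t\<in>{0..T}. convergent (\<lambda>n. X n t \<omega>)"
  obtains a Y \<beta> Z where "\<And>n. (a n, Y n) \<in> tail_hull (\<lambda>n. (\<alpha> n, X n)) n"
    and "\<beta> \<in> admissible G" and "strong_solution G \<beta> Z"
    and "AE \<omega> in P. \<forall>t\<in>{0..T}. (\<lambda>n. X n t \<omega>) \<longlonglongrightarrow> Z t \<omega>"
    and "AE z in Q. (\<lambda>n. Y n (fst z) (snd z)) \<longlonglongrightarrow> Z (fst z) (snd z)"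
    and "AE z in Q. (\<lambda>n. a n (fst z) (snd z)) \<longlonglongrightarrow> \<beta> (fst z) (snd z)"
proof -
  let ?H = "tail_hull (\<lambda>n. (\<alpha> n, X n))"
  define V where "V n = (\<lambda>(a, Y) z. a (fst z) (snd z)) ` ?H n" for n
  have hull: "a \<in> admissible G" "strong_solution G a Y" if "(a, Y) \<in> ?H n" for a Y n
    using tail_hull_strong_solution[where n=n and \<alpha>=\<alpha> and X=X, OF adm sol] that by blast+
  obtain y where y: "\<And>n. y n \<in> V n" and yc: "AE z in Q. convergent (\<lambda>n. y n z)"
  proof (rule midpoint_tails_AE_convergent[of Q V K])
    show "finite_measure Q" by (rule Qfin.finite_measure_axioms)
    show "V n \<noteq> {}" for n using tail_hull.tail[of n n] by (auto simp: V_def)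
    show "V n \<subseteq> V m" if "m \<le> n" for m n unfolding V_def by (intro image_mono tail_hull_antimono that)
    show "(\<lambda>z. (v z + w z) / 2) \<in> V n" if "v \<in> V n" "w \<in> V n" for n v w
    proof -
      obtain a Y b Z where e: "(a, Y) \<in> ?H n" "v = (\<lambda>z. a (fst z) (snd z))" "(b, Z) \<in> ?H n" "w = (\<lambda>z. b (fst z) (snd z))"
        using \<open>v \<in> V n\<close> \<open>w \<in> V n\<close> unfolding V_def by auto
      show ?thesis unfolding V_def
        by (rule image_eqI[OF _ tail_hull.midpoint[OF e(1,3)]]) (simp add: e)
    qed
    show "v \<in> borel_measurable Q" if "v \<in> V 0" for v
      using that hull progressive_measurable by (auto simp: V_def admissible_iff split_beta')
    show "\<bar>v z\<bar> \<le> K" if "v \<in> V 0" "z \<in> space Q" for v z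
      using that hull(1) K_control by (fastforce simp: V_def admissible_iff space_Q)
  qed blast
  have "\<exists>aY. aY \<in> ?H n \<and> y n = (\<lambda>z. fst aY (fst z) (snd z))" for n
    using y[of n] unfolding V_def image_iff split_beta' by blast
  then have "\<exists>aY. \<forall>n. aY n \<in> ?H n \<and> y n = (\<lambda>z. fst (aY n) (fst z) (snd z))"
    by (intro choice allI)
  then obtain aY where aY: "\<And>n. aY n \<in> ?H n" "\<And>n. y n = (\<lambda>z. fst (aY n) (fst z) (snd z))" by blast
  define a Y where "a n = fst (aY n)" and "Y n = snd (aY n)" for n
  have aH: "(a n, Y n) \<in> ?H n" for n using aY(1)[of n] by (simp add: a_def Y_def)
  note a_sol = hull[OF aH]
  have ac: "AE z in Q. convergent (\<lambda>n. a n (fst z) (snd z))" using yc by (simp add: aY(2) a_def)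
  obtain u where u: "u \<in> U" using controls_nonempty[OF adm] by blast
  \<comment> \<open>Where the combinations do not converge, any control value will do; \<open>u\<close> keeps \<open>\<beta>\<close> in the control set.\<close>
  define \<beta> where "\<beta> t \<omega> = (if Cauchy (\<lambda>n. a n t \<omega>) then lim (\<lambda>n. a n t \<omega>) else u)" for t \<omega>
  have a_lim: "AE z in Q. (\<lambda>n. a n (fst z) (snd z)) \<longlonglongrightarrow> \<beta> (fst z) (snd z)"
    using ac by eventually_elim (simp add: \<beta>_def Cauchy_convergent_iff convergent_LIMSEQ_iff)
  have aU: "a n t \<omega> \<in> U" if "t \<in> {0..T}" "\<omega> \<in> space P" for n t \<omega>
    using a_sol(1)[of n] that by (auto simp: admissible_iff)
  have adm\<beta>: "\<beta> \<in> admissible G"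
    unfolding admissible_iff
  proof (intro conjI ballI)
    show "progressive T F \<beta>"
      unfolding progressive_def split_beta'
    proof
      fix t assume t: "t \<in> {0..T}"
      let ?N = "restrict_space borel {0..t} \<Otimes>\<^sub>M F t"
      have [measurable]: "(\<lambda>z. a n (fst z) (snd z)) \<in> borel_measurable ?N" for n
        using a_sol(1)[of n] t by (auto simp: admissible_iff progressive_def split_beta')
      have "{z \<in> space ?N. Cauchy (\<lambda>n. a n (fst z) (snd z))} \<in> sets ?N" by measurable
      then show "(\<lambda>z. \<beta> (fst z) (snd z)) \<in> borel_measurable ?N"
        unfolding \<beta>_def by measurable
    qed
    fix t \<omega> assume tw: "t \<in> {0..T}" "\<omega> \<in> space P"
    show "\<beta> t \<omega> \<in> U"
    proof (cases "Cauchy (\<lambda>n. a n t \<omega>)")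
      case True
      then have "(\<lambda>n. a n t \<omega>) \<longlonglongrightarrow> \<beta> t \<omega>"
        by (simp add: \<beta>_def Cauchy_convergent_iff convergent_LIMSEQ_iff)
      then show ?thesis
        using compact_imp_closed[OF compact_controls] aU[OF tw] by (meson closed_sequentially)
    qed (use u in \<open>simp add: \<beta>_def\<close>)
  qed
  define x where "x t \<omega> = lim (\<lambda>n. X n t \<omega>)" for t \<omega>
  have xconv: "AE \<omega> in P. \<forall>t\<in>{0..T}. (\<lambda>n. X n t \<omega>) \<longlonglongrightarrow> x t \<omega>"
    using conv by eventually_elim (simp add: x_def convergent_LIMSEQ_iff)
  have Yconv: "(\<lambda>n. Y n t \<omega>) \<longlonglongrightarrow> l" if l: "(\<lambda>n. X n t \<omega>) \<longlonglongrightarrow> l" for t \<omega> l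
  proof (rule LIMSEQ_I)
    fix e :: real assume "0 < e"
    then obtain n0 where n0: "\<And>n. n \<ge> n0 \<Longrightarrow> norm (X n t \<omega> - l) < e / 2"
      using LIMSEQ_D[OF l, of "e / 2"] by (metis half_gt_zero)
    have "\<bar>Y n t \<omega> - l\<bar> \<le> e / 2" if "n \<ge> n0" for n
      by (rule tail_hull_close[OF aH[of n]]) (use n0 that in \<open>fastforce intro: less_imp_le\<close>)
    then show "\<exists>n0. \<forall>n\<ge>n0. norm (Y n t \<omega> - l) < e" using \<open>0 < e\<close> by (intro exI[of _ n0]) fastforce
  qed
  have path: "AE \<omega> in P. continuous_on {0..T} (\<lambda>t. x t \<omega>) \<and>
    (\<forall>t\<in>{0..T}. x t \<omega> = evolved \<beta> x t \<omega>)"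
  proof -
    have eqs: "AE \<omega> in P. \<forall>n. \<forall>t\<in>{0..T}. Y n t \<omega> = evolved (a n) (Y n) t \<omega>"
      using a_sol strong_solution_iff by (simp add: AE_all_countable)
    have bnds: "AE \<omega> in P. \<forall>n. \<forall>t\<in>{0..T}. \<bar>Y n t \<omega>\<bar> \<le> envelope t \<omega>"
      using strong_solution_bound[OF a_sol] by (simp add: AE_all_countable)
    have acs: "AE \<omega> in P. AE t in time_measure T. (\<lambda>n. a n t \<omega>) \<longlonglongrightarrow> \<beta> t \<omega>"
      by (rule AE_Q_sections[OF a_lim])
    show ?thesis
      using eqs bnds acs xconv AE_space
    proof eventually_elim
      case (elim \<omega>)
      have xl: "(\<lambda>n. Y n t \<omega>) \<longlonglongrightarrow> x t \<omega>" if "t \<in> {0..T}" for t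
        using elim(4) that by (intro Yconv) auto
      have contY: "continuous_on {0..T} (\<lambda>t. Y n t \<omega>)" for n
        using a_sol(2)[of n] elim(5) by (auto simp: strong_solution_def)
      let ?g = "\<lambda>s. rate \<beta> x s \<omega>"
      let ?gn = "\<lambda>n s. rate (a n) (Y n) s \<omega>"
      let ?w = "\<lambda>s. K + K * envelope s \<omega> + K * K"
      have in_n: "integrable (time_measure T) (?gn n)" for n
        unfolding integrable_time_measure
        by (rule affine_path_integrable[OF a_sol(1) elim(5) contY]) (use T_pos in auto)
      have xm: "(\<lambda>s. x s \<omega>) \<in> borel_measurable (time_measure T)"
      proof (rule borel_measurable_LIMSEQ_real)
        show "(\<lambda>n. Y n s \<omega>) \<longlonglongrightarrow> x s \<omega>" if "s \<in> space (time_measure T)" for s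
          using xl that by (simp add: space_time_measure)
        show "(\<lambda>s. Y n s \<omega>) \<in> borel_measurable (time_measure T)" for n
          by (rule progressive_section[OF strong_solution_progressive[OF a_sol(2)] elim(5)])
      qed
      have cm: "h \<in> borel_measurable (time_measure T)" if "continuous_on {0..T} h" for h :: "real \<Rightarrow> real"
        using borel_measurable_integrable borel_integrable_atLeastAtMost'[OF that] integrable_time_measure by blast
      note [measurable] = xm progressive_section[OF _ elim(5), of \<beta>] cm[OF coeff_cont(1)] cm[OF coeff_cont(2)] cm[OF coeff_cont(3)]
      have [measurable]: "(\<lambda>s. \<beta> s \<omega>) \<in> borel_measurable (time_measure T)"
        using adm\<beta> progressive_section[OF _ elim(5), of \<beta>] by (simp add: admissible_iff)
      have wint: "integrable (time_measure T) ?w"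
        unfolding integrable_time_measure envelope_def
        by (intro borel_integrable_atLeastAtMost' continuous_intros W_cont elim)
      have conv_ae: "AE s in time_measure T. (\<lambda>n. ?gn n s) \<longlonglongrightarrow> ?g s"
        using elim(3) AE_space
        by eventually_elim (intro tendsto_intros xl, simp add: space_time_measure)
      have bnd_ae: "AE s in time_measure T. norm (?gn n s) \<le> ?w s" for n
      proof (rule AE_I2)
        fix s assume "s \<in> space (time_measure T)"
        then have s: "s \<in> {0..T}" by (simp add: space_time_measure)
        have "\<bar>?gn n s\<bar> \<le> \<bar>c s\<bar> + \<bar>p s\<bar> * \<bar>Y n s \<omega>\<bar> + \<bar>q s\<bar> * \<bar>a n s \<omega>\<bar>" by (simp add: abs_mult[symmetric])
        also have "\<dots> \<le> ?w s"
          using K_coeff[OF s] elim(2) s K_control[OF aU[OF s elim(5)], of n] K_pos by (intro add_mono mult_mono) auto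
        finally show "norm (?gn n s) \<le> ?w s" by simp
      qed
      have gint: "integrable (time_measure T) ?g"
        by (rule integrable_dominated_convergence[OF _ _ wint conv_ae bnd_ae]) (use in_n in auto)
      have eq: "x t \<omega> = \<xi> \<omega> + (LBINT s:{0..t}. ?g s) + \<sigma> * W t \<omega>" if t: "t \<in> {0..T}" for t
      proof -
        have restrict: "(\<integral>s. indicator {0..t} s * h s \<partial>time_measure T) = (LBINT s:{0..t}. h s)" for h :: "real \<Rightarrow> real"
          unfolding integral_time_measure set_lebesgue_integral_def
          by (rule Bochner_Integration.integral_cong) (use t in \<open>auto simp: indicator_def\<close>)
        have ti: "{0..t} \<inter> space (time_measure T) \<in> sets (time_measure T)"
          using t by (auto simp: space_time_measure sets_time_measure sets_restrict_space)
        have [measurable]: "(indicator {0..t} :: real \<Rightarrow> real) \<in> borel_measurable (time_measure T)"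
          using ti by (simp add: borel_measurable_indicator_iff Int_commute)
        have "(\<lambda>n. \<integral>s. indicator {0..t} s * ?gn n s \<partial>time_measure T) \<longlonglongrightarrow> (\<integral>s. indicator {0..t} s * ?g s \<partial>time_measure T)"
        proof (rule integral_dominated_convergence[OF _ _ wint])
          show "AE s in time_measure T. (\<lambda>n. indicator {0..t} s * ?gn n s) \<longlonglongrightarrow> indicator {0..t} s * ?g s"
            using conv_ae by eventually_elim (rule tendsto_mult_left)
          show "AE s in time_measure T. norm (indicator {0..t} s * ?gn n s) \<le> ?w s" for n
            using bnd_ae[of n] by eventually_elim (auto simp: indicator_def)
          show "(\<lambda>s. indicator {0..t} s * ?gn n s) \<in> borel_measurable (time_measure T)" for n
            using in_n[of n] by (intro borel_measurable_times) auto
        qed measurable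
        then have "(\<lambda>n. \<xi> \<omega> + (LBINT s:{0..t}. ?gn n s) + \<sigma> * W t \<omega>) \<longlonglongrightarrow> \<xi> \<omega> + (LBINT s:{0..t}. ?g s) + \<sigma> * W t \<omega>"
          unfolding restrict by (intro tendsto_intros)
        moreover have "\<xi> \<omega> + (LBINT s:{0..t}. ?gn n s) + \<sigma> * W t \<omega> = Y n t \<omega>" for n
          using elim(1) t by simp
        ultimately show ?thesis using LIMSEQ_unique[OF xl[OF t]] by simp
      qed
      have "continuous_on {0..T} (\<lambda>t. \<xi> \<omega> + (LBINT s:{0..t}. ?g s) + \<sigma> * W t \<omega>)"
        using gint unfolding integrable_time_measure
        by (intro continuous_intros continuous_on_indefinite_set_integral W_cont elim)
      then have "continuous_on {0..T} (\<lambda>t. x t \<omega>)"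
        by (rule continuous_on_cong[OF refl, THEN iffD1, rotated]) (use eq in auto)
      with eq show ?case by blast
    qed
  qed
  then obtain N where N: "N \<in> null_sets P" "{\<omega>\<in>space P. \<not> (continuous_on {0..T} (\<lambda>t. x t \<omega>) \<and>
    (\<forall>t\<in>{0..T}. x t \<omega> = evolved \<beta> x t \<omega>))} \<subseteq> N"
    unfolding eventually_ae_filter by auto
  \<comment> \<open>All paths of a state have to be continuous, so the limit is replaced by a constant path on a null set,
    which belongs to the filtration from time \<open>0\<close> on.\<close>
  define Z where "Z t \<omega> = (if \<omega> \<in> N then 0 else x t \<omega>)" for t \<omega>
  have notN: "AE \<omega> in P. \<omega> \<notin> N" by (rule AE_not_in[OF N(1)])
  have Zconv: "AE \<omega> in P. \<forall>t\<in>{0..T}. (\<lambda>n. X n t \<omega>) \<longlonglongrightarrow> Z t \<omega>"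
    using xconv notN by eventually_elim (simp add: Z_def)
  have solZ: "strong_solution G \<beta> Z"
    unfolding strong_solution_iff[OF adm\<beta>]
  proof (intro conjI ballI)
    fix t assume t: "t \<in> {0..T}"
    have [measurable]: "X n t \<in> borel_measurable (F t)" for n
      using sol[of n] t by (auto simp: strong_solution_def)
    have [measurable]: "N \<in> sets (F t)" by (rule null_sets_in_F[OF N(1) t])
    show "Z t \<in> borel_measurable (F t)" unfolding Z_def x_def by measurable
  next
    fix \<omega> assume "\<omega> \<in> space P"
    then show "continuous_on {0..T} (\<lambda>t. Z t \<omega>)" using N(2) by (cases "\<omega> \<in> N") (auto simp: Z_def)
  next
    show "AE \<omega> in P. \<forall>t\<in>{0..T}. Z t \<omega> = evolved \<beta> Z t \<omega>"
      using path notN by eventually_elim (simp add: Z_def)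
  qed
  show ?thesis
  proof (rule that[OF aH adm\<beta> solZ Zconv _ a_lim])
    show "AE z in Q. (\<lambda>n. Y n (fst z) (snd z)) \<longlonglongrightarrow> Z (fst z) (snd z)"
      using AE_Q_of_P[OF Zconv] by eventually_elim (rule Yconv)
  qed
qed

text \<open>The extreme measures are made so that Markov's inequality for \<open>\<psi>\<close> places a law between them.\<close>

lemma law_in_st_interval:
  assumes Y [measurable]: "Y \<in> borel_measurable P"
    and bound: "(\<integral>\<^sup>+ \<omega>. ennreal (\<psi> \<bar>Y \<omega>\<bar>) \<partial>P) \<le> ennreal M"
  shows "distr P borel Y \<in> st_interval \<psi> M"
proof -
  have psim [measurable]: "(\<lambda>x. \<psi> \<bar>x\<bar>) \<in> borel_measurable borel"
    by (intro borel_measurable_continuous_onI continuous_on_compose2[OF psi(2)] continuous_intros) auto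
  have M0: "0 < M" using psi(1,5) by (meson le_less_trans order_refl)
  have markov: "P.prob {\<omega>\<in>space P. s \<le> \<bar>Y \<omega>\<bar>} \<le> M / \<psi> s" if s: "0 \<le> s" "M < \<psi> s" for s
  proof -
    have "ennreal (\<psi> s) * emeasure P {\<omega>\<in>space P. s \<le> \<bar>Y \<omega>\<bar>} = 
        (\<integral>\<^sup>+\<omega>. ennreal (\<psi> s) * indicator {\<omega>\<in>space P. s \<le> \<bar>Y \<omega>\<bar>} \<omega> \<partial>P)"
      by (rule nn_integral_cmult_indicator[symmetric]) measurable
    also have "\<dots> \<le> (\<integral>\<^sup>+ \<omega>. ennreal (\<psi> \<bar>Y \<omega>\<bar>) \<partial>P)"
    proof (rule nn_integral_mono)
      fix \<omega>
      have "\<psi> s \<le> \<psi> \<bar>Y \<omega>\<bar>" if "s \<le> \<bar>Y \<omega>\<bar>"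
        using monotone_onD[OF strict_mono_on_imp_mono_on[OF psi(3)]] that s by auto
      then show "ennreal (\<psi> s) * indicator {\<omega>\<in>space P. s \<le> \<bar>Y \<omega>\<bar>} \<omega> \<le> ennreal (\<psi> \<bar>Y \<omega>\<bar>)"
        by (auto simp: indicator_def intro: ennreal_leI)
    qed
    also note bound
    finally have "ennreal (\<psi> s * P.prob {\<omega>\<in>space P. s \<le> \<bar>Y \<omega>\<bar>}) \<le> ennreal M"
      using psi(1) s(1) by (simp add: P.emeasure_eq_measure ennreal_mult)
    then have "\<psi> s * P.prob {\<omega>\<in>space P. s \<le> \<bar>Y \<omega>\<bar>} \<le> M"
      using M0 by (simp add: ennreal_le_iff)
    then show ?thesis using s(2) M0 by (simp add: pos_le_divide_eq mult.commute)
  qed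
  have cdf: "cdf (distr P borel Y) s = P.prob {\<omega>\<in>space P. Y \<omega> \<le> s}" for s
    unfolding cdf_def by (subst measure_distr) (auto intro!: arg_cong[where f=P.prob])
  have "mu_Min \<psi> M \<le>st distr P borel Y"
    unfolding st_le_def cdf_mu_Min[OF psi(2,3,1,4,5)] cdf
  proof
    fix s
    show "P.prob {\<omega>\<in>space P. Y \<omega> \<le> s} \<le> (if \<psi> (max 0 (- s)) \<le> M then 1 else M / \<psi> (max 0 (- s)))"
    proof (cases "\<psi> (max 0 (- s)) \<le> M")
      case False
      then have s: "0 < - s" using psi(5) by (cases "s = 0") (auto simp: max_def split: if_splits)
      have "P.prob {\<omega>\<in>space P. Y \<omega> \<le> s} \<le> P.prob {\<omega>\<in>space P. - s \<le> \<bar>Y \<omega>\<bar>}"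
        by (rule P.finite_measure_mono) auto
      also have "\<dots> \<le> M / \<psi> (- s)" using markov[of "- s"] False s by (simp add: max_def)
      finally show ?thesis using False s by (simp add: max_def)
    qed simp
  qed
  moreover have "distr P borel Y \<le>st mu_Max \<psi> M"
    unfolding st_le_def cdf_mu_Max[OF psi(2,3,1,4,5)] cdf
  proof
    fix s
    show "(if \<psi> (max 0 s) \<le> M then 0 else 1 - M / \<psi> (max 0 s)) \<le> P.prob {\<omega>\<in>space P. Y \<omega> \<le> s}"
    proof (cases "\<psi> (max 0 s) \<le> M")
      case False
      then have s: "0 < s" using psi(5) by (cases "s = 0") (auto simp: max_def split: if_splits)
      have "1 - P.prob {\<omega>\<in>space P. Y \<omega> \<le> s} = P.prob {\<omega>\<in>space P. \<not> Y \<omega> \<le> s}"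
        by (rule P.prob_neg[symmetric]) measurable
      also have "\<dots> \<le> P.prob {\<omega>\<in>space P. s \<le> \<bar>Y \<omega>\<bar>}"
        by (rule P.finite_measure_mono) auto
      also have "\<dots> \<le> M / \<psi> s" using markov[of s] False s by (simp add: max_def)
      finally show ?thesis using False s by (simp add: max_def)
    qed simp
  qed
  ultimately show ?thesis
    by (auto simp: st_interval_def space_prob_algebra intro!: P.prob_space_distr)
qed

text \<open>Fatou's lemma carries the moment bound to the limit, so the limit laws stay in the interval
  before they are known to be laws of optimal states.\<close>

lemma psi_moment_limit:
  assumes Y: "\<And>n. Y n \<in> borel_measurable P" and Z [measurable]: "Z \<in> borel_measurable P"
    and conv: "AE \<omega> in P. (\<lambda>n. Y n \<omega>) \<longlonglongrightarrow> Z \<omega>"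
    and bound: "\<And>n. (\<integral>\<^sup>+ \<omega>. ennreal (\<psi> \<bar>Y n \<omega>\<bar>) \<partial>P) \<le> ennreal M"
  shows "(\<integral>\<^sup>+ \<omega>. ennreal (\<psi> \<bar>Z \<omega>\<bar>) \<partial>P) \<le> ennreal M"
proof -
  note [measurable] = Y
  have cont: "continuous_on UNIV (\<lambda>x. \<psi> \<bar>x\<bar>)"
    by (intro continuous_on_compose2[OF psi(2)] continuous_intros) auto
  have [measurable]: "(\<lambda>x. \<psi> \<bar>x\<bar>) \<in> borel_measurable borel"
    by (rule borel_measurable_continuous_onI[OF cont])
  have "(\<integral>\<^sup>+ \<omega>. ennreal (\<psi> \<bar>Z \<omega>\<bar>) \<partial>P) = (\<integral>\<^sup>+ \<omega>. liminf (\<lambda>n. ennreal (\<psi> \<bar>Y n \<omega>\<bar>)) \<partial>P)"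
  proof (rule nn_integral_cong_AE)
    show "AE \<omega> in P. ennreal (\<psi> \<bar>Z \<omega>\<bar>) = liminf (\<lambda>n. ennreal (\<psi> \<bar>Y n \<omega>\<bar>))"
      using conv
    proof eventually_elim
      case (elim \<omega>)
      have "(\<lambda>n. \<psi> \<bar>Y n \<omega>\<bar>) \<longlonglongrightarrow> \<psi> \<bar>Z \<omega>\<bar>"
        by (rule continuous_on_tendsto_compose[OF cont elim]) auto
      then have "(\<lambda>n. ennreal (\<psi> \<bar>Y n \<omega>\<bar>)) \<longlonglongrightarrow> ennreal (\<psi> \<bar>Z \<omega>\<bar>)" by (rule tendsto_ennrealI)
      then show ?case by (intro lim_imp_Liminf[symmetric]) auto
    qed
  qed
  also have "\<dots> \<le> liminf (\<lambda>n. \<integral>\<^sup>+ \<omega>. ennreal (\<psi> \<bar>Y n \<omega>\<bar>) \<partial>P)"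
    by (rule nn_integral_liminf) measurable
  also have "\<dots> \<le> liminf (\<lambda>n::nat. ennreal M)"
    by (rule Liminf_mono) (simp add: bound)
  finally show ?thesis by (simp add: Liminf_const)
qed

lemma flows_prob_measures: "\<mu> \<in> flows T \<Longrightarrow> t \<in> {0..T} \<Longrightarrow> \<mu> t \<in> prob_measures"
  unfolding flows_def by (drule measurable_space) (auto simp: space_restrict_space)

lemma law_in_flows:
  assumes "strong_solution G \<alpha> X"
  shows "(\<lambda>t. distr P borel (X t)) \<in> flows T"
proof (rule law_flow_measurable[OF prob_space_P])
  have "(\<lambda>(t, \<omega>). X t \<omega>) \<in> borel_measurable Q"
    by (rule progressive_measurable[OF strong_solution_progressive[OF assms]])
  also have "borel_measurable Q = borel_measurable (restrict_space borel {0..T} \<Otimes>\<^sub>M P)"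
    by (intro measurable_cong_sets sets_pair_measure_cong refl sets_time_measure)
  finally show "(\<lambda>(t, \<omega>). X t \<omega>) \<in> borel_measurable (restrict_space borel {0..T} \<Otimes>\<^sub>M P)" .
qed

text \<open>State and flow may vary together, because the costs are jointly continuous and dominated by
  the growth bound at the envelope.\<close>

lemma flow_costs_tendsto:
  assumes adm: "\<And>n. \<alpha> n \<in> admissible G" "\<beta> \<in> admissible G"
    and sol: "\<And>n. strong_solution G (\<alpha> n) (X n)" "strong_solution G \<beta> Z"
    and conv: "AE \<omega> in P. \<forall>t\<in>{0..T}. (\<lambda>n. X n t \<omega>) \<longlonglongrightarrow> Z t \<omega>"
    and \<mu>: "\<And>n. tight_flow (\<mu> n)" "tight_flow \<nu>"
    and weak: "\<And>t. t \<in> {0..T} \<Longrightarrow> weak_conv_m (\<lambda>n. \<mu> n t) (\<nu> t)"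
  shows "(\<lambda>n. (\<integral>z. running (X n) (\<mu> n) z \<partial>Q) + (\<integral>\<omega>. terminal (X n) (\<mu> n) \<omega> \<partial>P)) \<longlonglongrightarrow>
    (\<integral>z. running Z \<nu> z \<partial>Q) + (\<integral>\<omega>. terminal Z \<nu> \<omega> \<partial>P)"
proof (rule tendsto_add)
  have fl: "\<mu> n \<in> flows T" "\<nu> \<in> flows T" for n using \<mu> by (auto simp: tight_flow_def)
  have Tin: "T \<in> {0..T}" using T_pos by auto
  show "(\<lambda>n. \<integral>z. running (X n) (\<mu> n) z \<partial>Q) \<longlonglongrightarrow> (\<integral>z. running Z \<nu> z \<partial>Q)"
  proof (rule integral_dominated_convergence[OF _ _ cost_bound_integrable(1)])
    show "running Z \<nu> \<in> borel_measurable Q"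
      by (rule borel_measurable_integrable[OF cost_integrable(1)[OF adm(2) sol(2) \<mu>(2)]])
    show "running (X n) (\<mu> n) \<in> borel_measurable Q" for n
      by (rule borel_measurable_integrable[OF cost_integrable(1)[OF adm(1) sol(1) \<mu>(1)]])
    show "AE z in Q. (\<lambda>n. running (X n) (\<mu> n) z) \<longlonglongrightarrow> running Z \<nu> z"
      using AE_Q_of_P[where R="\<lambda>t \<omega>. (\<lambda>n. X n t \<omega>) \<longlonglongrightarrow> Z t \<omega>", OF conv] AE_space
    proof eventually_elim
      case (elim z)
      have z: "fst z \<in> {0..T}" "snd z \<in> space P" using elim(2) by (auto simp: space_Q)
      show ?case unfolding running_def
        by (rule joint_continuity_limit[OF f_cont[OF z] elim(1)
              flows_prob_measures[OF fl(1) z(1)] flows_prob_measures[OF fl(2) z(1)] weak[OF z(1)]])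
    qed
    show "AE z in Q. norm (running (X n) (\<mu> n) z) \<le> cost_bound (fst z) (snd z)" for n
      using running_bound(1)[OF adm(1) sol(1) \<mu>(1)] by simp
  qed
  show "(\<lambda>n. \<integral>\<omega>. terminal (X n) (\<mu> n) \<omega> \<partial>P) \<longlonglongrightarrow> (\<integral>\<omega>. terminal Z \<nu> \<omega> \<partial>P)"
  proof (rule integral_dominated_convergence[OF _ _ cost_bound_integrable(2)[OF Tin]])
    show "terminal Z \<nu> \<in> borel_measurable P"
      by (rule borel_measurable_integrable[OF cost_integrable(3)[OF adm(2) sol(2) \<mu>(2)]])
    show "terminal (X n) (\<mu> n) \<in> borel_measurable P" for n
      by (rule borel_measurable_integrable[OF cost_integrable(3)[OF adm(1) sol(1) \<mu>(1)]])
    show "AE \<omega> in P. (\<lambda>n. terminal (X n) (\<mu> n) \<omega>) \<longlonglongrightarrow> terminal Z \<nu> \<omega>"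
      using conv AE_space
    proof eventually_elim
      case (elim \<omega>)
      show ?case unfolding terminal_def
        by (rule joint_continuity_limit[OF g_cont[OF elim(2)] elim(1)[rule_format, OF Tin]
              flows_prob_measures[OF fl(1) Tin] flows_prob_measures[OF fl(2) Tin] weak[OF Tin]])
    qed
    show "AE \<omega> in P. norm (terminal (X n) (\<mu> n) \<omega>) \<le> cost_bound T \<omega>" for n
      using running_bound(2)[OF adm(1) sol(1) \<mu>(1)] by simp
  qed
qed

text \<open>Each pair beats every competitor for its own flow.  In this inequality the flow-dependent costs
  converge on both sides, which bounds the control costs of the tails by the competitor up to
  \<open>\<epsilon>\<close>; the bound passes to convex combinations and then, by lower semicontinuity, to the limit.\<close>

lemma limit_optimal:
  assumes opt: "\<And>n. optimal_pair G (\<mu> n) (X n) (\<alpha> n)"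
    and conv: "AE \<omega> in P. \<forall>t\<in>{0..T}. convergent (\<lambda>n. X n t \<omega>)"
    and \<mu>: "\<And>n. tight_flow (\<mu> n)"
    and step: "\<And>n t. t \<in> {0..T} \<Longrightarrow> \<mu> (Suc n) t = distr P borel (X n t)"
    and bound: "\<And>n t. t \<in> {0..T} \<Longrightarrow> (\<integral>\<^sup>+ \<omega>. ennreal (\<psi> \<bar>X n t \<omega>\<bar>) \<partial>P) \<le> ennreal M"
  obtains \<beta> Z where "tight_flow (\<lambda>t. distr P borel (Z t))"
    and "\<And>t. t \<in> {0..T} \<Longrightarrow> weak_conv_m (\<lambda>n. \<mu> n t) (distr P borel (Z t))"
    and "optimal_pair G (\<lambda>t. distr P borel (Z t)) Z \<beta>"
    and "AE \<omega> in P. \<forall>t\<in>{0..T}. (\<lambda>n. X n t \<omega>) \<longlonglongrightarrow> Z t \<omega>"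
    and "\<And>t. t \<in> {0..T} \<Longrightarrow> distr P borel (Z t) \<in> st_interval \<psi> M"
proof -
  have adm: "\<alpha> n \<in> admissible G" and sol: "strong_solution G (\<alpha> n) (X n)" 
    and best: "\<gamma> \<in> admissible G \<Longrightarrow> strong_solution G \<gamma> Y \<Longrightarrow> J (X n) (\<alpha> n) (\<mu> n) \<le> J Y \<gamma> (\<mu> n)" for n \<gamma> Y
    using opt optimal_pair_iff[OF \<mu>] by blast+
  obtain a Y \<beta> Z where hull: "\<And>n. (a n, Y n) \<in> tail_hull (\<lambda>n. (\<alpha> n, X n)) n"
    and admZ: "\<beta> \<in> admissible G" and solZ: "strong_solution G \<beta> Z"
    and convZ: "AE \<omega> in P. \<forall>t\<in>{0..T}. (\<lambda>n. X n t \<omega>) \<longlonglongrightarrow> Z t \<omega>"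
    and convY: "AE z in Q. (\<lambda>n. Y n (fst z) (snd z)) \<longlonglongrightarrow> Z (fst z) (snd z)"
    and conva: "AE z in Q. (\<lambda>n. a n (fst z) (snd z)) \<longlonglongrightarrow> \<beta> (fst z) (snd z)"
    using limit_strong_solution[of \<alpha> X, OF adm sol conv] by blast
  let ?\<nu> = "\<lambda>t. distr P borel (Z t)"
  have convt: "AE \<omega> in P. (\<lambda>n. X n t \<omega>) \<longlonglongrightarrow> Z t \<omega>" if "t \<in> {0..T}" for t
    using convZ by eventually_elim (use that in blast)
  note Xm = strong_solution_measurable(2)[OF sol] and Zm = strong_solution_measurable(2)[OF solZ]
  have st: "?\<nu> t \<in> st_interval \<psi> M" if "t \<in> {0..T}" for t
    by (rule law_in_st_interval[OF Zm[OF that] psi_moment_limit[OF Xm[OF that] Zm[OF that] convt[OF that] bound[OF that]]])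
  have tight: "tight_flow ?\<nu>"
  proof -
    have "?\<nu> \<in> flows T" by (rule law_in_flows[OF solZ])
    then show ?thesis using st T_pos by (auto simp: tight_flow_def space_time_measure intro!: AE_I2)
  qed
  have weak: "weak_conv_m (\<lambda>n. \<mu> n t) (?\<nu> t)" if t: "t \<in> {0..T}" for t
  proof -
    have "weak_conv_m (\<lambda>n. \<mu> (Suc n) t) (?\<nu> t)"
      unfolding step[OF t] by (rule weak_conv_m_distr[OF prob_space_P Xm[OF t] Zm[OF t] convt[OF t]])
    then show ?thesis
      unfolding weak_conv_m_def weak_conv_def
      by (intro allI impI LIMSEQ_imp_Suc[where f="\<lambda>n. cdf (\<mu> n t) x" for x]) blast
  qed
  have "J Z \<beta> ?\<nu> \<le> J V \<gamma> ?\<nu>" if V: "\<gamma> \<in> admissible G" "strong_solution G \<gamma> V" for V \<gamma>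
  proof (rule field_le_epsilon)
    fix \<epsilon> :: real assume \<epsilon>: "0 < \<epsilon>"
    \<comment> \<open>The part of the cost that depends on the flow.\<close>
    define R where "R X \<mu> = (\<integral>z. running X \<mu> z \<partial>Q) + (\<integral>\<omega>. terminal X \<mu> \<omega> \<partial>P)" for X \<mu>
    have J: "J X \<alpha> \<mu> = R X \<mu> + (\<integral>z. effort X \<alpha> z \<partial>Q)" for X \<alpha> \<mu> by (simp add: J_def R_def)
    let ?B = "(J V \<gamma> ?\<nu> - R Z ?\<nu>) + \<epsilon>"
    have "(\<lambda>n. R (X n) (\<mu> n)) \<longlonglongrightarrow> R Z ?\<nu>"
      unfolding R_def by (rule flow_costs_tendsto[OF adm admZ sol solZ convZ \<mu> tight weak])
    moreover have "(\<lambda>n. R V (\<mu> n)) \<longlonglongrightarrow> R V ?\<nu>"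
      unfolding R_def by (rule flow_costs_tendsto[OF V(1) V(1) V(2) V(2) _ \<mu> tight weak]) auto
    ultimately have "(\<lambda>n. J V \<gamma> (\<mu> n) - R (X n) (\<mu> n)) \<longlonglongrightarrow> J V \<gamma> ?\<nu> - R Z ?\<nu>"
      unfolding J by (intro tendsto_intros)
    then have "\<forall>\<^sub>F n in sequentially. J V \<gamma> (\<mu> n) - R (X n) (\<mu> n) < ?B"
      by (rule order_tendstoD) (use \<epsilon> in simp)
    then obtain n0 where n0: "\<And>n. n \<ge> n0 \<Longrightarrow> J V \<gamma> (\<mu> n) - R (X n) (\<mu> n) < ?B"
      by (auto simp: eventually_sequentially)
    have eff: "(\<integral>z. effort (X n) (\<alpha> n) z \<partial>Q) \<le> ?B" if "n \<ge> n0" for n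
      using n0[OF that] best[OF V, of n] unfolding J by linarith
    have hs: "a n \<in> admissible G" "strong_solution G (a n) (Y n)" for n
      using tail_hull_strong_solution[OF adm sol hull[of n]] by auto
    have "(\<integral>z. effort Z \<beta> z \<partial>Q) \<le> ?B"
    proof (rule integral_le_of_lower_limit[where D="\<lambda>z. cost_bound (fst z) (snd z)" and h="\<lambda>n. effort (Y n) (a n)"])
      show "integrable Q (effort Z \<beta>)" by (rule cost_integrable(2)[OF admZ solZ tight])
      show "integrable Q (effort (Y n) (a n))" for n by (rule cost_integrable(2)[OF hs tight])
      show "integrable Q (\<lambda>z. cost_bound (fst z) (snd z))" by (rule cost_bound_integrable)
      show "AE z in Q. - cost_bound (fst z) (snd z) \<le> effort Z \<beta> z"
        using running_bound(3)[OF admZ solZ tight] by eventually_elim linarith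
      show "AE z in Q. - cost_bound (fst z) (snd z) \<le> effort (Y n) (a n) z" for n
        using running_bound(3)[OF hs tight, of n] by eventually_elim linarith
      show "AE z in Q. \<forall>c<effort Z \<beta> z. \<forall>\<^sub>F n in sequentially. c < effort (Y n) (a n) z"
        using convY conva AE_space
      proof eventually_elim
        case (elim z)
        obtain t \<omega> where z: "z = (t, \<omega>)" "t \<in> {0..T}" "\<omega> \<in> space P" using elim(3) by (auto simp: space_Q)
        have lim: "(\<lambda>n. (Y n t \<omega>, a n t \<omega>)) \<longlonglongrightarrow> (Z t \<omega>, \<beta> t \<omega>)"
          using elim(1,2) z by (intro tendsto_Pair) auto
        show ?case
        proof (intro allI impI)
          fix c assume "c < effort Z \<beta> z"
          then have "c < (\<lambda>(x, a). cost_l G t \<omega> x a) (Z t \<omega>, \<beta> t \<omega>)" by (simp add: effort_def z)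
          from lsc_on_sequentially[OF l_lsc[OF z(2,3)] _ _ lim this]
          have "\<forall>\<^sub>F n in sequentially. c < (\<lambda>(x, a). cost_l G t \<omega> x a) (Y n t \<omega>, a n t \<omega>)"
            using admZ hs(1) z(2,3) by (auto simp: admissible_iff)
          then show "\<forall>\<^sub>F n in sequentially. c < effort (Y n) (a n) z" by (simp add: effort_def z)
        qed
      qed
      show "\<forall>\<^sub>F n in sequentially. (\<integral>z. effort (Y n) (a n) z \<partial>Q) \<le> ?B"
        unfolding eventually_sequentially
      proof (intro exI[of _ n0] allI impI)
        fix n assume n: "n0 \<le> n"
        show "(\<integral>z. effort (Y n) (a n) z \<partial>Q) \<le> ?B"
          by (rule tail_hull_effort_le[OF adm sol tight _ hull]) (use n eff in auto)
      qed
    qed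
    then show "J Z \<beta> ?\<nu> \<le> J V \<gamma> ?\<nu> + \<epsilon>" unfolding J[of Z] by linarith
  qed
  then have "optimal_pair G ?\<nu> Z \<beta>"
    unfolding optimal_pair_iff[OF tight] using admZ solZ by blast
  then show ?thesis using that tight weak convZ st by blast
qed

section \<open>The best response on the lattice of flows\<close>

abbreviation "L \<equiv> flow_lattice G \<psi> M"

definition cls :: "(real \<Rightarrow> real measure) \<Rightarrow> (real \<Rightarrow> real measure) set" where
  "cls \<mu> = flow_eq T `` {\<mu>}"

abbreviation "flow_le \<mu> \<nu> \<equiv> AE t in pi_measure T. \<mu> t \<le>st \<nu> t"

lemma AE_pi_iff: "(AE t in pi_measure T. R t) \<longleftrightarrow> R 0 \<and> R T \<and> (AE t in time_measure T. R t)"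
  by (rule AE_pi_measure_iff[OF T_pos])

lemma AE_pi_I: "(\<And>t. t \<in> {0..T} \<Longrightarrow> R t) \<Longrightarrow> AE t in pi_measure T. R t"
  unfolding AE_pi_iff using T_pos by (auto intro!: AE_I2 simp: space_time_measure)

lemma tight_flow_of_lattice: "\<mu> \<in> lattice_flows G \<psi> M \<Longrightarrow> tight_flow \<mu>"
proof -
  assume "\<mu> \<in> lattice_flows G \<psi> M"
  then have fl: "\<mu> \<in> flows T" and ae: "AE t in pi_measure T. t \<in> {0<..T} \<longrightarrow> \<mu> t \<in> st_interval \<psi> M"
    by (auto simp: lattice_flows_def)
  \<comment> \<open>The lattice bounds the flow at positive times only; the time \<open>0\<close> is a null set for \<open>dt\<close>.\<close>
  have "AE t in time_measure T. t \<noteq> 0"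
    using AE_lborel_singleton[of "0::real"] unfolding time_measure_def
    by (subst AE_restrict_space_iff) auto
  then have "AE t in time_measure T. \<mu> t \<in> st_interval \<psi> M"
    using ae[unfolded AE_pi_iff, THEN conjunct2, THEN conjunct2] AE_space
    by eventually_elim (auto simp: space_time_measure)
  then show ?thesis using fl ae[unfolded AE_pi_iff] T_pos by (auto simp: tight_flow_def)
qed

lemma lattice_flows_flows: "\<mu> \<in> lattice_flows G \<psi> M \<Longrightarrow> \<mu> \<in> flows T"
  by (simp add: lattice_flows_def)

lemma lattice_flows_zero: "\<mu> \<in> lattice_flows G \<psi> M \<Longrightarrow> \<mu> 0 = distr P borel \<xi>"
  by (simp add: lattice_flows_def)

lemma carrier_L: "A \<in> carrier L \<longleftrightarrow> (\<exists>\<mu>\<in>lattice_flows G \<psi> M. A = cls \<mu>)"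
  by (auto simp: flow_lattice_def quotient_def cls_def)

lemma in_cls: "\<nu> \<in> cls \<mu> \<longleftrightarrow> \<mu> \<in> flows T \<and> \<nu> \<in> flows T \<and> (AE t in pi_measure T. \<mu> t = \<nu> t)"
  by (auto simp: cls_def flow_eq_def)

lemma cls_eq_iff:
  assumes "\<mu> \<in> flows T" "\<nu> \<in> flows T"
  shows "cls \<mu> = cls \<nu> \<longleftrightarrow> (AE t in pi_measure T. \<mu> t = \<nu> t)"
proof
  assume "cls \<mu> = cls \<nu>"
  moreover have "\<nu> \<in> cls \<nu>" using assms by (auto simp: in_cls)
  ultimately have "\<nu> \<in> cls \<mu>" by simp
  then show "AE t in pi_measure T. \<mu> t = \<nu> t" by (simp add: in_cls)
next
  assume eq: "AE t in pi_measure T. \<mu> t = \<nu> t"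
  have "\<rho> \<in> cls \<mu> \<longleftrightarrow> \<rho> \<in> cls \<nu>" for \<rho>
  proof -
    have "(AE t in pi_measure T. \<mu> t = \<rho> t) \<longleftrightarrow> (AE t in pi_measure T. \<nu> t = \<rho> t)"
      by (rule eventually_cong[OF eq]) auto
    then show ?thesis using assms by (simp add: in_cls)
  qed
  then show "cls \<mu> = cls \<nu>" by blast
qed

lemma le_L:
  assumes "\<mu> \<in> flows T" "\<nu> \<in> flows T"
  shows "cls \<mu> \<sqsubseteq>\<^bsub>L\<^esub> cls \<nu> \<longleftrightarrow> flow_le \<mu> \<nu>"
proof
  assume "cls \<mu> \<sqsubseteq>\<^bsub>L\<^esub> cls \<nu>"
  then obtain \<mu>' \<nu>' where "\<mu>' \<in> cls \<mu>" "\<nu>' \<in> cls \<nu>" "flow_le \<mu>' \<nu>'"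
    by (auto simp: flow_lattice_def)
  then have "AE t in pi_measure T. \<mu> t = \<mu>' t" "AE t in pi_measure T. \<nu> t = \<nu>' t" "flow_le \<mu>' \<nu>'"
    by (auto simp: in_cls)
  then show "flow_le \<mu> \<nu>" by eventually_elim simp
next
  assume "flow_le \<mu> \<nu>"
  moreover have "\<mu> \<in> cls \<mu>" "\<nu> \<in> cls \<nu>" using assms by (auto simp: in_cls)
  ultimately show "cls \<mu> \<sqsubseteq>\<^bsub>L\<^esub> cls \<nu>" unfolding flow_lattice_def by auto
qed

lemma dir_le_L:
  assumes "\<mu> \<in> flows T" "\<nu> \<in> flows T"
  shows "dir up (le L) (cls \<mu>) (cls \<nu>) \<longleftrightarrow> (AE t in pi_measure T. dir up (\<le>st) (\<mu> t) (\<nu> t))"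
  using le_L[OF assms] le_L[OF assms(2,1)] by (cases up) (auto simp: dir_def)

text \<open>The cost functional sees a flow only at almost every time and at the final time, hence only
  through its class.\<close>

lemma cost_cong_flow:
  assumes "AE t in pi_measure T. \<mu> t = \<nu> t"
  shows "cost G \<alpha> \<mu> = cost G \<alpha> \<nu>"
proof -
  have T: "\<mu> T = \<nu> T" and ae: "AE t in time_measure T. \<mu> t = \<nu> t" using assms by (auto simp: AE_pi_iff)
  have "ext_integral (time_measure T) (\<lambda>t. ereal (cost_f G t \<omega> (X t \<omega>) (\<mu> t) + cost_l G t \<omega> (X t \<omega>) (\<alpha> t \<omega>))) =
     ext_integral (time_measure T) (\<lambda>t. ereal (cost_f G t \<omega> (X t \<omega>) (\<nu> t) + cost_l G t \<omega> (X t \<omega>) (\<alpha> t \<omega>)))" for X \<omega>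
    by (rule ext_integral_cong_AE, rule eventually_mono[OF ae]) simp
  then show ?thesis by (simp add: cost_def Let_def T)
qed

lemma optimal_state_cong:
  assumes "AE t in pi_measure T. \<mu> t = \<nu> t"
  shows "optimal_state G \<mu> = optimal_state G \<nu>"
  unfolding optimal_state_def optimal_pair_def cost_cong_flow[OF assms] ..

text \<open>The best response on representatives.\<close>

definition response :: "(real \<Rightarrow> real measure) \<Rightarrow> real \<Rightarrow> real measure" where
  "response \<mu> t = distr P borel (optimal_state G \<mu> t)"

lemma best_response_cls:
  assumes "\<mu> \<in> flows T"
  shows "best_response G (cls \<mu>) = cls (response \<mu>)"
proof -
  have eq: "(\<lambda>t. distr P borel (optimal_state G \<nu> t)) = response \<mu>" if "\<nu> \<in> cls \<mu>" for \<nu>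
  proof -
    have "optimal_state G \<mu> = optimal_state G \<nu>" using that by (intro optimal_state_cong) (simp add: in_cls)
    then show ?thesis by (intro ext) (simp only: response_def)
  qed
  have "best_response G (cls \<mu>) = (\<Union>\<nu>\<in>cls \<mu>. cls (response \<mu>))"
    unfolding best_response_def cls_def[of "response \<mu>"] by (rule SUP_cong[OF refl]) (simp only: eq)
  moreover have "\<mu> \<in> cls \<mu>" using assms by (simp add: in_cls)
  ultimately show ?thesis by (simp only: UN_constant) auto
qed

lemma optimal_state_pair:
  assumes "\<mu> \<in> flows T"
  shows "\<exists>\<alpha>. optimal_pair G \<mu> (optimal_state G \<mu>) \<alpha>"
  using unique_optimum[OF assms] someI_ex[of "\<lambda>X. \<exists>\<alpha>. optimal_pair G \<mu> X \<alpha>"]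
  unfolding optimal_state_def unique_optimal_pair_def by blast

lemma optimal_state_solution:
  assumes "\<mu> \<in> flows T"
  obtains \<alpha> where "\<alpha> \<in> admissible G" "strong_solution G \<alpha> (optimal_state G \<mu>)"
  using optimal_state_pair[OF assms] by (auto simp: optimal_pair_def)

lemma optimal_state_measurable:
  assumes "\<mu> \<in> flows T" "t \<in> {0..T}"
  shows "optimal_state G \<mu> t \<in> borel_measurable P"
  by (rule optimal_state_solution[OF assms(1)]) (rule strong_solution_measurable(2)[OF _ assms(2)])

lemma strong_solution_initial:
  assumes \<alpha>: "\<alpha> \<in> admissible G" and X: "strong_solution G \<alpha> X"
  shows "distr P borel (X 0) = distr P borel \<xi>"
proof (rule distr_cong_AE)
  show "AE \<omega> in P. X 0 \<omega> = \<xi> \<omega>"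
    using X[unfolded strong_solution_iff[OF \<alpha>], THEN conjunct2, THEN conjunct2] AE_space
  proof eventually_elim
    case (elim \<omega>)
    have "(LBINT s:{0..0}. rate \<alpha> X s \<omega>) = 0"
      unfolding set_lebesgue_integral_def
      by (rule integral_eq_zero_AE, rule AE_mp[OF AE_lborel_singleton[of 0]]) (auto simp: indicator_def)
    then show ?case using elim T_pos W_zero by auto
  qed
qed (use strong_solution_measurable(2)[OF X] T_pos in auto)

lemma response_lattice_flow:
  assumes "\<mu> \<in> flows T"
  shows "response \<mu> \<in> lattice_flows G \<psi> M"
proof -
  obtain \<alpha> where \<alpha>: "\<alpha> \<in> admissible G" "strong_solution G \<alpha> (optimal_state G \<mu>)"
    by (rule optimal_state_solution[OF assms])
  have "response \<mu> \<in> flows T" unfolding response_def[abs_def] by (rule law_in_flows[OF \<alpha>(2)])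
  moreover have "AE t in pi_measure T. t \<in> {0<..T} \<longrightarrow> response \<mu> t \<in> st_interval \<psi> M"
    by (rule AE_pi_I) (auto simp: response_def intro!: law_in_st_interval strong_solution_measurable[OF \<alpha>(2)] psi_bound assms)
  moreover have "response \<mu> 0 = distr P borel \<xi>"
    unfolding response_def by (rule strong_solution_initial[OF \<alpha>])
  ultimately show ?thesis by (simp add: lattice_flows_def)
qed

lemma optimal_state_dir:
  assumes \<mu>: "\<mu> \<in> lattice_flows G \<psi> M" and \<nu>: "\<nu> \<in> lattice_flows G \<psi> M"
    and le: "AE t in pi_measure T. dir up (\<le>st) (\<mu> t) (\<nu> t)"
  shows "AE \<omega> in P. \<forall>t\<in>{0..T}. dir up (\<le>) (optimal_state G \<mu> t \<omega>) (optimal_state G \<nu> t \<omega>)"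
proof -
  have le': "AE t in time_measure T. dir up (\<le>st) (\<mu> t) (\<nu> t)" "dir up (\<le>st) (\<mu> T) (\<nu> T)"
    using le by (auto simp: AE_pi_iff)
  note t = tight_flow_of_lattice[OF \<mu>] tight_flow_of_lattice[OF \<nu>]
  obtain \<alpha> \<beta> where "optimal_pair G \<mu> (optimal_state G \<mu>) \<alpha>" "optimal_pair G \<nu> (optimal_state G \<nu>) \<beta>"
    using optimal_state_pair[OF lattice_flows_flows[OF \<mu>]] optimal_state_pair[OF lattice_flows_flows[OF \<nu>]] by blast
  then show ?thesis
    using optimal_state_mono[OF t] optimal_state_mono[OF t(2,1)] le' by (cases up) (auto simp: dir_def)
qed

lemma dir_law:
  assumes "Y \<in> borel_measurable P" "Z \<in> borel_measurable P" "AE \<omega> in P. dir up (\<le>) (Y \<omega>) (Z \<omega>)"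
  shows "dir up (\<le>st) (distr P borel Y) (distr P borel Z)"
  using assms st_le_distr[OF prob_space_P] by (cases up) (auto simp: dir_def)

lemma response_dir:
  assumes \<mu>: "\<mu> \<in> lattice_flows G \<psi> M" and \<nu>: "\<nu> \<in> lattice_flows G \<psi> M"
    and le: "AE t in pi_measure T. dir up (\<le>st) (\<mu> t) (\<nu> t)" and t: "t \<in> {0..T}"
  shows "dir up (\<le>st) (response \<mu> t) (response \<nu> t)"
  unfolding response_def
proof (rule dir_law)
  show "AE \<omega> in P. dir up (\<le>) (optimal_state G \<mu> t \<omega>) (optimal_state G \<nu> t \<omega>)"
    using optimal_state_dir[OF \<mu> \<nu> le] by eventually_elim (use t in blast)
qed (rule optimal_state_measurable[OF lattice_flows_flows[OF \<mu>] t] optimal_state_measurable[OF lattice_flows_flows[OF \<nu>] t])+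

section \<open>Iteration from an extreme flow\<close>

text \<open>Everything is deduced from the pathwise order of the optimal states: it gives their convergence, the
  monotonicity of the laws, and the comparison of the limit with any other solution.\<close>

lemma iteration_from_extreme:
  fixes S :: "nat \<Rightarrow> (real \<Rightarrow> real measure) set"
  assumes S0: "S 0 \<in> carrier L" and extreme: "\<And>A. A \<in> carrier L \<Longrightarrow> dir up (le L) (S 0) A"
    and Suc: "\<And>n. S (Suc n) = best_response G (S n)"
  shows "\<forall>n. S n \<in> carrier L" and "\<forall>m n. m \<le> n \<longrightarrow> dir up (le L) (S m) (S n)"
    and "\<exists>B\<in>mfg_solutions G \<psi> M. (\<forall>A\<in>mfg_solutions G \<psi> M. dir up (le L) B A) \<and> weak_conv_ae T S B"
proof -
  obtain m0 where m0: "m0 \<in> lattice_flows G \<psi> M" "S 0 = cls m0" using S0 carrier_L by blast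
  define m where "m n = (response ^^ n) m0" for n
  have mS: "m n \<in> lattice_flows G \<psi> M \<and> S n = cls (m n)" for n
  proof (induction n)
    case 0
    then show ?case using m0 by (simp add: m_def)
  next
    case (Suc n)
    then show ?case
      using response_lattice_flow[OF lattice_flows_flows, of "m n"] best_response_cls[OF lattice_flows_flows, of "m n"]
      by (simp add: m_def assms(3))
  qed
  have mL: "m n \<in> lattice_flows G \<psi> M" and Sm: "S n = cls (m n)" and mF: "m n \<in> flows T" for n
    using mS[of n] lattice_flows_flows by auto
  have mSuc: "m (Suc n) = response (m n)" for n by (simp add: m_def)
  show carr: "\<forall>n. S n \<in> carrier L" using mS carrier_L by blast
  \<comment> \<open>Extremality of the starting point is used twice: to start the monotonicity of the iteration,
    and to start the comparison with another solution.\<close>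
  have below: "AE t in pi_measure T. dir up (\<le>st) (m 0 t) (\<nu> t)" if "\<nu> \<in> lattice_flows G \<psi> M" for \<nu>
    using extreme[of "cls \<nu>"] that Sm[of 0] dir_le_L[OF mF lattice_flows_flows[OF that], of up 0] carrier_L by auto
  have step: "AE t in pi_measure T. dir up (\<le>st) (m n t) (m (Suc n) t)" for n
  proof (induction n)
    case 0
    show ?case by (rule below[OF mL])
  next
    case (Suc n)
    show ?case by (rule AE_pi_I) (use response_dir[OF mL mL Suc] mSuc in auto)
  qed
  then have steps: "AE t in pi_measure T. \<forall>n. dir up (\<le>st) (m n t) (m (Suc n) t)"
    by (simp add: AE_all_countable)
  show "\<forall>m n. m \<le> n \<longrightarrow> dir up (le L) (S m) (S n)"
  proof (intro allI impI)
    fix i j :: nat assume ij: "i \<le> j"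
    have "AE t in pi_measure T. dir up (\<le>st) (m i t) (m j t)"
      using steps by eventually_elim (rule dir_st_le_chain, use ij in auto)
    then show "dir up (le L) (S i) (S j)" unfolding Sm using dir_le_L[OF mF mF] by blast
  qed
  define X where "X n = optimal_state G (m n)" for n
  have "\<exists>\<alpha>. \<forall>n. optimal_pair G (m n) (X n) (\<alpha> n)"
    using optimal_state_pair[OF mF] unfolding X_def by (intro choice) blast
  then obtain \<alpha> where opt: "\<And>n. optimal_pair G (m n) (X n) (\<alpha> n)" by blast
  have adm: "\<alpha> n \<in> admissible G" and sol: "strong_solution G (\<alpha> n) (X n)" for n
    using opt[of n] by (auto simp: optimal_pair_def)
  have Xmono: "AE \<omega> in P. \<forall>n. \<forall>t\<in>{0..T}. dir up (\<le>) (X n t \<omega>) (X (Suc n) t \<omega>)"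
    unfolding AE_all_countable X_def using optimal_state_dir[OF mL mL step] by blast
  have Xbound: "AE \<omega> in P. \<forall>n. \<forall>t\<in>{0..T}. \<bar>X n t \<omega>\<bar> \<le> envelope t \<omega>"
    unfolding AE_all_countable using strong_solution_bound[OF adm sol] by blast
  have conv: "AE \<omega> in P. \<forall>t\<in>{0..T}. convergent (\<lambda>n. X n t \<omega>)"
    using Xmono Xbound
  proof eventually_elim
    case (elim \<omega>)
    show ?case
    proof
      fix t assume "t \<in> {0..T}"
      then show "convergent (\<lambda>n. X n t \<omega>)"
        using elim by (intro dir_bounded_convergent[of up _ "envelope t \<omega>"]) auto
    qed
  qed
  obtain \<beta> Z where tight: "tight_flow (\<lambda>t. distr P borel (Z t))"
    and weak: "\<And>t. t \<in> {0..T} \<Longrightarrow> weak_conv_m (\<lambda>n. m n t) (distr P borel (Z t))"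
    and optZ: "optimal_pair G (\<lambda>t. distr P borel (Z t)) Z \<beta>"
    and convZ: "AE \<omega> in P. \<forall>t\<in>{0..T}. (\<lambda>n. X n t \<omega>) \<longlonglongrightarrow> Z t \<omega>"
    and stZ: "\<And>t. t \<in> {0..T} \<Longrightarrow> distr P borel (Z t) \<in> st_interval \<psi> M"
  proof (rule limit_optimal[of m X \<alpha>, OF opt conv tight_flow_of_lattice[OF mL]])
    show "m (Suc n) t = distr P borel (X n t)" for n t by (simp add: mSuc response_def X_def)
    show "(\<integral>\<^sup>+ \<omega>. ennreal (\<psi> \<bar>X n t \<omega>\<bar>) \<partial>P) \<le> ennreal M" if "t \<in> {0..T}" for n t
      unfolding X_def by (rule psi_bound[OF mF that])
  qed blast
  define \<nu> where "\<nu> t = distr P borel (Z t)" for t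
  have admZ: "\<beta> \<in> admissible G" and solZ: "strong_solution G \<beta> Z" using optZ by (auto simp: optimal_pair_def)
  have \<nu>F: "\<nu> \<in> flows T" using tight by (simp add: tight_flow_def \<nu>_def[abs_def])
  have \<nu>L: "\<nu> \<in> lattice_flows G \<psi> M"
    using \<nu>F stZ strong_solution_initial[OF admZ solZ]
    by (auto simp: lattice_flows_def \<nu>_def intro!: AE_pi_I)
  have Zopt: "AE \<omega> in P. \<forall>t\<in>{0..T}. Z t \<omega> = optimal_state G \<nu> t \<omega>"
  proof -
    obtain \<gamma> where "optimal_pair G \<nu> (optimal_state G \<nu>) \<gamma>" using optimal_state_pair[OF \<nu>F] by blast
    then show ?thesis using optimal_pair_unique[OF \<nu>F] optZ by (simp add: \<nu>_def[abs_def])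
  qed
  have fixed: "response \<nu> t = \<nu> t" if t: "t \<in> {0..T}" for t
    unfolding response_def \<nu>_def[of t]
  proof (rule distr_cong_AE)
    show "AE \<omega> in P. optimal_state G \<nu> t \<omega> = Z t \<omega>"
      using Zopt by eventually_elim (use t in auto)
  qed (rule refl optimal_state_measurable[OF \<nu>F t] strong_solution_measurable(2)[OF solZ t])+
  have "AE t in pi_measure T. response \<nu> t = \<nu> t" by (rule AE_pi_I[OF fixed])
  then have "cls (response \<nu>) = cls \<nu>"
    using cls_eq_iff[OF lattice_flows_flows[OF response_lattice_flow[OF \<nu>F]] \<nu>F] by simp
  then have solution: "cls \<nu> \<in> mfg_solutions G \<psi> M"
    using \<nu>L best_response_cls[OF \<nu>F] carrier_L by (auto simp: mfg_solutions_def)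
  moreover have "dir up (le L) (cls \<nu>) A" if A: "A \<in> mfg_solutions G \<psi> M" for A
  proof -
    obtain \<rho> where \<rho>: "\<rho> \<in> lattice_flows G \<psi> M" "A = cls \<rho>" "best_response G A = A"
      using A carrier_L by (auto simp: mfg_solutions_def)
    note \<rho>F = lattice_flows_flows[OF \<rho>(1)]
    have \<rho>fix: "AE t in pi_measure T. response \<rho> t = \<rho> t"
      using \<rho>(2,3) best_response_cls[OF \<rho>F] cls_eq_iff[OF lattice_flows_flows[OF response_lattice_flow[OF \<rho>F]] \<rho>F] by simp
    have m\<rho>: "AE t in pi_measure T. dir up (\<le>st) (m n t) (\<rho> t)" for n
    proof (induction n)
      case 0
      show ?case by (rule below[OF \<rho>(1)])
    next
      case (Suc n)
      have "AE t in pi_measure T. dir up (\<le>st) (m (Suc n) t) (response \<rho> t)"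
        by (rule AE_pi_I) (use response_dir[OF mL \<rho>(1) Suc] mSuc in auto)
      then show ?case using \<rho>fix by eventually_elim simp
    qed
    have "AE \<omega> in P. \<forall>n. \<forall>t\<in>{0..T}. dir up (\<le>) (X n t \<omega>) (optimal_state G \<rho> t \<omega>)"
      unfolding AE_all_countable X_def using optimal_state_dir[OF mL \<rho>(1) m\<rho>] by blast
    then have Z\<rho>: "AE \<omega> in P. \<forall>t\<in>{0..T}. dir up (\<le>) (Z t \<omega>) (optimal_state G \<rho> t \<omega>)"
      using convZ
    proof eventually_elim
      case (elim \<omega>)
      show ?case
      proof
        fix t assume t: "t \<in> {0..T}"
        show "dir up (\<le>) (Z t \<omega>) (optimal_state G \<rho> t \<omega>)"
          by (rule dir_limit[of "\<lambda>n. X n t \<omega>"]) (use elim t in auto)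
      qed
    qed
    have "dir up (\<le>st) (\<nu> t) (response \<rho> t)" if t: "t \<in> {0..T}" for t
      unfolding \<nu>_def response_def
    proof (rule dir_law[OF strong_solution_measurable(2)[OF solZ t] optimal_state_measurable[OF \<rho>F t]])
      show "AE \<omega> in P. dir up (\<le>) (Z t \<omega>) (optimal_state G \<rho> t \<omega>)"
        using Z\<rho> by eventually_elim (use t in blast)
    qed
    then have "AE t in pi_measure T. dir up (\<le>st) (\<nu> t) (response \<rho> t)" by (rule AE_pi_I)
    then have "AE t in pi_measure T. dir up (\<le>st) (\<nu> t) (\<rho> t)" using \<rho>fix by eventually_elim simp
    then show ?thesis unfolding \<rho>(2) using dir_le_L[OF \<nu>F \<rho>F] by blast
  qed
  moreover have "weak_conv_ae T S (cls \<nu>)"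
    unfolding weak_conv_ae_def
  proof (intro allI impI)
    fix \<mu>' \<nu>' assume a: "\<forall>n. \<mu>' n \<in> S n" "\<nu>' \<in> cls \<nu>"
    have 1: "AE t in pi_measure T. \<forall>n. m n t = \<mu>' n t"
      unfolding AE_all_countable using a(1) by (auto simp: Sm in_cls)
    have 2: "AE t in pi_measure T. \<nu> t = \<nu>' t" using a(2) by (auto simp: in_cls)
    have 3: "AE t in pi_measure T. weak_conv_m (\<lambda>n. m n t) (\<nu> t)"
      using weak by (intro AE_pi_I) (simp add: \<nu>_def)
    show "AE t in pi_measure T. weak_conv_m (\<lambda>n. \<mu>' n t) (\<nu>' t)"
      using 1 2 3 by eventually_elim simp
  qed
  ultimately show "\<exists>B\<in>mfg_solutions G \<psi> M. (\<forall>A\<in>mfg_solutions G \<psi> M. dir up (le L) B A) \<and> weak_conv_ae T S B"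
    by blast
qed

text \<open>All flows of the lattice agree at time \<open>0\<close>, which \<open>\<pi>\<close> charges, so an extreme flow has to start
  from the law of the initial state.\<close>

definition extreme_flow :: "real measure \<Rightarrow> real \<Rightarrow> real measure" where
  "extreme_flow \<mu> t = (if t = 0 then distr P borel \<xi> else \<mu>)"

lemma extreme_flow_lattice:
  assumes "\<mu> \<in> st_interval \<psi> M"
  shows "extreme_flow \<mu> \<in> lattice_flows G \<psi> M"
proof -
  have "\<mu> \<in> prob_measures" using assms by (simp add: st_interval_def)
  moreover have "distr P borel \<xi> \<in> prob_measures"
    by (auto simp: space_prob_algebra intro: P.prob_space_distr)
  moreover have "{t \<in> space (restrict_space borel {0..T}). t = 0} \<in> sets (restrict_space borel {0..T})"
    using T_pos by (auto simp: sets_restrict_space space_restrict_space intro!: image_eqI[of _ _ "{0}"])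
  ultimately have "extreme_flow \<mu> \<in> flows T"
    unfolding flows_def extreme_flow_def by (intro measurable_If measurable_const)
  then show ?thesis
    using assms by (auto simp: lattice_flows_def extreme_flow_def intro!: AE_pi_I)
qed

lemma mu_Min_interval: "mu_Min \<psi> M \<in> st_interval \<psi> M" and mu_Max_interval: "mu_Max \<psi> M \<in> st_interval \<psi> M"
proof -
  have M0: "0 < M" using psi(1,5) by (meson le_less_trans order_refl)
  have "mu_Min \<psi> M \<le>st mu_Max \<psi> M"
    unfolding st_le_def cdf_mu_Min[OF psi(2,3,1,4,5)] cdf_mu_Max[OF psi(2,3,1,4,5)]
    using M0 psi(1,5) by (auto simp: max_def)
  then show "mu_Min \<psi> M \<in> st_interval \<psi> M" "mu_Max \<psi> M \<in> st_interval \<psi> M"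
    using prob_measures_mu_Min_mu_Max[OF psi(2,3,1,4,5)] by (auto simp: st_interval_def st_le_refl)
qed

lemma extreme_flow_bounds:
  assumes \<mu>: "\<mu> \<in> lattice_flows G \<psi> M"
  shows "flow_le (extreme_flow (mu_Min \<psi> M)) \<mu>" and "flow_le \<mu> (extreme_flow (mu_Max \<psi> M))"
proof -
  have "AE t in pi_measure T. t \<in> {0<..T} \<longrightarrow> \<mu> t \<in> st_interval \<psi> M"
    using \<mu> by (simp add: lattice_flows_def)
  moreover have "AE t in pi_measure T. t \<in> {0..T}" by (rule AE_pi_I)
  ultimately have "AE t in pi_measure T. extreme_flow (mu_Min \<psi> M) t \<le>st \<mu> t \<and> \<mu> t \<le>st extreme_flow (mu_Max \<psi> M) t"
  proof eventually_elim
    case (elim t)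
    then show ?case using lattice_flows_zero[OF \<mu>]
      by (cases "t = 0") (auto simp: extreme_flow_def st_le_refl st_interval_def)
  qed
  then show "flow_le (extreme_flow (mu_Min \<psi> M)) \<mu>" "flow_le \<mu> (extreme_flow (mu_Max \<psi> M))" by auto
qed

text \<open>The infimum is a choice among greatest lower bounds.  The extreme flow shows that there is one,
  so the chosen element is a lower bound of the whole carrier.\<close>

lemma inf_carrier: "\<Sqinter>\<^bsub>L\<^esub> (carrier L) \<in> carrier L" "A \<in> carrier L \<Longrightarrow> \<Sqinter>\<^bsub>L\<^esub> (carrier L) \<sqsubseteq>\<^bsub>L\<^esub> A"
proof -
  let ?b = "extreme_flow (mu_Min \<psi> M)"
  have b: "?b \<in> lattice_flows G \<psi> M" by (rule extreme_flow_lattice[OF mu_Min_interval])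
  have bL: "cls ?b \<in> carrier L" using b carrier_L by blast
  have "cls ?b \<sqsubseteq>\<^bsub>L\<^esub> B" if "B \<in> carrier L" for B
    using that extreme_flow_bounds(1) le_L lattice_flows_flows b by (auto simp: carrier_L)
  then have "greatest L (cls ?b) (Lower L (carrier L))"
    using bL by (auto simp: greatest_def Lower_def)
  then have "greatest L (\<Sqinter>\<^bsub>L\<^esub> (carrier L)) (Lower L (carrier L))"
    unfolding Lattice.inf_def by (rule someI)
  then show "\<Sqinter>\<^bsub>L\<^esub> (carrier L) \<in> carrier L" "A \<in> carrier L \<Longrightarrow> \<Sqinter>\<^bsub>L\<^esub> (carrier L) \<sqsubseteq>\<^bsub>L\<^esub> A"
    by (auto simp: greatest_def Lower_def)
qed

lemma sup_carrier: "\<Squnion>\<^bsub>L\<^esub> (carrier L) \<in> carrier L" "A \<in> carrier L \<Longrightarrow> A \<sqsubseteq>\<^bsub>L\<^esub> \<Squnion>\<^bsub>L\<^esub> (carrier L)"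
proof -
  let ?b = "extreme_flow (mu_Max \<psi> M)"
  have b: "?b \<in> lattice_flows G \<psi> M" by (rule extreme_flow_lattice[OF mu_Max_interval])
  have bL: "cls ?b \<in> carrier L" using b carrier_L by blast
  have "B \<sqsubseteq>\<^bsub>L\<^esub> cls ?b" if "B \<in> carrier L" for B
    using that extreme_flow_bounds(2) le_L lattice_flows_flows b by (auto simp: carrier_L)
  then have "least L (cls ?b) (Upper L (carrier L))"
    using bL by (auto simp: least_def Upper_def)
  then have "least L (\<Squnion>\<^bsub>L\<^esub> (carrier L)) (Upper L (carrier L))"
    unfolding Lattice.sup_def by (rule someI)
  then show "\<Squnion>\<^bsub>L\<^esub> (carrier L) \<in> carrier L" "A \<in> carrier L \<Longrightarrow> A \<sqsubseteq>\<^bsub>L\<^esub> \<Squnion>\<^bsub>L\<^esub> (carrier L)"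
    by (auto simp: least_def Upper_def)
qed

end

section \<open>Convergence of the best-response iteration\<close>

theorem theorem2p16:
  fixes G :: "'a mfg"
    and \<psi> c p q :: "real \<Rightarrow> real"
    and M r C :: real
    and lo up :: "nat \<Rightarrow> (real \<Rightarrow> real measure) set"
  assumes game: "mfg_game G"
    and A1: "\<forall>\<mu>\<in>flows (horizon G). unique_optimal_pair G \<mu>"
    and A2_psi: "\<forall>s\<ge>0. \<psi> s \<ge> 0" "continuous_on {0..} \<psi>" "strict_mono_on {0..} \<psi>"
      "filterlim \<psi> at_top at_top" "M > \<psi> 0"
    and A2_bound: "\<forall>\<mu>\<in>flows (horizon G). \<forall>t\<in>{0..horizon G}.
      (\<integral>\<^sup>+ \<omega>. ennreal (\<psi> \<bar>optimal_state G \<mu> t \<omega>\<bar>) \<partial>prob_sp G) \<le> ennreal M"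
    and B: "AE (t, \<omega>) in time_measure (horizon G) \<Otimes>\<^sub>M prob_sp G.
      \<forall>\<phi>\<in>{cost_f G t \<omega>, cost_g G \<omega>}. submodular \<phi>"
    and C1: "compact (control_set G)" "r > 1" "integrable (prob_sp G) (\<lambda>\<omega>. \<bar>init_state G \<omega>\<bar> powr r)"
    and C2: "\<forall>t\<in>{0..horizon G}. \<forall>x. \<forall>a\<in>control_set G. drift G t x a = c t + p t * x + q t * a"
      "continuous_on {0..horizon G} c" "continuous_on {0..horizon G} p"
      "continuous_on {0..horizon G} q"
    and C3_f: "\<forall>t\<in>{0..horizon G}. \<forall>\<omega>\<in>space (prob_sp G).
      continuous_map (prod_topology euclidean weak_topology) euclidean (\<lambda>(x, \<mu>). cost_f G t \<omega> x \<mu>)"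
    and C3_g: "\<forall>\<omega>\<in>space (prob_sp G).
      continuous_map (prod_topology euclidean weak_topology) euclidean (\<lambda>(x, \<mu>). cost_g G \<omega> x \<mu>)"
    and C3_l: "\<forall>t\<in>{0..horizon G}. \<forall>\<omega>\<in>space (prob_sp G).
      convex_on (UNIV \<times> control_set G) (\<lambda>(x, a). cost_l G t \<omega> x a) \<and>
      lsc_on (UNIV \<times> control_set G) (\<lambda>(x, a). cost_l G t \<omega> x a)"
    and C4: "C > 0" "\<forall>\<omega>\<in>space (prob_sp G). \<forall>t\<in>{0..horizon G}. \<forall>x. \<forall>a\<in>control_set G.
      \<forall>\<mu>\<in>st_interval \<psi> M.
        \<bar>cost_f G t \<omega> x \<mu>\<bar> + \<bar>cost_l G t \<omega> x a\<bar> + \<bar>cost_g G \<omega> x \<mu>\<bar> \<le> C * (1 + \<bar>x\<bar> powr r)"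
    and lo: "lo 0 = \<Sqinter>\<^bsub>flow_lattice G \<psi> M\<^esub> (carrier (flow_lattice G \<psi> M))"
      "\<forall>n. lo (Suc n) = best_response G (lo n)"
    and up: "up 0 = \<Squnion>\<^bsub>flow_lattice G \<psi> M\<^esub> (carrier (flow_lattice G \<psi> M))"
      "\<forall>n. up (Suc n) = best_response G (up n)"
  shows "((\<forall>n. lo n \<in> carrier (flow_lattice G \<psi> M)) \<and>
         (\<forall>m n. m \<le> n \<longrightarrow> lo m \<sqsubseteq>\<^bsub>flow_lattice G \<psi> M\<^esub> lo n) \<and>
         (\<exists>S. least (flow_lattice G \<psi> M) S (mfg_solutions G \<psi> M) \<and>
              weak_conv_ae (horizon G) lo S)) \<and>
         ((\<forall>n. up n \<in> carrier (flow_lattice G \<psi> M)) \<and>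
         (\<forall>m n. m \<le> n \<longrightarrow> up n \<sqsubseteq>\<^bsub>flow_lattice G \<psi> M\<^esub> up m) \<and>
         (\<exists>S. greatest (flow_lattice G \<psi> M) S (mfg_solutions G \<psi> M) \<and>
              weak_conv_ae (horizon G) up S))"
proof -
  interpret mfg_setting G \<psi> c p q M r C
  proof (rule mfg_setting.intro)
    show "mfg_game G" by (rule game)
    show "unique_optimal_pair G \<mu>" if "\<mu> \<in> flows (horizon G)" for \<mu>
      using A1 that by blast
    show "\<forall>s\<ge>0. 0 \<le> \<psi> s" "continuous_on {0..} \<psi>" "strict_mono_on {0..} \<psi>"
      "filterlim \<psi> at_top at_top" "\<psi> 0 < M"
      by (rule A2_psi)+
    show "(\<integral>\<^sup>+ \<omega>. ennreal (\<psi> \<bar>optimal_state G \<mu> t \<omega>\<bar>) \<partial>prob_sp G) \<le> ennreal M"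
      if "\<mu> \<in> flows (horizon G)" "t \<in> {0..horizon G}" for \<mu> t
      using A2_bound that by blast
    show "compact (control_set G)" "1 < r" "integrable (prob_sp G) (\<lambda>\<omega>. \<bar>init_state G \<omega>\<bar> powr r)"
      by (rule C1)+
    show "drift G t x a = c t + p t * x + q t * a"
      if "t \<in> {0..horizon G}" "a \<in> control_set G" for t x a
      using C2(1) that by blast
    show "continuous_on {0..horizon G} c" "continuous_on {0..horizon G} p" "continuous_on {0..horizon G} q"
      by (rule C2(2-4))+
    show "\<bar>cost_f G t \<omega> x \<mu>\<bar> + \<bar>cost_l G t \<omega> x a\<bar> + \<bar>cost_g G \<omega> x \<mu>\<bar> \<le> C * (1 + \<bar>x\<bar> powr r)"
      if "\<omega> \<in> space (prob_sp G)" "t \<in> {0..horizon G}" "a \<in> control_set G" "\<mu> \<in> st_interval \<psi> M"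
      for \<omega> t x a \<mu>
      using C4(2) that by blast
  qed (use B C3_f C3_g C3_l C4(1) in blast)+
  have lower: "dir True (le L) (lo 0) A" if "A \<in> carrier L" for A
    using inf_carrier(2)[OF that] by (simp add: lo(1) dir_def)
  have upper: "dir False (le L) (up 0) A" if "A \<in> carrier L" for A
    using sup_carrier(2)[OF that] by (simp add: up(1) dir_def)
  have "lo 0 \<in> carrier L" "up 0 \<in> carrier L"
    using inf_carrier(1) sup_carrier(1) by (simp_all add: lo(1) up(1))
  note iter = iteration_from_extreme[of lo, OF this(1) lower lo(2)[rule_format]]
    iteration_from_extreme[of up, OF this(2) upper up(2)[rule_format]]
  have "mfg_solutions G \<psi> M \<subseteq> carrier L" by (auto simp: mfg_solutions_def)
  with iter show ?thesis unfolding least_def greatest_def dir_def if_True if_False by blast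
qed

end
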